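(* Let $\{X_n;n\ge 1\}$ be a sequence of independent random variables in a sub-linear expectation space $(\Omega,\mathscr H,\widehat{\mathbb E})$ with $\widehat{\mathbb E}[X_n^2]<\infty$ for all $n$, and let $\mathbb V$ be a sub-additive capacity on $\mathcal F$ satisfying the compatibility property (C). Put $S_n=\sum_{i=1}^nX_i$, $s_n^2=\sum_{k=1}^n\widehat{\mathbb E}[X_k^2]$, $t_n=\sqrt{2\log\log s_n^2}$, $a_n=s_nt_n$, and $$\Gamma_n(p,\alpha)=\widehat{\mathbb E}\Big[\big((|X_n|-\alpha s_n/t_n)^+\big)^p\Big],\qquad \Lambda_n(p,\alpha)=\sum_{j=1}^n\widehat{\mathbb E}\Big[\big((|X_j|-\alpha s_n/t_n)^+\big)^p\Big].$$ Suppose that $\sum_{n=1}^\infty\mathbb V(|X_n|\ge\epsilon a_n)<\infty$ for all $\epsilon>0$; that for every $\alpha>0$ there exist some $p\ge2$ and $d\ge0$ such that $$\sum_{n=1}^\infty\frac{\Gamma_n(p,\alpha)}{a_n^p}\left(\frac{\Lambda_n(p,\alpha)}{a_n^p}\right)^d<\infty;$$ and further that $$\sum_{n=1}^\infty s_n^{-2}(\log s_n^2)^{\delta-1}\widehat{\mathbb E}[X_n^2]=\infty\ \text{ for all }\delta>0,\qquad \frac{\sum_{j=1}^n|\widehat{\mathbb E}[X_j]|+\sum_{j=1}^n|\widehat{\mathcal E}[X_j]|}{a_n}\to0.$$ Then for every $\epsilon>0$, $$\lim_{n\to\infty}\max_N\mathbb V\Big(\max_{n\le m\le N}\frac{|S_m|}{a_m}>1+\epsilon\Big)=0,$$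 $$\lim_{n\to\infty}\max_N\mathbb V\Big(\max_{n\le m\le N}\frac{-S_m}{a_m}\ge1-\epsilon\Big)=\lim_{n\to\infty}\max_N\mathbb V\Big(\max_{n\le m\le N}\frac{S_m}{a_m}\ge1-\epsilon\Big)=1.$$ Further, with $\widehat{\mathbb V}^*$ the countably sub-additive extension of $\widehat{\mathbb V}$, $$\widehat{\mathbb V}^*\Big(\limsup_{n\to\infty}\frac{|S_n|}{a_n}>1\Big)=0.$$
   Context: Sub-linear expectation space: $(\Omega,\mathcal F)$ is a measurable space and $\mathscr H$ is a linear space of real measurable functions on it such that $\varphi(X_1,\dots,X_n)\in\mathscr H$ whenever $X_1,\dots,X_n\in\mathscr H$ and $\varphi\in C_{l,Lip}(\mathbb R^n)$, where $C_{l,Lip}(\mathbb R^n)$ is the set of $\varphi$ with $|\varphi(x)-\varphi(y)|\le C(1+|x|^m+|y|^m)|x-y|$ for some $C>0$, $m\in\mathbb N$ depending on $\varphi$. A sub-linear expectation is a map $\widehat{\mathbb E}:\mathscr H\to[-\infty,\infty]$ such that: $X\ge Y$ implies $\widehat{\mathbb E}[X]\ge\widehat{\mathbb E}[Y]$; $\widehat{\mathbb E}[c]=c$ for constants $c$; $\widehat{\mathbb E}[X+Y]\le\widehat{\mathbb E}[X]+\widehat{\mathbb E}[Y]$ whenever the right side is not of the form $\infty-\infty$; $\widehat{\mathbb E}[\lambda X]=\lambda\widehat{\mathbb E}[X]$ for $\lambda\ge0$ (with $0\cdot\infty=0$). The conjugate expectation is $\widehat{\mathcal E}[X]=-\widehat{\mathbb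 E}[-X]$. Elements of $\mathscr H$ are called random variables. Independence: a random vector $\bm Y\in\mathscr H^n$ is independent to $\bm X\in\mathscr H^m$ if $\widehat{\mathbb E}[\varphi(\bm X,\bm Y)]=\widehat{\mathbb E}\big[\widehat{\mathbb E}[\varphi(\bm x,\bm Y)]|_{\bm x=\bm X}\big]$ for each $\varphi\in C_{l,Lip}(\mathbb R^m\times\mathbb R^n)$ with $\overline\varphi(\bm x):=\widehat{\mathbb E}[|\varphi(\bm x,\bm Y)|]<\infty$ for all $\bm x$ and $\widehat{\mathbb E}[|\overline\varphi(\bm X)|]<\infty$. A sequence $\{X_n\}$ is independent if $X_{i+1}$ is independent to $(X_1,\dots,X_i)$ for each $i\ge1$. Capacities: a capacity is a monotone set function $V:\mathcal F\to[0,1]$ with $V(\emptyset)=0$, $V(\Omega)=1$; it is sub-additive if $V(A\cup B)\le V(A)+V(B)$. Property (C) for $\mathbb V$: $\widehat{\mathbb E}[f]\le\mathbb V(A)\le\widehat{\mathbb E}[g]$ whenever $f\le I_A\le g$, $f,g\in\mathscr H$, $A\in\mathcal F$. Define $\widehat{\mathbb V}(A)=\inf\{\widehat{\mathbb E}[\xi]:I_A\le\xi,\ \xi\in\mathscr H\}$ and $\widehat{\mathbb V}^*(A)=\inf\{\sum_{n=1}^\infty\widehat{\mathbb V}(A_n):A\subset\bigcup_{n=1}^\infty A_n\}$, $A,A_n\in\mathcal F$. Conventions: $\log x=\ln\max(e,x)$; $x^+=\max(x,0)$; $\max_N$ denotes the supremum over integers $N\ge n$. *)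

theory Defs
  imports "HOL-Analysis.Analysis"
begin

text \<open>
  A point of \<open>\<real>\<^sup>n\<close> is represented by a function \<open>x :: nat \<Rightarrow> real\<close> of which only the coordinates
  \<open>x 0, \<dots>, x (n - 1)\<close> matter; its Euclidean norm is \<open>L2_set x {..<n}\<close>.  The inequality below forces
  \<open>\<phi> x = \<phi> y\<close> whenever \<open>x\<close> and \<open>y\<close> agree on \<open>{..<n}\<close>, so that \<open>\<phi>\<close> really is a function on \<open>\<real>\<^sup>n\<close>.
\<close>

definition C_lLip :: "nat \<Rightarrow> ((nat \<Rightarrow> real) \<Rightarrow> real) set" where
  "C_lLip n = {\<phi>. \<exists>C>0. \<exists>m::nat. \<forall>x y.
     \<bar>\<phi> x - \<phi> y\<bar> \<le> C * (1 + L2_set x {..<n} ^ m + L2_set y {..<n} ^ m)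
                       * L2_set (\<lambda>i. x i - y i) {..<n}}"

text \<open>
  The \<open>\<sigma>\<close>-algebra is \<open>sets M\<close> on \<open>\<Omega> = space M\<close>; the measure carried by \<open>M\<close> plays no role.
  Only the values of \<open>E\<close> on \<open>H\<close> are meaningful.
\<close>

locale sublinear_expectation_space =
  fixes M :: "'a measure" and H :: "('a \<Rightarrow> real) set" and E :: "('a \<Rightarrow> real) \<Rightarrow> ereal"
  assumes measurable_H: "X \<in> H \<Longrightarrow> X \<in> borel_measurable M"
    and zero_H: "(\<lambda>_. 0) \<in> H"
    and add_H: "X \<in> H \<Longrightarrow> Y \<in> H \<Longrightarrow> (\<lambda>\<omega>. X \<omega> + Y \<omega>) \<in> H"
    and scale_H: "X \<in> H \<Longrightarrow> (\<lambda>\<omega>. c * X \<omega>) \<in> H"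
    and C_lLip_H: "\<phi> \<in> C_lLip n \<Longrightarrow> (\<And>i. i < n \<Longrightarrow> Z i \<in> H) \<Longrightarrow> (\<lambda>\<omega>. \<phi> (\<lambda>i. Z i \<omega>)) \<in> H"
    and E_mono: "X \<in> H \<Longrightarrow> Y \<in> H \<Longrightarrow> (\<And>\<omega>. \<omega> \<in> space M \<Longrightarrow> X \<omega> \<ge> Y \<omega>) \<Longrightarrow> E X \<ge> E Y"
    and E_const: "E (\<lambda>_. c) = ereal c"
    and E_subadd: "X \<in> H \<Longrightarrow> Y \<in> H \<Longrightarrow>
       \<not> (E X = \<infinity> \<and> E Y = -\<infinity>) \<Longrightarrow> \<not> (E X = -\<infinity> \<and> E Y = \<infinity>) \<Longrightarrow>
       E (\<lambda>\<omega>. X \<omega> + Y \<omega>) \<le> E X + E Y"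
    and E_pos_homogeneous: "X \<in> H \<Longrightarrow> 0 \<le> c \<Longrightarrow> E (\<lambda>\<omega>. c * X \<omega>) = ereal c * E X"

definition conjugate_expectation :: "(('a \<Rightarrow> real) \<Rightarrow> ereal) \<Rightarrow> ('a \<Rightarrow> real) \<Rightarrow> ereal" where
  "conjugate_expectation E X = - E (\<lambda>\<omega>. - X \<omega>)"

definition vec_append :: "nat \<Rightarrow> (nat \<Rightarrow> real) \<Rightarrow> (nat \<Rightarrow> real) \<Rightarrow> nat \<Rightarrow> real" where
  "vec_append m x y = (\<lambda>i. if i < m then x i else y (i - m))"

text \<open>
  The vector \<open>Y \<in> H\<^sup>n\<close> is independent to \<open>X \<in> H\<^sup>m\<close>.  Since \<open>E\<close> is defined on \<open>H\<close> only, a test function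
  \<open>\<phi>\<close> is admitted when the random variables obtained by substituting \<open>X\<close> for \<open>x\<close> lie in \<open>H\<close>, i.e. when
  the outer expectations make sense.  Finiteness of \<open>E[|\<phi>(x,Y)|]\<close> makes both inner expectations finite,
  so \<open>real_of_ereal\<close> is only a change of type.
\<close>

definition independent_to ::
  "('a \<Rightarrow> real) set \<Rightarrow> (('a \<Rightarrow> real) \<Rightarrow> ereal) \<Rightarrow>
   nat \<Rightarrow> (nat \<Rightarrow> 'a \<Rightarrow> real) \<Rightarrow> nat \<Rightarrow> (nat \<Rightarrow> 'a \<Rightarrow> real) \<Rightarrow> bool" where
  "independent_to H E n Y m X \<longleftrightarrow>
     (\<forall>i<n. Y i \<in> H) \<and> (\<forall>i<m. X i \<in> H) \<and>
     (\<forall>\<phi> \<in> C_lLip (m + n).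
        let abs_inner = (\<lambda>x. E (\<lambda>\<omega>. \<bar>\<phi> (vec_append m x (\<lambda>i. Y i \<omega>))\<bar>));
            inner = (\<lambda>x. E (\<lambda>\<omega>. \<phi> (vec_append m x (\<lambda>i. Y i \<omega>))));
            abs_inner_X = (\<lambda>\<omega>. real_of_ereal (abs_inner (\<lambda>i. X i \<omega>)));
            inner_X = (\<lambda>\<omega>. real_of_ereal (inner (\<lambda>i. X i \<omega>)))
        in (\<forall>x. abs_inner x < \<infinity>) \<longrightarrow> abs_inner_X \<in> H \<longrightarrow> E (\<lambda>\<omega>. \<bar>abs_inner_X \<omega>\<bar>) < \<infinity> \<longrightarrow>
           inner_X \<in> H \<longrightarrow>
           E (\<lambda>\<omega>. \<phi> (vec_append m (\<lambda>i. X i \<omega>) (\<lambda>i. Y i \<omega>))) = E inner_X)"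

text \<open>Sequences of random variables are indexed from \<open>1\<close>; the value at index \<open>0\<close> is ignored.\<close>

definition independent_seq ::
  "('a \<Rightarrow> real) set \<Rightarrow> (('a \<Rightarrow> real) \<Rightarrow> ereal) \<Rightarrow> (nat \<Rightarrow> 'a \<Rightarrow> real) \<Rightarrow> bool" where
  "independent_seq H E X \<longleftrightarrow>
     (\<forall>i\<ge>1. X i \<in> H) \<and> (\<forall>i\<ge>1. independent_to H E 1 (\<lambda>_. X (i + 1)) i (\<lambda>j. X (j + 1)))"

definition capacity :: "'a measure \<Rightarrow> ('a set \<Rightarrow> real) \<Rightarrow> bool" where
  "capacity M V \<longleftrightarrow>
     (\<forall>A\<in>sets M. 0 \<le> V A \<and> V A \<le> 1) \<and>
     (\<forall>A\<in>sets M. \<forall>B\<in>sets M. A \<subseteq> B \<longrightarrow> V A \<le> V B) \<and>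
     V {} = 0 \<and> V (space M) = 1"

definition subadditive_capacity :: "'a measure \<Rightarrow> ('a set \<Rightarrow> real) \<Rightarrow> bool" where
  "subadditive_capacity M V \<longleftrightarrow>
     capacity M V \<and> (\<forall>A\<in>sets M. \<forall>B\<in>sets M. V (A \<union> B) \<le> V A + V B)"

definition property_C ::
  "'a measure \<Rightarrow> ('a \<Rightarrow> real) set \<Rightarrow> (('a \<Rightarrow> real) \<Rightarrow> ereal) \<Rightarrow> ('a set \<Rightarrow> real) \<Rightarrow> bool" where
  "property_C M H E V \<longleftrightarrow>
     (\<forall>f\<in>H. \<forall>g\<in>H. \<forall>A\<in>sets M.
        (\<forall>\<omega>\<in>space M. f \<omega> \<le> indicator A \<omega> \<and> indicator A \<omega> \<le> g \<omega>) \<longrightarrow>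
        E f \<le> ereal (V A) \<and> ereal (V A) \<le> E g)"

definition V_hat ::
  "'a measure \<Rightarrow> ('a \<Rightarrow> real) set \<Rightarrow> (('a \<Rightarrow> real) \<Rightarrow> ereal) \<Rightarrow> 'a set \<Rightarrow> ereal" where
  "V_hat M H E A = Inf {E \<xi> |\<xi>. \<xi> \<in> H \<and> (\<forall>\<omega>\<in>space M. indicator A \<omega> \<le> \<xi> \<omega>)}"

definition V_hat_star ::
  "'a measure \<Rightarrow> ('a \<Rightarrow> real) set \<Rightarrow> (('a \<Rightarrow> real) \<Rightarrow> ereal) \<Rightarrow> 'a set \<Rightarrow> ereal" where
  "V_hat_star M H E A =
     Inf {(\<Sum>n. V_hat M H E (B n)) |B :: nat \<Rightarrow> 'a set. range B \<subseteq> sets M \<and> A \<subseteq> (\<Union>n. B n)}"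

definition Log :: "real \<Rightarrow> real" where
  "Log x = ln (max (exp 1) x)"

definition partial_sum :: "(nat \<Rightarrow> 'a \<Rightarrow> real) \<Rightarrow> nat \<Rightarrow> 'a \<Rightarrow> real" where
  "partial_sum X n \<omega> = (\<Sum>i=1..n. X i \<omega>)"

text \<open>Used only when all \<open>E[X\<^sub>k\<^sup>2]\<close> are finite.\<close>

definition s_seq :: "(('a \<Rightarrow> real) \<Rightarrow> ereal) \<Rightarrow> (nat \<Rightarrow> 'a \<Rightarrow> real) \<Rightarrow> nat \<Rightarrow> real" where
  "s_seq E X n = sqrt (\<Sum>k=1..n. real_of_ereal (E (\<lambda>\<omega>. (X k \<omega>)\<^sup>2)))"

definition t_seq :: "(('a \<Rightarrow> real) \<Rightarrow> ereal) \<Rightarrow> (nat \<Rightarrow> 'a \<Rightarrow> real) \<Rightarrow> nat \<Rightarrow> real" where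
  "t_seq E X n = sqrt (2 * Log (Log ((s_seq E X n)\<^sup>2)))"

definition a_seq :: "(('a \<Rightarrow> real) \<Rightarrow> ereal) \<Rightarrow> (nat \<Rightarrow> 'a \<Rightarrow> real) \<Rightarrow> nat \<Rightarrow> real" where
  "a_seq E X n = s_seq E X n * t_seq E X n"

text \<open>\<open>Gamma_trunc E X n p \<alpha>\<close> and \<open>Lambda_trunc E X n p \<alpha>\<close> may be infinite when \<open>p > 2\<close>.\<close>

definition Gamma_trunc ::
  "(('a \<Rightarrow> real) \<Rightarrow> ereal) \<Rightarrow> (nat \<Rightarrow> 'a \<Rightarrow> real) \<Rightarrow> nat \<Rightarrow> real \<Rightarrow> real \<Rightarrow> ereal" where
  "Gamma_trunc E X n p \<alpha> =
     E (\<lambda>\<omega>. (max (\<bar>X n \<omega>\<bar> - \<alpha> * s_seq E X n / t_seq E X n) 0) powr p)"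

definition Lambda_trunc ::
  "(('a \<Rightarrow> real) \<Rightarrow> ereal) \<Rightarrow> (nat \<Rightarrow> 'a \<Rightarrow> real) \<Rightarrow> nat \<Rightarrow> real \<Rightarrow> real \<Rightarrow> ereal" where
  "Lambda_trunc E X n p \<alpha> =
     (\<Sum>j=1..n. E (\<lambda>\<omega>. (max (\<bar>X j \<omega>\<bar> - \<alpha> * s_seq E X n / t_seq E X n) 0) powr p))"

text \<open>
  The power \<open>x\<^sup>d\<close> for \<open>x \<in> [0,\<infinity>]\<close> and real \<open>d \<ge> 0\<close>, with \<open>x\<^sup>0 = 1\<close> for every \<open>x\<close>
  (the operator \<open>powr\<close> on the reals has \<open>0 powr 0 = 0\<close>).
\<close>

definition ereal_powr :: "ereal \<Rightarrow> real \<Rightarrow> ereal" where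
  "ereal_powr x d =
     (if d = 0 then 1 else if x = \<infinity> then \<infinity> else ereal (real_of_ereal x powr d))"

end

theory Submission
  imports Defs
begin

text \<open>
  Proof idea.  On bounded Lipschitz functions of finitely many coordinates, independence says that the
  expectation is a composition of one-step sublinear operators; hence exponential maximal
  inequalities, product formulas and the computation of \<open>E[1 - \<Prod>(1 - F\<^sub>i)]\<close> over disjoint
  blocks need only estimates for a single variable.

  Write \<open>b\<^sub>n = \<Lambda>\<^sub>n / a\<^sub>n\<^sup>p\<close>.  Cut the indices into blocks on which \<open>s\<^sub>n\<^sup>2\<close> stays within a factor
  \<open>\<Theta>\<close>.  The hypothesis on \<open>\<Gamma>\<close> and \<open>\<Lambda>\<close> makes \<open>b\<^sup>d\<^sup>+\<^sup>1\<close> summable along the block ends.  A block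
  end is good if \<open>b \<le> exp (- \<eta> log log s\<^sup>2)\<close>.  At good block ends the classical exponential bounds hold,
  from above with \<open>\<lambda> = t/s\<close> and from below by Kolmogorov's tilting argument; at bad ones the choice
  \<open>\<lambda> \<approx> log (1/b) / a\<close> bounds the tail by a multiple of \<open>b\<^sup>d\<^sup>+\<^sup>1\<close>.  Both bounds are summable, which gives
  the upper half.  For the lower half, the variance hypothesis makes the lower bounds at good block
  ends non-summable, and every other block is used so that the preceding partial sum is negligible.
\<close>


section \<open>Bounded Lipschitz functions of finitely many coordinates\<close>

text \<open>Independence can be used only for test functions whose inner expectations, read at the
  random vector, lie again in \<open>H\<close>, and only to integrate a later variable given the
  earlier ones. Bounded Lipschitz functions meet these conditions and are stable under integrating
  out the last coordinate; hence indicators are replaced by ramps and exponentials are capped or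
  applied to clipped variables. A second obstacle is that \<open>V\<close> is only finitely
  sub-additive and no continuity of the expectation is assumed. Limit arguments are therefore
  replaced by bounds uniform in the finite horizon, carried by dominating random variables of
  explicit expectation. The exponents \<open>p\<close> and \<open>d\<close> come with \<alpha>. So
  the accuracy fixes \<alpha> first, and a single truncation level must then serve good and bad
  block ends alike. The power \<open>d + 1\<close> arises because \<open>\<Lambda>^d\<close> times
  an increment of \<open>\<Lambda>\<close> is, up to a factor, an increment of
  \<open>\<Lambda>^(d+1)\<close>; dividing by a geometrically growing normaliser then makes the
  block values summable.\<close>

definition lip1 :: "(real \<Rightarrow> real) \<Rightarrow> bool" where
  "lip1 f \<longleftrightarrow> (\<exists>L\<ge>0. \<forall>x y. \<bar>f x - f y\<bar> \<le> L * \<bar>x - y\<bar>)"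

lemma lip1I: "0 \<le> L \<Longrightarrow> (\<And>x y. \<bar>f x - f y\<bar> \<le> L * \<bar>x - y\<bar>) \<Longrightarrow> lip1 f"
  unfolding lip1_def by blast

lemma lip1_comp:
  assumes "lip1 f" "lip1 g"
  shows "lip1 (\<lambda>x. f (g x))"
proof -
  obtain L where L: "0 \<le> L" "\<And>x y. \<bar>f x - f y\<bar> \<le> L * \<bar>x - y\<bar>"
    using assms(1) unfolding lip1_def by blast
  obtain L' where L': "0 \<le> L'" "\<And>x y. \<bar>g x - g y\<bar> \<le> L' * \<bar>x - y\<bar>"
    using assms(2) unfolding lip1_def by blast
  show ?thesis
  proof (rule lip1I)
    show "0 \<le> L * L'" using L L' by simp
    fix x y
    have "\<bar>f (g x) - f (g y)\<bar> \<le> L * \<bar>g x - g y\<bar>" by (rule L)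
    also have "\<dots> \<le> L * (L' * \<bar>x - y\<bar>)" by (intro mult_left_mono L' L)
    finally show "\<bar>f (g x) - f (g y)\<bar> \<le> L * L' * \<bar>x - y\<bar>" by (simp add: mult.assoc)
  qed
qed

lemma lip1_affine: "lip1 (\<lambda>x. c * x + d)"
proof (rule lip1I)
  fix x y :: real
  have "c * x + d - (c * y + d) = c * (x - y)" by (simp add: algebra_simps)
  then show "\<bar>c * x + d - (c * y + d)\<bar> \<le> \<bar>c\<bar> * \<bar>x - y\<bar>" by (simp add: abs_mult)
qed simp

lemma lip1_const: "lip1 (\<lambda>_. c)"
  by (rule lip1I[of 0]) auto

lemma lip1_min: "lip1 (\<lambda>x. min x c)"
  by (rule lip1I[of 1]) auto

lemma lip1_max: "lip1 (\<lambda>x. max x c)"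
  by (rule lip1I[of 1]) auto

lemma lip1_abs: "lip1 (\<lambda>x. \<bar>x\<bar>)"
  by (rule lip1I[of 1]) auto

lemma exp_diff_le: "exp x - exp y \<le> exp x * (x - y)" for x y :: real
proof -
  have "1 + (y - x) \<le> exp (y - x)" by (rule exp_ge_add_one_self)
  then have "exp x * (1 + (y - x)) \<le> exp x * exp (y - x)" by (intro mult_left_mono) auto
  then show ?thesis by (simp add: algebra_simps flip: exp_add)
qed

lemma exp_lipschitz: "x \<le> B \<Longrightarrow> y \<le> B \<Longrightarrow> \<bar>exp x - exp y\<bar> \<le> exp B * \<bar>x - y\<bar>" for x y B :: real
proof (induction x y rule: linorder_wlog)
  case (le x y)
  have "exp y - exp x \<le> exp y * (y - x)" by (rule exp_diff_le)
  also have "\<dots> \<le> exp B * (y - x)" using le by (intro mult_right_mono) auto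
  finally show ?case using le by simp
next
  case (sym x y)
  then show ?case by (simp add: abs_minus_commute)
qed

lemma lip1_exp_min: "lip1 (\<lambda>x. exp (min x c))"
proof (rule lip1I[of "exp c"])
  fix x y
  have "\<bar>exp (min x c) - exp (min y c)\<bar> \<le> exp c * \<bar>min x c - min y c\<bar>"
    by (rule exp_lipschitz) auto
  also have "\<dots> \<le> exp c * \<bar>x - y\<bar>" by (intro mult_left_mono) auto
  finally show "\<bar>exp (min x c) - exp (min y c)\<bar> \<le> exp c * \<bar>x - y\<bar>" .
qed simp

text \<open>The l1 distance is chosen because changing one coordinate alters a single summand:
  sections in one variable, and functions with one variable integrated out, keep the same
  constant.\<close>

definition Lip :: "nat \<Rightarrow> ((nat \<Rightarrow> real) \<Rightarrow> real) set" where
  "Lip n = {\<phi>. \<exists>L\<ge>0. \<forall>x y. \<bar>\<phi> x - \<phi> y\<bar> \<le> L * (\<Sum>i<n. \<bar>x i - y i\<bar>)}"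

definition BL :: "nat \<Rightarrow> ((nat \<Rightarrow> real) \<Rightarrow> real) set" where
  "BL n = {\<phi> \<in> Lip n. \<exists>B. \<forall>x. \<bar>\<phi> x\<bar> \<le> B}"

lemma LipI: "0 \<le> L \<Longrightarrow> (\<And>x y. \<bar>\<phi> x - \<phi> y\<bar> \<le> L * (\<Sum>i<n. \<bar>x i - y i\<bar>)) \<Longrightarrow> \<phi> \<in> Lip n"
  unfolding Lip_def by blast

lemma LipD: "\<phi> \<in> Lip n \<Longrightarrow> \<exists>L\<ge>0. \<forall>x y. \<bar>\<phi> x - \<phi> y\<bar> \<le> L * (\<Sum>i<n. \<bar>x i - y i\<bar>)"
  unfolding Lip_def by blast

lemma Lip_cong_coords: "\<phi> \<in> Lip n \<Longrightarrow> (\<And>i. i < n \<Longrightarrow> x i = y i) \<Longrightarrow> \<phi> x = \<phi> y"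
proof -
  assume "\<phi> \<in> Lip n" and eq: "\<And>i. i < n \<Longrightarrow> x i = y i"
  then obtain L where "\<bar>\<phi> x - \<phi> y\<bar> \<le> L * (\<Sum>i<n. \<bar>x i - y i\<bar>)" using LipD by blast
  also have "\<dots> = 0" using eq by simp
  finally show ?thesis by simp
qed

lemma BLI: "\<phi> \<in> Lip n \<Longrightarrow> (\<And>x. \<bar>\<phi> x\<bar> \<le> B) \<Longrightarrow> \<phi> \<in> BL n"
  unfolding BL_def by blast

lemma BL_Lip: "\<phi> \<in> BL n \<Longrightarrow> \<phi> \<in> Lip n"
  unfolding BL_def by blast

lemma BL_bound:
  assumes "\<phi> \<in> BL n"
  shows "\<exists>B\<ge>0. \<forall>x. \<bar>\<phi> x\<bar> \<le> B"
proof -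
  obtain B where B: "\<And>x. \<bar>\<phi> x\<bar> \<le> B" using assms unfolding BL_def by blast
  have "0 \<le> B" using B[of undefined] by linarith
  with B show ?thesis by blast
qed

lemma Lip_const: "(\<lambda>_. c) \<in> Lip n"
  by (rule LipI[of 0]) auto

lemma Lip_mono: "\<phi> \<in> Lip m \<Longrightarrow> m \<le> n \<Longrightarrow> \<phi> \<in> Lip n"
proof -
  assume "\<phi> \<in> Lip m" "m \<le> n"
  then obtain L where L: "0 \<le> L" "\<And>x y. \<bar>\<phi> x - \<phi> y\<bar> \<le> L * (\<Sum>i<m. \<bar>x i - y i\<bar>)"
    using LipD by blast
  show "\<phi> \<in> Lip n"
  proof (rule LipI[OF L(1)])
    fix x y :: "nat \<Rightarrow> real"
    have "(\<Sum>i<m. \<bar>x i - y i\<bar>) \<le> (\<Sum>i<n. \<bar>x i - y i\<bar>)"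
      using \<open>m \<le> n\<close> by (intro sum_mono2) auto
    then show "\<bar>\<phi> x - \<phi> y\<bar> \<le> L * (\<Sum>i<n. \<bar>x i - y i\<bar>)"
      using L(2)[of x y] mult_left_mono[OF _ L(1)] by fastforce
  qed
qed

lemma Lip_add:
  assumes "\<phi> \<in> Lip n" "\<psi> \<in> Lip n"
  shows "(\<lambda>x. \<phi> x + \<psi> x) \<in> Lip n"
proof -
  obtain L where L: "0 \<le> L" "\<And>x y. \<bar>\<phi> x - \<phi> y\<bar> \<le> L * (\<Sum>i<n. \<bar>x i - y i\<bar>)"
    using LipD[OF assms(1)] by blast
  obtain L' where L': "0 \<le> L'" "\<And>x y. \<bar>\<psi> x - \<psi> y\<bar> \<le> L' * (\<Sum>i<n. \<bar>x i - y i\<bar>)"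
    using LipD[OF assms(2)] by blast
  show ?thesis
  proof (rule LipI)
    show "0 \<le> L + L'" using L L' by simp
    fix x y
    show "\<bar>\<phi> x + \<psi> x - (\<phi> y + \<psi> y)\<bar> \<le> (L + L') * (\<Sum>i<n. \<bar>x i - y i\<bar>)"
      using L(2)[of x y] L'(2)[of x y] by (simp add: algebra_simps)
  qed
qed

lemma Lip_compose:
  assumes "\<phi> \<in> Lip n" "lip1 f"
  shows "(\<lambda>x. f (\<phi> x)) \<in> Lip n"
proof -
  obtain L where L: "0 \<le> L" "\<And>x y. \<bar>\<phi> x - \<phi> y\<bar> \<le> L * (\<Sum>i<n. \<bar>x i - y i\<bar>)"
    using LipD[OF assms(1)] by blast
  obtain L' where L': "0 \<le> L'" "\<And>x y. \<bar>f x - f y\<bar> \<le> L' * \<bar>x - y\<bar>"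
    using assms(2) unfolding lip1_def by blast
  show ?thesis
  proof (rule LipI)
    show "0 \<le> L' * L" using L L' by simp
    fix x y
    have "\<bar>f (\<phi> x) - f (\<phi> y)\<bar> \<le> L' * \<bar>\<phi> x - \<phi> y\<bar>" by (rule L')
    also have "\<dots> \<le> L' * (L * (\<Sum>i<n. \<bar>x i - y i\<bar>))" by (intro mult_left_mono L L')
    finally show "\<bar>f (\<phi> x) - f (\<phi> y)\<bar> \<le> L' * L * (\<Sum>i<n. \<bar>x i - y i\<bar>)" by (simp add: mult.assoc)
  qed
qed

lemma Lip_coord: "i < n \<Longrightarrow> (\<lambda>x. x i) \<in> Lip n"
proof (rule LipI[of 1])
  fix x y :: "nat \<Rightarrow> real" assume "i < n"
  then have "\<bar>x i - y i\<bar> \<le> (\<Sum>i<n. \<bar>x i - y i\<bar>)"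
    by (intro member_le_sum) auto
  then show "\<bar>x i - y i\<bar> \<le> 1 * (\<Sum>i<n. \<bar>x i - y i\<bar>)" by simp
qed simp

lemma Lip_coord_fun: "i < n \<Longrightarrow> lip1 f \<Longrightarrow> (\<lambda>x. f (x i)) \<in> Lip n"
  by (rule Lip_compose[OF Lip_coord])

lemma Lip_sum: "(\<And>i. i \<in> I \<Longrightarrow> \<phi> i \<in> Lip n) \<Longrightarrow> (\<lambda>x. \<Sum>i\<in>I. \<phi> i x) \<in> Lip n"
  by (induction I rule: infinite_finite_induct) (auto intro: Lip_const Lip_add)

lemma BL_const: "(\<lambda>_. c) \<in> BL n"
  by (rule BLI[OF Lip_const]) auto

lemma BL_mono: "\<phi> \<in> BL m \<Longrightarrow> m \<le> n \<Longrightarrow> \<phi> \<in> BL n"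
  unfolding BL_def using Lip_mono by blast

lemma BL_add:
  assumes "\<phi> \<in> BL n" "\<psi> \<in> BL n"
  shows "(\<lambda>x. \<phi> x + \<psi> x) \<in> BL n"
proof -
  obtain B where B: "\<And>x. \<bar>\<phi> x\<bar> \<le> B" using BL_bound[OF assms(1)] by blast
  obtain B' where B': "\<And>x. \<bar>\<psi> x\<bar> \<le> B'" using BL_bound[OF assms(2)] by blast
  have "\<bar>\<phi> x + \<psi> x\<bar> \<le> B + B'" for x using B[of x] B'[of x] by linarith
  then show ?thesis using Lip_add BL_Lip assms by (blast intro: BLI)
qed

text \<open>As \<phi> is bounded, \<open>f\<close> need only be Lipschitz on bounded intervals; this
  admits the exponential and the square.\<close>

lemma BL_compose:
  assumes "\<phi> \<in> BL n" and "\<And>B. \<exists>L\<ge>0. \<forall>x y. \<bar>x\<bar> \<le> B \<longrightarrow> \<bar>y\<bar> \<le> B \<longrightarrow> \<bar>f x - f y\<bar> \<le> L * \<bar>x - y\<bar>"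
  shows "(\<lambda>x. f (\<phi> x)) \<in> BL n"
proof -
  obtain L where L: "0 \<le> L" "\<And>x y. \<bar>\<phi> x - \<phi> y\<bar> \<le> L * (\<Sum>i<n. \<bar>x i - y i\<bar>)"
    using LipD[OF BL_Lip[OF assms(1)]] by blast
  obtain B where B: "0 \<le> B" "\<And>x. \<bar>\<phi> x\<bar> \<le> B" using BL_bound[OF assms(1)] by blast
  obtain L' where L': "0 \<le> L'" "\<And>x y. \<bar>x\<bar> \<le> B \<Longrightarrow> \<bar>y\<bar> \<le> B \<Longrightarrow> \<bar>f x - f y\<bar> \<le> L' * \<bar>x - y\<bar>"
    using assms(2)[of B] by blast
  have "(\<lambda>x. f (\<phi> x)) \<in> Lip n"
  proof (rule LipI)
    show "0 \<le> L' * L" using L L' by simp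
    fix x y
    have "\<bar>f (\<phi> x) - f (\<phi> y)\<bar> \<le> L' * \<bar>\<phi> x - \<phi> y\<bar>" by (intro L' B)
    also have "\<dots> \<le> L' * (L * (\<Sum>i<n. \<bar>x i - y i\<bar>))" by (intro mult_left_mono L L')
    finally show "\<bar>f (\<phi> x) - f (\<phi> y)\<bar> \<le> L' * L * (\<Sum>i<n. \<bar>x i - y i\<bar>)" by (simp add: mult.assoc)
  qed
  moreover have "\<bar>f (\<phi> x)\<bar> \<le> \<bar>f 0\<bar> + L' * B" for x
  proof -
    have "\<bar>f (\<phi> x) - f 0\<bar> \<le> L' * \<bar>\<phi> x - 0\<bar>" using B by (intro L') auto
    also have "\<dots> \<le> L' * B" using B L' by (intro mult_left_mono) auto
    finally show ?thesis by linarith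
  qed
  ultimately show ?thesis by (rule BLI)
qed

lemma BL_lip1: "\<phi> \<in> BL n \<Longrightarrow> lip1 f \<Longrightarrow> (\<lambda>x. f (\<phi> x)) \<in> BL n"
  by (rule BL_compose) (auto simp: lip1_def)

lemma BL_scale: "\<phi> \<in> BL n \<Longrightarrow> (\<lambda>x. c * \<phi> x) \<in> BL n"
  using BL_lip1[OF _ lip1_affine[of c 0]] by simp

lemma BL_diff: "\<phi> \<in> BL n \<Longrightarrow> \<psi> \<in> BL n \<Longrightarrow> (\<lambda>x. \<phi> x - \<psi> x) \<in> BL n"
  using BL_add[OF _ BL_scale[of \<psi> n "-1"]] by simp

lemma BL_exp: "\<phi> \<in> BL n \<Longrightarrow> (\<lambda>x. exp (\<phi> x)) \<in> BL n"
proof (rule BL_compose[where f = exp and \<phi> = \<phi>])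
  fix B :: real
  show "\<exists>L\<ge>0. \<forall>x y. \<bar>x\<bar> \<le> B \<longrightarrow> \<bar>y\<bar> \<le> B \<longrightarrow> \<bar>exp x - exp y\<bar> \<le> L * \<bar>x - y\<bar>"
    by (intro exI[of _ "exp B"]) (auto intro: exp_lipschitz)
qed

lemma BL_square: "\<phi> \<in> BL n \<Longrightarrow> (\<lambda>x. (\<phi> x)\<^sup>2) \<in> BL n"
proof (rule BL_compose[where f = "\<lambda>x. x\<^sup>2" and \<phi> = \<phi>])
  fix B :: real
  have "\<bar>x\<^sup>2 - y\<^sup>2\<bar> \<le> \<bar>2 * B\<bar> * \<bar>x - y\<bar>" if "\<bar>x\<bar> \<le> B" "\<bar>y\<bar> \<le> B" for x y :: real
  proof -
    have "x\<^sup>2 - y\<^sup>2 = (x + y) * (x - y)" by (simp add: power2_eq_square algebra_simps)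
    then have "\<bar>x\<^sup>2 - y\<^sup>2\<bar> = \<bar>x + y\<bar> * \<bar>x - y\<bar>" by (simp add: abs_mult)
    also have "\<dots> \<le> \<bar>2 * B\<bar> * \<bar>x - y\<bar>" using that by (intro mult_right_mono) auto
    finally show ?thesis .
  qed
  then show "\<exists>L\<ge>0. \<forall>x y. \<bar>x\<bar> \<le> B \<longrightarrow> \<bar>y\<bar> \<le> B \<longrightarrow> \<bar>x\<^sup>2 - y\<^sup>2\<bar> \<le> L * \<bar>x - y\<bar>"
    by (intro exI[of _ "\<bar>2 * B\<bar>"]) auto
qed

lemma BL_mult:
  assumes "\<phi> \<in> BL n" "\<psi> \<in> BL n"
  shows "(\<lambda>x. \<phi> x * \<psi> x) \<in> BL n"
proof -
  \<comment> \<open>Polarisation reduces the product to squares.\<close>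
  have "(\<lambda>x. (1/4) * ((\<phi> x + \<psi> x)\<^sup>2 - (\<phi> x - \<psi> x)\<^sup>2)) \<in> BL n"
    using assms by (intro BL_scale BL_diff BL_square BL_add)
  moreover have "(1/4) * ((p + q)\<^sup>2 - (p - q)\<^sup>2) = p * q" for p q :: real
    by (simp add: power2_eq_square algebra_simps)
  ultimately show ?thesis by simp
qed

lemma BL_sum: "(\<And>i. i \<in> I \<Longrightarrow> \<phi> i \<in> BL n) \<Longrightarrow> (\<lambda>x. \<Sum>i\<in>I. \<phi> i x) \<in> BL n"
  by (induction I rule: infinite_finite_induct) (auto intro: BL_const BL_add)

lemma BL_prod: "(\<And>i. i \<in> I \<Longrightarrow> \<phi> i \<in> BL n) \<Longrightarrow> (\<lambda>x. \<Prod>i\<in>I. \<phi> i x) \<in> BL n"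
  by (induction I rule: infinite_finite_induct) (auto intro: BL_const BL_mult)

lemma BL_Lip_compose: "\<phi> \<in> Lip n \<Longrightarrow> lip1 f \<Longrightarrow> (\<And>x. \<bar>f x\<bar> \<le> B) \<Longrightarrow> (\<lambda>x. f (\<phi> x)) \<in> BL n"
  by (rule BLI[OF Lip_compose]) auto

lemma BL_imp_C_lLip:
  assumes "\<phi> \<in> BL n"
  shows "\<phi> \<in> C_lLip n"
proof -
  obtain L where L: "0 \<le> L" "\<And>x y. \<bar>\<phi> x - \<phi> y\<bar> \<le> L * (\<Sum>i<n. \<bar>x i - y i\<bar>)"
    using LipD[OF BL_Lip[OF assms(1)]] by blast
  show ?thesis unfolding C_lLip_def
  \<comment> \<open>With growth exponent 0 the polynomial factor is the constant 3; the summand 1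
    keeps the constant positive when \<open>L * n = 0\<close>.\<close>
  proof (intro CollectI exI[of _ "L * n + 1"] conjI exI[of _ 0] allI)
    show "0 < L * real n + 1" using L by (simp add: add_nonneg_pos)
    fix x y :: "nat \<Rightarrow> real"
    have "(\<Sum>i<n. \<bar>x i - y i\<bar>) \<le> (\<Sum>i<n. L2_set (\<lambda>i. x i - y i) {..<n})"
    proof (rule sum_mono)
      fix i assume "i \<in> {..<n}"
      then show "\<bar>x i - y i\<bar> \<le> L2_set (\<lambda>i. x i - y i) {..<n}"
        using member_le_L2_set[of "{..<n}" i "\<lambda>i. \<bar>x i - y i\<bar>"] by (simp add: L2_set_def)
    qed
    then have "\<bar>\<phi> x - \<phi> y\<bar> \<le> L * (n * L2_set (\<lambda>i. x i - y i) {..<n})"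
      using order_trans[OF L(2)[of x y] mult_left_mono[OF _ L(1)]] by simp
    also have "\<dots> \<le> (L * n + 1) * 3 * L2_set (\<lambda>i. x i - y i) {..<n}"
      using L(1) by (simp add: algebra_simps add_increasing2 mult_nonneg_nonneg L2_set_nonneg)
    finally show "\<bar>\<phi> x - \<phi> y\<bar> \<le> (L * n + 1) * (1 + L2_set x {..<n} ^ 0 + L2_set y {..<n} ^ 0) *
        L2_set (\<lambda>i. x i - y i) {..<n}" by simp
  qed
qed

section \<open>The expectation as a real functional on random variables of finite absolute
  moment\<close>

context sublinear_expectation_space
begin

definition fin :: "('a \<Rightarrow> real) set" where
  "fin = {Y \<in> H. E (\<lambda>\<omega>. \<bar>Y \<omega>\<bar>) < \<infinity>}"

text \<open>Meaningful on \<open>fin\<close> only: \<open>real_of_ereal\<close> sends infinite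
  values to 0.\<close>

definition e :: "('a \<Rightarrow> real) \<Rightarrow> real" where
  "e Y = real_of_ereal (E Y)"

lemma H_compose:
  assumes "Y \<in> H" and "\<And>x y. \<bar>f x - f y\<bar> \<le> C * (1 + \<bar>x\<bar> ^ m + \<bar>y\<bar> ^ m) * \<bar>x - y\<bar>"
  shows "(\<lambda>\<omega>. f (Y \<omega>)) \<in> H"
proof -
  have [simp]: "L2_set z {..<Suc 0} = \<bar>z 0\<bar>" for z by (simp add: L2_set_def)
  have "(\<lambda>x. f (x 0)) \<in> C_lLip 1"
    unfolding C_lLip_def
  proof (intro CollectI exI[of _ "max C 1"] exI[of _ m] conjI allI)
    fix x y :: "nat \<Rightarrow> real"
    have "C * (1 + \<bar>x 0\<bar> ^ m + \<bar>y 0\<bar> ^ m) * \<bar>x 0 - y 0\<bar> \<le>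
        max C 1 * (1 + \<bar>x 0\<bar> ^ m + \<bar>y 0\<bar> ^ m) * \<bar>x 0 - y 0\<bar>"
      by (intro mult_right_mono) auto
    then show "\<bar>f (x 0) - f (y 0)\<bar> \<le> max C 1 *
       (1 + L2_set x {..<1} ^ m + L2_set y {..<1} ^ m) * L2_set (\<lambda>i. x i - y i) {..<1}"
      using assms(2)[of "x 0" "y 0"] by simp
  qed simp
  from C_lLip_H[OF this, of "\<lambda>_. Y"] assms(1) show ?thesis by simp
qed

lemma H_lip1: "Y \<in> H \<Longrightarrow> lip1 f \<Longrightarrow> (\<lambda>\<omega>. f (Y \<omega>)) \<in> H"
  unfolding lip1_def
proof (elim exE conjE)
  fix L assume L: "0 \<le> L" "\<forall>x y. \<bar>f x - f y\<bar> \<le> L * \<bar>x - y\<bar>" "Y \<in> H"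
  have "\<bar>f x - f y\<bar> \<le> L * (1 + \<bar>x\<bar> ^ 0 + \<bar>y\<bar> ^ 0) * \<bar>x - y\<bar>" for x y
  proof -
    have "L * \<bar>x - y\<bar> \<le> (L * 3) * \<bar>x - y\<bar>" using L(1) by (intro mult_right_mono) auto
    then show ?thesis using L(2)[rule_format, of x y] by simp
  qed
  then show ?thesis by (rule H_compose[OF L(3)])
qed

lemma const_H: "(\<lambda>_. c) \<in> H"
  using H_lip1[OF zero_H lip1_affine[of 0 c]] by simp

lemma abs_H: "Y \<in> H \<Longrightarrow> (\<lambda>\<omega>. \<bar>Y \<omega>\<bar>) \<in> H"
  using H_lip1[OF _ lip1_abs] .

lemma square_H: "Y \<in> H \<Longrightarrow> (\<lambda>\<omega>. (Y \<omega>)\<^sup>2) \<in> H"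
proof (rule H_compose[where C=1 and m=1 and f = "\<lambda>x. x\<^sup>2" and Y = Y])
  fix x y :: real
  have "x\<^sup>2 - y\<^sup>2 = (x + y) * (x - y)" by (simp add: power2_eq_square algebra_simps)
  then have "\<bar>x\<^sup>2 - y\<^sup>2\<bar> = \<bar>x + y\<bar> * \<bar>x - y\<bar>" by (simp add: abs_mult)
  also have "\<dots> \<le> 1 * (1 + \<bar>x\<bar> ^ 1 + \<bar>y\<bar> ^ 1) * \<bar>x - y\<bar>" by (intro mult_right_mono) auto
  finally show "\<bar>x\<^sup>2 - y\<^sup>2\<bar> \<le> 1 * (1 + \<bar>x\<bar> ^ 1 + \<bar>y\<bar> ^ 1) * \<bar>x - y\<bar>" .
qed

lemma fin_H: "Y \<in> fin \<Longrightarrow> Y \<in> H"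
  unfolding fin_def by blast

lemma E_nonneg: "Y \<in> H \<Longrightarrow> (\<And>\<omega>. \<omega> \<in> space M \<Longrightarrow> 0 \<le> Y \<omega>) \<Longrightarrow> 0 \<le> E Y"
  using E_mono[of Y "\<lambda>_. 0"] E_const[of 0] zero_H by (simp add: zero_ereal_def)

lemma finI: "Y \<in> H \<Longrightarrow> Z \<in> H \<Longrightarrow> E Z < \<infinity> \<Longrightarrow> (\<And>\<omega>. \<omega> \<in> space M \<Longrightarrow> \<bar>Y \<omega>\<bar> \<le> Z \<omega>) \<Longrightarrow> Y \<in> fin"
  using E_mono[of Z "\<lambda>\<omega>. \<bar>Y \<omega>\<bar>"] abs_H[of Y] unfolding fin_def by auto

text \<open>Only the value -\<infinity> needs an argument: since \<open>E (- Y)\<close> is below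
  \<infinity>, sub-additivity for \<open>Y\<close> and \<open>- Y\<close> would give
  \<open>E 0 = -\<infinity>\<close>.\<close>

lemma E_fin: assumes "Y \<in> fin" shows "E Y = ereal (e Y)"
proof -
  have Y: "Y \<in> H" "E (\<lambda>\<omega>. \<bar>Y \<omega>\<bar>) < \<infinity>" using assms by (auto simp: fin_def)
  have Y': "(\<lambda>\<omega>. - Y \<omega>) \<in> H" using scale_H[OF Y(1), of "-1"] by simp
  have le: "E Y < \<infinity>" "E (\<lambda>\<omega>. - Y \<omega>) < \<infinity>"
    using order.strict_trans1[OF E_mono[OF abs_H[OF Y(1)] Y(1)] Y(2)]
      order.strict_trans1[OF E_mono[OF abs_H[OF Y(1)] Y'] Y(2)] by auto
  have "E Y \<noteq> -\<infinity>"
  proof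
    assume *: "E Y = -\<infinity>"
    have "E (\<lambda>\<omega>. Y \<omega> + - Y \<omega>) \<le> E Y + E (\<lambda>\<omega>. - Y \<omega>)"
      by (rule E_subadd[OF Y(1) Y']) (use * le in auto)
    then show False using * le E_const[of 0] by (cases "E (\<lambda>\<omega>. - Y \<omega>)") auto
  qed
  with le show ?thesis unfolding e_def by (cases "E Y") auto
qed

lemma fin_const: "(\<lambda>_. c) \<in> fin"
  using E_const[of "\<bar>c\<bar>"] const_H by (simp add: fin_def)

lemma e_const: "e (\<lambda>_. c) = c"
  by (simp add: e_def E_const)

lemma fin_abs: "Y \<in> fin \<Longrightarrow> (\<lambda>\<omega>. \<bar>Y \<omega>\<bar>) \<in> fin"
  unfolding fin_def using abs_H by auto

lemma fin_add: assumes "Y \<in> fin" "Z \<in> fin" shows "(\<lambda>\<omega>. Y \<omega> + Z \<omega>) \<in> fin"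
proof (rule finI)
  have Y: "(\<lambda>\<omega>. \<bar>Y \<omega>\<bar>) \<in> fin" "(\<lambda>\<omega>. \<bar>Z \<omega>\<bar>) \<in> fin" using assms fin_abs by auto
  show "(\<lambda>\<omega>. Y \<omega> + Z \<omega>) \<in> H" "(\<lambda>\<omega>. \<bar>Y \<omega>\<bar> + \<bar>Z \<omega>\<bar>) \<in> H"
    using assms Y by (auto intro!: add_H dest: fin_H)
  have "E (\<lambda>\<omega>. \<bar>Y \<omega>\<bar> + \<bar>Z \<omega>\<bar>) \<le> E (\<lambda>\<omega>. \<bar>Y \<omega>\<bar>) + E (\<lambda>\<omega>. \<bar>Z \<omega>\<bar>)"
    using Y by (intro E_subadd) (auto dest: fin_H simp: E_fin)
  also have "\<dots> < \<infinity>" using Y by (simp add: E_fin)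
  finally show "E (\<lambda>\<omega>. \<bar>Y \<omega>\<bar> + \<bar>Z \<omega>\<bar>) < \<infinity>" .
qed (rule abs_triangle_ineq)

lemma fin_scale: assumes "Y \<in> fin" shows "(\<lambda>\<omega>. c * Y \<omega>) \<in> fin"
proof (rule finI)
  have Y: "(\<lambda>\<omega>. \<bar>Y \<omega>\<bar>) \<in> fin" using assms fin_abs by auto
  show "(\<lambda>\<omega>. c * Y \<omega>) \<in> H" "(\<lambda>\<omega>. \<bar>c\<bar> * \<bar>Y \<omega>\<bar>) \<in> H"
    using assms Y by (auto intro!: scale_H dest: fin_H)
  show "E (\<lambda>\<omega>. \<bar>c\<bar> * \<bar>Y \<omega>\<bar>) < \<infinity>"
    using E_pos_homogeneous[OF fin_H[OF Y], of "\<bar>c\<bar>"] Y by (simp add: E_fin)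
qed (simp add: abs_mult)

lemma fin_uminus: "Y \<in> fin \<Longrightarrow> (\<lambda>\<omega>. - Y \<omega>) \<in> fin"
  using fin_scale[of Y "-1"] by simp

lemma fin_diff: "Y \<in> fin \<Longrightarrow> Z \<in> fin \<Longrightarrow> (\<lambda>\<omega>. Y \<omega> - Z \<omega>) \<in> fin"
  using fin_add[OF _ fin_uminus, of Y Z] by simp

lemma fin_dom: "Y \<in> H \<Longrightarrow> Z \<in> fin \<Longrightarrow> (\<And>\<omega>. \<omega> \<in> space M \<Longrightarrow> \<bar>Y \<omega>\<bar> \<le> Z \<omega>) \<Longrightarrow> Y \<in> fin"
  by (rule finI[where Z = Z]) (auto simp: E_fin fin_H)

lemma e_mono: "Y \<in> fin \<Longrightarrow> Z \<in> fin \<Longrightarrow> (\<And>\<omega>. \<omega> \<in> space M \<Longrightarrow> Y \<omega> \<le> Z \<omega>) \<Longrightarrow> e Y \<le> e Z"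
  using E_mono[of Z Y] E_fin[of Y] E_fin[of Z] by (simp add: fin_H)

lemma e_add: "Y \<in> fin \<Longrightarrow> Z \<in> fin \<Longrightarrow> e (\<lambda>\<omega>. Y \<omega> + Z \<omega>) \<le> e Y + e Z"
  using E_subadd[of Y Z] E_fin[of Y] E_fin[of Z] E_fin[OF fin_add[of Y Z]] by (simp add: fin_H)

lemma e_scale: "Y \<in> fin \<Longrightarrow> 0 \<le> c \<Longrightarrow> e (\<lambda>\<omega>. c * Y \<omega>) = c * e Y"
  using E_pos_homogeneous[of Y c] E_fin[of Y] E_fin[OF fin_scale[of Y c]] by (simp add: fin_H)

lemma e_nonneg: "Y \<in> fin \<Longrightarrow> (\<And>\<omega>. \<omega> \<in> space M \<Longrightarrow> 0 \<le> Y \<omega>) \<Longrightarrow> 0 \<le> e Y"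
  using e_mono[of "\<lambda>_. 0" Y] fin_const e_const by simp

lemma e_diff_ge: "Y \<in> fin \<Longrightarrow> Z \<in> fin \<Longrightarrow> e Y - e Z \<le> e (\<lambda>\<omega>. Y \<omega> - Z \<omega>)"
  using e_add[OF fin_diff, of Y Z Z] by simp

text \<open>Constants pass through exactly: the inequality for adding \<open>a\<close> is reversed
  by adding \<open>- a\<close>.\<close>

lemma e_affine:
  assumes "Y \<in> fin" "0 \<le> b" shows "e (\<lambda>\<omega>. a + b * Y \<omega>) = a + b * e Y"
proof (rule antisym)
  have bY: "(\<lambda>\<omega>. b * Y \<omega>) \<in> fin" by (rule fin_scale[OF assms(1)])
  show "e (\<lambda>\<omega>. a + b * Y \<omega>) \<le> a + b * e Y"
    using e_add[OF fin_const bY, of a] e_scale[OF assms] by (simp add: e_const)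
  have "e (\<lambda>\<omega>. - a + (a + b * Y \<omega>)) \<le> - a + e (\<lambda>\<omega>. a + b * Y \<omega>)"
    using e_add[OF fin_const fin_add[OF fin_const bY], of "-a" a] by (simp add: e_const)
  then show "a + b * e Y \<le> e (\<lambda>\<omega>. a + b * Y \<omega>)" using e_scale[OF assms] by simp
qed

lemma e_abs_diff_le:
  assumes "Y \<in> fin" "Z \<in> fin" "\<And>\<omega>. \<omega> \<in> space M \<Longrightarrow> \<bar>Y \<omega> - Z \<omega>\<bar> \<le> W \<omega>" "W \<in> fin"
  shows "\<bar>e Y - e Z\<bar> \<le> e W"
proof -
  have "e Y \<le> e (\<lambda>\<omega>. Z \<omega> + W \<omega>)" "e Z \<le> e (\<lambda>\<omega>. Y \<omega> + W \<omega>)"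
    using assms by (intro e_mono fin_add; fastforce)+
  then show ?thesis using e_add[of Z W] e_add[of Y W] assms by simp
qed

lemma BL_fin:
  assumes "\<phi> \<in> BL n" "\<And>i. i < n \<Longrightarrow> Z i \<in> H"
  shows "(\<lambda>\<omega>. \<phi> (\<lambda>i. Z i \<omega>)) \<in> fin"
proof -
  obtain B where B: "\<And>x. \<bar>\<phi> x\<bar> \<le> B" using BL_bound[OF assms(1)] by blast
  show ?thesis
    by (rule fin_dom[OF C_lLip_H[OF BL_imp_C_lLip[OF assms(1)] assms(2)] fin_const B])
qed

text \<open>An upper bound carried by an explicit dominating variable of finite expectation, so that
  no infimum has to be handled. It bounds \<open>V\<close> through property (C) and
  \<open>V_hat\<close> by definition.\<close>

definition hat_le :: "'a set \<Rightarrow> real \<Rightarrow> bool" where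
  "hat_le A r \<longleftrightarrow> (\<exists>\<xi>\<in>fin. (\<forall>\<omega>\<in>space M. indicator A \<omega> \<le> \<xi> \<omega>) \<and> e \<xi> \<le> r)"

lemma hat_le_mono: "hat_le A r \<Longrightarrow> B \<inter> space M \<subseteq> A \<Longrightarrow> r \<le> q \<Longrightarrow> hat_le B q"
  unfolding hat_le_def
  by (smt (verit) IntI indicator_eq_0_iff indicator_simps(1) indicator_pos_le subset_iff)

lemma hat_le_nonneg: "hat_le A r \<Longrightarrow> 0 \<le> r"
  unfolding hat_le_def by (meson e_nonneg indicator_pos_le order_trans)

lemma V_hat_le: "hat_le A r \<Longrightarrow> V_hat M H E A \<le> ereal r"
proof -
  assume "hat_le A r"
  then obtain \<xi> where \<xi>: "\<xi> \<in> fin" "\<forall>\<omega>\<in>space M. indicator A \<omega> \<le> \<xi> \<omega>" "e \<xi> \<le> r"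
    unfolding hat_le_def by blast
  have "V_hat M H E A \<le> E \<xi>"
    unfolding V_hat_def using \<xi> fin_H by (intro Inf_lower) blast
  then show ?thesis using \<xi> E_fin order_trans by fastforce
qed

lemma V_hat_nonneg: "0 \<le> V_hat M H E A"
  unfolding V_hat_def
  by (rule Inf_greatest) (auto intro!: E_nonneg intro: order_trans[OF indicator_pos_le])

lemma zero_fin: "(\<lambda>_. 0) \<in> fin" by (rule fin_const)

lemma property_C_le:
  assumes "property_C M H E V" "A \<in> sets M" "hat_le A r"
  shows "V A \<le> r"
proof -
  obtain \<xi> where \<xi>: "\<xi> \<in> fin" "\<forall>\<omega>\<in>space M. indicator A \<omega> \<le> \<xi> \<omega>" "e \<xi> \<le> r"
    using assms(3) unfolding hat_le_def by blast
  have "ereal (V A) \<le> E \<xi>"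
    using assms(1,2) \<xi> zero_H unfolding property_C_def
    by (smt (verit, best) fin_H indicator_pos_le)
  then show ?thesis using \<xi> E_fin by simp
qed

lemma property_C_ge:
  assumes "property_C M H E V" "A \<in> sets M" "Y \<in> fin" "\<And>\<omega>. \<omega> \<in> space M \<Longrightarrow> Y \<omega> \<le> indicator A \<omega>"
  shows "e Y \<le> V A"
proof -
  have "E Y \<le> ereal (V A)"
    using assms const_H[of 1] fin_H[OF assms(3)] unfolding property_C_def
    by (smt (verit, best) indicator_le_1)
  then show ?thesis using E_fin[OF assms(3)] by simp
qed

end

section \<open>Independence on bounded Lipschitz functions\<close>

text \<open>Lipschitz substitute for the indicator of \<open>[a, \<infinity>)\<close>: for positive
  \<open>d\<close> it lies between that indicator and the one of
  \<open>(a - d, \<infinity>)\<close>.\<close>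

definition ramp :: "real \<Rightarrow> real \<Rightarrow> real \<Rightarrow> real" where
  "ramp a d x = min (max ((x - a) / d + 1) 0) 1"

lemma ramp_lip1: "lip1 (ramp a d)"
proof -
  have "lip1 (\<lambda>x. min (max ((1 / d) * x + (1 - a / d)) 0) 1)"
    by (rule lip1_comp[OF lip1_min lip1_comp[OF lip1_max lip1_affine]])
  moreover have "(1 / d) * x + (1 - a / d) = (x - a) / d + 1" for x by (simp add: diff_divide_distrib)
  ultimately show ?thesis unfolding ramp_def by (simp only:)
qed

lemma ramp_bounds: "0 \<le> ramp a d x" "ramp a d x \<le> 1"
  by (auto simp: ramp_def)

lemma ramp_eq_1: "0 < d \<Longrightarrow> a \<le> x \<Longrightarrow> ramp a d x = 1"
  by (auto simp: ramp_def)

lemma ramp_eq_0: "0 < d \<Longrightarrow> x \<le> a - d \<Longrightarrow> ramp a d x = 0"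
proof -
  assume "0 < d" "x \<le> a - d"
  then have "(x - a) / d \<le> -1" by (simp add: field_simps)
  then show ?thesis by (auto simp: ramp_def)
qed

locale independent_square_integrable = sublinear_expectation_space M H E
  for M :: "'a measure" and H E +
  fixes X :: "nat \<Rightarrow> 'a \<Rightarrow> real"
  assumes indep: "independent_seq H E X"
    and square_fin: "n \<ge> 1 \<Longrightarrow> E (\<lambda>\<omega>. (X n \<omega>)\<^sup>2) < \<infinity>"
begin

lemma X_H: "n \<ge> 1 \<Longrightarrow> X n \<in> H"
  using indep unfolding independent_seq_def by blast

lemma X_Suc_H: "X (Suc n) \<in> H"
  by (simp add: X_H)

text \<open>\<open>K i\<close> integrates out the coordinate \<open>i\<close>, which stands for \<open>X (Suc i)\<close>.  On bounded Lipschitz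
  functions independence says that the joint expectation is the composition of these operators.\<close>

definition K :: "nat \<Rightarrow> ((nat \<Rightarrow> real) \<Rightarrow> real) \<Rightarrow> (nat \<Rightarrow> real) \<Rightarrow> real" where
  "K i \<phi> x = e (\<lambda>\<omega>. \<phi> (x(i := X (Suc i) \<omega>)))"

definition EE :: "((nat \<Rightarrow> real) \<Rightarrow> real) \<Rightarrow> real" where
  "EE \<phi> = e (\<lambda>\<omega>. \<phi> (\<lambda>i. X (Suc i) \<omega>))"

lemma BL_section:
  assumes "\<phi> \<in> BL (Suc i)" shows "(\<lambda>y. \<phi> (x(i := y 0))) \<in> BL 1"
proof -
  obtain L where L: "0 \<le> L" "\<And>x y. \<bar>\<phi> x - \<phi> y\<bar> \<le> L * (\<Sum>i<Suc i. \<bar>x i - y i\<bar>)"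
    using LipD[OF BL_Lip[OF assms(1)]] by blast
  obtain B where "\<And>x. \<bar>\<phi> x\<bar> \<le> B" using BL_bound[OF assms] by blast
  moreover have "(\<lambda>y. \<phi> (x(i := y 0))) \<in> Lip 1"
  proof (rule LipI[OF L(1)])
    fix y z :: "nat \<Rightarrow> real"
    have "(\<Sum>j<Suc i. \<bar>(x(i := y 0)) j - (x(i := z 0)) j\<bar>) = (\<Sum>j<1. \<bar>y j - z j\<bar>)" by simp
    then show "\<bar>\<phi> (x(i := y 0)) - \<phi> (x(i := z 0))\<bar> \<le> L * (\<Sum>j<1. \<bar>y j - z j\<bar>)"
      using L(2)[of "x(i := y 0)" "x(i := z 0)"] by simp
  qed
  ultimately show ?thesis by (intro BLI)
qed

lemma section_fin: "\<phi> \<in> BL (Suc i) \<Longrightarrow> (\<lambda>\<omega>. \<phi> (x(i := X (Suc i) \<omega>))) \<in> fin"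
  using BL_fin[OF BL_section, of \<phi> i "\<lambda>_. X (Suc i)" x] X_Suc_H by simp

lemma joint_fin: "\<phi> \<in> BL n \<Longrightarrow> (\<lambda>\<omega>. \<phi> (\<lambda>i. X (Suc i) \<omega>)) \<in> fin"
  by (rule BL_fin) (auto simp: X_Suc_H)

text \<open>A sub-linear expectation is a contraction in the supremum norm, so both the Lipschitz
  constant and the bound survive. This is what makes the operators iterable.\<close>

lemma K_BL:
  assumes "\<phi> \<in> BL (Suc i)" shows "K i \<phi> \<in> BL i"
proof -
  obtain L where L: "0 \<le> L" "\<And>x y. \<bar>\<phi> x - \<phi> y\<bar> \<le> L * (\<Sum>j<Suc i. \<bar>x j - y j\<bar>)"
    using LipD[OF BL_Lip[OF assms(1)]] by blast
  obtain B where B: "\<And>x. \<bar>\<phi> x\<bar> \<le> B" using BL_bound[OF assms] by blast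
  have "K i \<phi> \<in> Lip i"
  proof (rule LipI[OF L(1)])
    fix x y :: "nat \<Rightarrow> real"
    have "\<bar>K i \<phi> x - K i \<phi> y\<bar> \<le> e (\<lambda>_. L * (\<Sum>j<i. \<bar>x j - y j\<bar>))"
      unfolding K_def
    proof (rule e_abs_diff_le[OF section_fin[OF assms] section_fin[OF assms] _ fin_const])
      fix \<omega>
      have "(\<Sum>j<Suc i. \<bar>(x(i := X (Suc i) \<omega>)) j - (y(i := X (Suc i) \<omega>)) j\<bar>) = (\<Sum>j<i. \<bar>x j - y j\<bar>)"
        by simp
      then show "\<bar>\<phi> (x(i := X (Suc i) \<omega>)) - \<phi> (y(i := X (Suc i) \<omega>))\<bar> \<le> L * (\<Sum>j<i. \<bar>x j - y j\<bar>)"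
        using L(2)[of "x(i := X (Suc i) \<omega>)" "y(i := X (Suc i) \<omega>)"] by simp
    qed
    then show "\<bar>K i \<phi> x - K i \<phi> y\<bar> \<le> L * (\<Sum>j<i. \<bar>x j - y j\<bar>)" by (simp add: e_const)
  qed
  moreover have "\<bar>K i \<phi> x\<bar> \<le> B" for x
    using e_abs_diff_le[OF section_fin[OF assms] zero_fin _ fin_const, of x B] B
    by (simp add: K_def e_const)
  ultimately show ?thesis by (rule BLI)
qed

text \<open>The provisos in the definition of independence hold because the inner expectations are
  bounded Lipschitz functions of the earlier variables, hence in \<open>H\<close> after
  substitution.\<close>

lemma EE_K:
  assumes "\<phi> \<in> BL (Suc i)" shows "EE (K i \<phi>) = EE \<phi>"
proof (cases "i = 0")
  case True
  \<comment> \<open>Independence concerns the second variable onwards; with no earlier variable the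
    one-step operator already yields a constant.\<close>
  have "K i \<phi> x = EE \<phi>" for x
    unfolding K_def EE_def
    by (intro arg_cong[where f = e] ext Lip_cong_coords[OF BL_Lip[OF assms]]) (simp add: True)
  then show ?thesis by (simp add: EE_def e_const)
next
  case False
  have "independent_to H E 1 (\<lambda>_. X (i + 1)) i (\<lambda>j. X (j + 1))"
    using indep False unfolding independent_seq_def by simp
  then have ind: "(\<forall>x. E (\<lambda>\<omega>. \<bar>\<phi> (vec_append i x (\<lambda>_. X (i + 1) \<omega>))\<bar>) < \<infinity>) \<Longrightarrow>
     (\<lambda>\<omega>. real_of_ereal (E (\<lambda>\<omega>'. \<bar>\<phi> (vec_append i (\<lambda>j. X (j + 1) \<omega>) (\<lambda>_. X (i + 1) \<omega>'))\<bar>))) \<in> H \<Longrightarrow>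
     E (\<lambda>\<omega>. \<bar>real_of_ereal (E (\<lambda>\<omega>'. \<bar>\<phi> (vec_append i (\<lambda>j. X (j + 1) \<omega>) (\<lambda>_. X (i + 1) \<omega>'))\<bar>))\<bar>) < \<infinity> \<Longrightarrow>
     (\<lambda>\<omega>. real_of_ereal (E (\<lambda>\<omega>'. \<phi> (vec_append i (\<lambda>j. X (j + 1) \<omega>) (\<lambda>_. X (i + 1) \<omega>'))))) \<in> H \<Longrightarrow>
     E (\<lambda>\<omega>. \<phi> (vec_append i (\<lambda>j. X (j + 1) \<omega>) (\<lambda>_. X (i + 1) \<omega>))) =
     E (\<lambda>\<omega>. real_of_ereal (E (\<lambda>\<omega>'. \<phi> (vec_append i (\<lambda>j. X (j + 1) \<omega>) (\<lambda>_. X (i + 1) \<omega>')))))"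
    using BL_imp_C_lLip[OF assms] unfolding independent_to_def Let_def by simp
  \<comment> \<open>\<open>vec_append\<close> repeats the new value in all coordinates from
    \<open>i\<close> on, of which \<phi> sees only the first.\<close>
  have app: "\<phi> (vec_append i x (\<lambda>_. c)) = \<phi> (x(i := c))" for x c
    by (rule Lip_cong_coords[OF BL_Lip[OF assms]]) (auto simp: vec_append_def less_Suc_eq)
  have app': "\<phi> (vec_append i (\<lambda>j. X (Suc j) \<omega>) (\<lambda>_. X (Suc i) \<omega>)) = \<phi> (\<lambda>j. X (Suc j) \<omega>)" for \<omega>
    by (rule Lip_cong_coords[OF BL_Lip[OF assms]]) (auto simp: vec_append_def less_Suc_eq)
  have abs_BL: "(\<lambda>x. \<bar>\<phi> x\<bar>) \<in> BL (Suc i)" using BL_lip1[OF assms lip1_abs] .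
  have kabs: "real_of_ereal (E (\<lambda>\<omega>'. \<bar>\<phi> (x(i := X (Suc i) \<omega>'))\<bar>)) = K i (\<lambda>x. \<bar>\<phi> x\<bar>) x" for x
    by (simp add: K_def e_def)
  have k: "real_of_ereal (E (\<lambda>\<omega>'. \<phi> (x(i := X (Suc i) \<omega>')))) = K i \<phi> x" for x
    by (simp add: K_def e_def)
  have "E (\<lambda>\<omega>. \<phi> (\<lambda>j. X (Suc j) \<omega>)) = E (\<lambda>\<omega>. K i \<phi> (\<lambda>j. X (Suc j) \<omega>))"
    using ind unfolding Suc_eq_plus1[symmetric] app' unfolding app k kabs
    using fin_H[OF joint_fin[OF K_BL[OF assms]]] joint_fin[OF K_BL[OF abs_BL]] 
      section_fin[OF abs_BL] by (auto simp: fin_def)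
  then show ?thesis by (simp add: EE_def e_def)
qed

lemma EE_mono: "\<phi> \<in> BL n \<Longrightarrow> \<psi> \<in> BL m \<Longrightarrow> (\<And>x. \<phi> x \<le> \<psi> x) \<Longrightarrow> EE \<phi> \<le> EE \<psi>"
  unfolding EE_def by (intro e_mono joint_fin)

text \<open>Dynamic programming: each step of the comparison shows that the numbers
  \<open>EE (U m)\<close> do not increase with \<open>m\<close>.\<close>

lemma EE_supersolution:
  assumes "\<And>m. m \<le> n \<Longrightarrow> U m \<in> BL m" and "\<And>m x. m < n \<Longrightarrow> K m (U (Suc m)) x \<le> U m x"
    and "\<And>x. U 0 x \<le> c"
  shows "EE (U n) \<le> c"
proof -
  have "EE (U m) \<le> c" if "m \<le> n" for m
    using that
  proof (induction m)
    case 0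
    have "EE (U 0) \<le> EE (\<lambda>_. c)" using assms by (intro EE_mono BL_const) auto
    then show ?case by (simp add: EE_def e_const)
  next
    case (Suc m)
    have "EE (U (Suc m)) = EE (K m (U (Suc m)))" using EE_K assms(1) Suc.prems by simp
    also have "\<dots> \<le> EE (U m)" using Suc.prems assms(1,2)
      by (intro EE_mono[of _ m _ m] K_BL) auto
    finally show ?case using Suc by simp
  qed
  then show ?thesis by simp
qed

text \<open>Functions of the earlier coordinates are constants for the last one. The slope is
  nonnegative because \<open>e\<close> is only positively homogeneous.\<close>

lemma K_affine:
  assumes "a \<in> BL i" "b \<in> BL i" "\<And>x. 0 \<le> b x" "\<phi> \<in> BL (Suc i)"
  shows "K i (\<lambda>x. a x + b x * \<phi> x) x = a x + b x * K i \<phi> x"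
proof -
  have "a (x(i := z)) = a x" "b (x(i := z)) = b x" for z
    by (rule Lip_cong_coords[OF BL_Lip[OF assms(1)]], simp)
       (rule Lip_cong_coords[OF BL_Lip[OF assms(2)]], simp)
  then show ?thesis unfolding K_def using e_affine[OF section_fin[OF assms(4)]] assms(3) by simp
qed

lemma K_coord: "K i (\<lambda>x. f (x i)) x = e (\<lambda>\<omega>. f (X (Suc i) \<omega>))"
  by (simp add: K_def)

lemma BL_coord: "i < n \<Longrightarrow> lip1 f \<Longrightarrow> (\<And>x. \<bar>f x\<bar> \<le> B) \<Longrightarrow> (\<lambda>x. f (x i)) \<in> BL n"
  by (rule BLI[OF Lip_coord_fun])

lemma EE_scale: "\<phi> \<in> BL n \<Longrightarrow> 0 \<le> c \<Longrightarrow> EE (\<lambda>x. c * \<phi> x) = c * EE \<phi>"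
  unfolding EE_def by (intro e_scale joint_fin)

text \<open>Since the earlier factors are nonnegative, the expectation of the last one is pulled out
  with equality, in spite of sub-linearity.\<close>

lemma EE_prod:
  assumes "\<And>j. j < n \<Longrightarrow> lip1 (G j)" "\<And>j x. j < n \<Longrightarrow> 0 \<le> G j x" "\<And>j x. j < n \<Longrightarrow> G j x \<le> B j"
  shows "EE (\<lambda>x. \<Prod>j<n. G j (x j)) = (\<Prod>j<n. e (\<lambda>\<omega>. G j (X (Suc j) \<omega>)))"
  using assms
proof (induction n)
  case 0
  then show ?case by (simp add: EE_def e_const)
next
  case (Suc n)
  have bl: "(\<lambda>x. G j (x j)) \<in> BL m" if "j < Suc n" "j < m" for j m
    using Suc.prems that by (intro BL_coord[where B = "B j"]) auto
  have P: "(\<lambda>x. \<Prod>j<n. G j (x j)) \<in> BL n" by (intro BL_prod bl) auto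
  let ?c = "e (\<lambda>\<omega>. G n (X (Suc n) \<omega>))"
  have G: "(\<lambda>x. G n (x n)) \<in> BL (Suc n)" by (intro bl) auto
  have c: "0 \<le> ?c"
    using section_fin[OF G] Suc.prems(2) by (intro e_nonneg) auto
  have "EE (\<lambda>x. \<Prod>j<Suc n. G j (x j)) = EE (K n (\<lambda>x. 0 + (\<Prod>j<n. G j (x j)) * G n (x n)))"
    using EE_K[OF BL_mult[OF BL_mono[OF P] G]] by simp
  also have "K n (\<lambda>x. 0 + (\<Prod>j<n. G j (x j)) * G n (x n)) = (\<lambda>x. ?c * (\<Prod>j<n. G j (x j)))"
  proof
    fix x
    have "\<And>x. 0 \<le> (\<Prod>j<n. G j (x j))" using Suc.prems(2) by (intro prod_nonneg) auto
    then show "K n (\<lambda>x. 0 + (\<Prod>j<n. G j (x j)) * G n (x n)) x = ?c * (\<Prod>j<n. G j (x j))"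
      using K_affine[OF BL_const P _ G, of 0 x] by (simp only: K_coord) simp
  qed
  also have "EE \<dots> = ?c * (\<Prod>j<n. e (\<lambda>\<omega>. G j (X (Suc j) \<omega>)))"
    using Suc EE_scale[OF P c] by simp
  finally show ?case by (simp add: mult.commute)
qed

text \<open>The function \<open>U m\<close> in the proof dominates the value of the game
  that pays \<open>1\<close> if some partial sum (up to smoothing) reaches \<open>x\<close>, given the first \<open>m\<close> coordinates.\<close>

lemma exponential_maximal:
  assumes lip: "\<And>j. lip1 (g j)" and bdd: "\<And>j z. g j z \<le> B j" and lam: "0 < \<theta>"
    and c: "\<And>j. j < n \<Longrightarrow> 0 \<le> c j"
    and le: "\<And>j. j < n \<Longrightarrow> e (\<lambda>\<omega>. exp (\<theta> * g j (X (Suc j) \<omega>))) \<le> exp (c j)"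
  shows "hat_le {\<omega> \<in> space M. \<exists>m\<in>{1..n}. x \<le> (\<Sum>j<m. g j (X (Suc j) \<omega>))}
           (exp (1 - \<theta> * x + (\<Sum>j<n. c j)))"
proof -
  \<comment> \<open>A ramp of this width costs a factor e, the 1 in the exponent of the
    bound.\<close>
  define d where "d = 1 / \<theta>"
  have d: "0 < d" "\<theta> * d = 1" using lam by (auto simp: d_def)
  define T where "T m y = (\<Sum>j<m. g j (y j))" for m and y :: "nat \<Rightarrow> real"
  \<comment> \<open>Smoothed indicator that no partial sum has reached \<open>x\<close> so
    far.\<close>
  define P where "P m y = (\<Prod>i\<in>{1..m}. 1 - ramp x d (T i y))" for m y
  define k where "k m = (\<Sum>j=m..<n. c j) - \<theta> * x + 1" for m
  \<comment> \<open>Exponential bound for reaching \<open>x\<close> later on from the current sum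
    \<open>r\<close>, capped at 1; \<open>k m\<close> collects the costs \<open>c j\<close> still to
    come.\<close>
  define F where "F m r = exp (min (\<theta> * r + k m) 0)" for m r
  define U where "U m y = 1 - P m y * (1 - F m (T m y))" for m y
  have T_Lip: "T i \<in> Lip m" if "i \<le> m" for i m
    unfolding T_def using that by (intro Lip_sum Lip_coord_fun lip) auto
  have lip_1ramp: "lip1 (\<lambda>r. 1 - ramp x d r)"
    using lip1_comp[OF lip1_affine[of "-1" 1] ramp_lip1[of x d]] by simp
  have rampT: "(\<lambda>y. 1 - ramp x d (T i y)) \<in> BL m" if "i \<le> m" for i m
    by (rule BL_Lip_compose[OF T_Lip[OF that] lip_1ramp, where B = 1])
       (use ramp_bounds[of x d] in auto)
  have P_BL: "P i \<in> BL m" if "i \<le> m" for i m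
    unfolding P_def using that by (intro BL_prod rampT) auto
  have P_nonneg: "0 \<le> P m y" for m y
    unfolding P_def using ramp_bounds(2)[of x d] by (intro prod_nonneg) auto
  have F_lip: "lip1 (F m)" for m
    unfolding F_def using lip1_comp[OF lip1_exp_min[of 0] lip1_affine[of \<theta> "k m"]] by simp
  have F_bd: "0 \<le> F m r" "F m r \<le> 1" for m r by (auto simp: F_def)
  have FT_BL: "(\<lambda>y. F i (T i' y)) \<in> BL m" if "i' \<le> m" for i i' m
    by (rule BL_Lip_compose[OF T_Lip[OF that] F_lip, where B = 1]) (use F_bd in auto)
  have U_BL: "U m \<in> BL m" for m
    unfolding U_def by (intro BL_diff BL_mult P_BL FT_BL BL_const) auto
  have step: "K m (U (Suc m)) y \<le> U m y" if "m < n" for m y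
  proof -
    have km: "k m = k (Suc m) + c m" using that by (simp add: k_def sum.atLeast_Suc_lessThan)
    have k1: "1 - \<theta> * x \<le> k (Suc m)" using c that by (auto simp: k_def intro!: sum_nonneg)
    have absorb: "(1 - ramp x d r) * (1 - F (Suc m) r) = 1 - F (Suc m) r" for r
    proof (cases "r \<le> x - d")
      case True
      then show ?thesis using ramp_eq_0[OF d(1)] by simp
    next
      case False
      then have "\<theta> * (x - d) < \<theta> * r" using lam by simp
      then have "0 \<le> \<theta> * r + k (Suc m)" using k1 d(2) by (simp add: algebra_simps)
      then show ?thesis by (simp add: F_def)
    qed
    have US: "U (Suc m) = (\<lambda>z. (1 - P m z) + P m z * F (Suc m) (T (Suc m) z))"
    proof
      fix z
      have "P (Suc m) z * (1 - F (Suc m) (T (Suc m) z)) =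
          P m z * ((1 - ramp x d (T (Suc m) z)) * (1 - F (Suc m) (T (Suc m) z)))"
        unfolding P_def by simp
      then show "U (Suc m) z = (1 - P m z) + P m z * F (Suc m) (T (Suc m) z)"
        unfolding U_def absorb by (simp add: algebra_simps)
    qed
    have 1: "K m (U (Suc m)) y = (1 - P m y) + P m y * K m (\<lambda>z. F (Suc m) (T (Suc m) z)) y"
      unfolding US by (rule K_affine) (auto intro!: BL_diff BL_const P_BL FT_BL P_nonneg)
    have gf: "(\<lambda>\<omega>. exp (\<theta> * g m (X (Suc m) \<omega>))) \<in> fin"
    proof -
      have "lip1 (\<lambda>z. exp (min (\<theta> * g m z + 0) (\<theta> * B m)))"
        by (rule lip1_comp[OF lip1_exp_min lip1_comp[OF lip1_affine lip]])
      moreover have "min (\<theta> * g m z + 0) (\<theta> * B m) = \<theta> * g m z" for z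
        using bdd lam by (simp add: min_def)
      ultimately have l: "lip1 (\<lambda>z. exp (\<theta> * g m z))" by simp
      show ?thesis
        by (rule fin_dom[OF H_lip1[OF X_Suc_H l] fin_const[of "exp (\<theta> * B m)"]])
           (use bdd lam in auto)
    qed
    have "K m (\<lambda>z. F (Suc m) (T (Suc m) z)) y \<le> F m (T m y)"
    proof -
      have Tm: "T (Suc m) (y(m := z)) = T m y + g m z" for z
        by (simp add: T_def)
      have fin1: "(\<lambda>\<omega>. F (Suc m) (T (Suc m) (y(m := X (Suc m) \<omega>)))) \<in> fin"
        by (rule section_fin[OF FT_BL]) simp
      have "K m (\<lambda>z. F (Suc m) (T (Suc m) z)) y \<le>
          e (\<lambda>\<omega>. exp (\<theta> * T m y + k (Suc m)) * exp (\<theta> * g m (X (Suc m) \<omega>)))"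
        unfolding K_def
        by (rule e_mono[OF fin1 fin_scale[OF gf]])
           (auto simp: F_def Tm algebra_simps simp flip: exp_add)
      also have "\<dots> \<le> exp (\<theta> * T m y + k (Suc m)) * exp (c m)"
        using le[OF that] e_scale[OF gf] by simp
      also have "\<dots> = exp (\<theta> * T m y + k m)" by (simp add: km algebra_simps flip: exp_add)
      finally have "K m (\<lambda>z. F (Suc m) (T (Suc m) z)) y \<le> exp (\<theta> * T m y + k m)" .
      moreover have "K m (\<lambda>z. F (Suc m) (T (Suc m) z)) y \<le> 1"
        unfolding K_def using e_mono[OF fin1 fin_const[of 1]] F_bd e_const by simp
      ultimately show ?thesis unfolding F_def by (simp add: min_def)
    qed
    then have "P m y * K m (\<lambda>z. F (Suc m) (T (Suc m) z)) y \<le> P m y * F m (T m y)"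
      by (rule mult_left_mono) (rule P_nonneg)
    then show ?thesis unfolding 1 U_def by (simp add: algebra_simps)
  qed
  have U0: "U 0 y \<le> exp (1 - \<theta> * x + (\<Sum>j<n. c j))" for y
  proof -
    have "U 0 y = exp (min (k 0) 0)" by (simp add: U_def P_def F_def T_def)
    also have "\<dots> \<le> exp (k 0)" by simp
    finally show ?thesis by (simp add: k_def lessThan_atLeast0 algebra_simps)
  qed
  have "EE (U n) \<le> exp (1 - \<theta> * x + (\<Sum>j<n. c j))"
    by (rule EE_supersolution[OF U_BL step U0])
  moreover have "indicator {\<omega> \<in> space M. \<exists>m\<in>{1..n}. x \<le> (\<Sum>j<m. g j (X (Suc j) \<omega>))} \<omega>
      \<le> U n (\<lambda>i. X (Suc i) \<omega>)" if "\<omega> \<in> space M" for \<omega>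
  proof (cases "\<exists>m\<in>{1..n}. x \<le> (\<Sum>j<m. g j (X (Suc j) \<omega>))")
    case True
    then obtain m where m: "m \<in> {1..n}" "x \<le> T m (\<lambda>i. X (Suc i) \<omega>)" by (auto simp: T_def)
    have "P n (\<lambda>i. X (Suc i) \<omega>) = 0"
      unfolding P_def
    proof (rule prod_zero[OF finite_atLeastAtMost bexI[OF _ m(1)]])
      show "1 - ramp x d (T m (\<lambda>i. X (Suc i) \<omega>)) = 0" using ramp_eq_1[OF d(1) m(2)] by simp
    qed
    then show ?thesis by (simp add: U_def)
  next
    case False
    have "P n (\<lambda>i. X (Suc i) \<omega>) \<le> 1"
      unfolding P_def by (intro prod_le_1) (simp add: ramp_bounds)
    then have "P n (\<lambda>i. X (Suc i) \<omega>) * (1 - F n (T n (\<lambda>i. X (Suc i) \<omega>))) \<le> 1"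
      by (rule mult_le_one) (simp_all add: F_bd)
    then have "0 \<le> U n (\<lambda>i. X (Suc i) \<omega>)" unfolding U_def by linarith
    moreover have "indicator {\<omega> \<in> space M. \<exists>m\<in>{1..n}. x \<le> (\<Sum>j<m. g j (X (Suc j) \<omega>))} \<omega> = (0::real)"
      using False by (intro indicator_simps(2)) blast
    ultimately show ?thesis by linarith
  qed
  ultimately show ?thesis
    unfolding hat_le_def EE_def by (intro bexI[OF _ joint_fin[OF U_BL[of n]]] conjI ballI)
qed

text \<open>The last coordinates are integrated out one at a time, each passing through the affine
  form whose coefficients live on the first \<open>m\<close>. When none is left, \<phi> depends on
  no coordinate and is constant.\<close>

lemma EE_block:
  assumes "\<phi> \<in> BL (m + k)" and "\<And>x y. (\<And>i. m \<le> i \<Longrightarrow> x i = y i) \<Longrightarrow> \<phi> x = \<phi> y"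
    and "a \<in> BL m" "b \<in> BL m" "\<And>x. 0 \<le> b x"
  shows "EE (\<lambda>x. a x + b x * \<phi> x) = EE (\<lambda>x. a x + b x * EE \<phi>)"
  using assms
proof (induction k arbitrary: \<phi>)
  case 0
  have "\<phi> x = \<phi> (\<lambda>_. 0)" for x
  proof -
    have "\<phi> x = \<phi> (\<lambda>i. if i < m then x i else 0)"
    proof (rule Lip_cong_coords[OF BL_Lip[OF 0(1)]])
    qed simp
    also have "\<dots> = \<phi> (\<lambda>_. 0)" by (rule 0(2)) simp
    finally show ?thesis .
  qed
  then obtain c where \<phi>: "\<And>x. \<phi> x = c" by meson
  then have EE: "EE \<phi> = c" unfolding EE_def by (simp only: e_const)
  show ?case unfolding EE unfolding \<phi> ..
next
  case (Suc k)
  have bl: "\<phi> \<in> BL (Suc (m + k))" "a \<in> BL (m + k)" "b \<in> BL (m + k)"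
    using Suc.prems(1) BL_mono[OF Suc.prems(3)] BL_mono[OF Suc.prems(4)] by simp_all
  have "EE (\<lambda>x. a x + b x * \<phi> x) = EE (K (m + k) (\<lambda>x. a x + b x * \<phi> x))"
    by (rule EE_K[OF BL_add[OF BL_mono[OF bl(2)] BL_mult[OF BL_mono[OF bl(3)] bl(1)]], symmetric]) simp_all
  also have "K (m + k) (\<lambda>x. a x + b x * \<phi> x) = (\<lambda>x. a x + b x * K (m + k) \<phi> x)"
    by (rule ext, rule K_affine[OF bl(2,3) Suc.prems(5) bl(1)])
  also have "EE \<dots> = EE (\<lambda>x. a x + b x * EE (K (m + k) \<phi>))"
  proof (rule Suc.IH[OF K_BL[OF bl(1)] _ Suc.prems(3,4,5)])
    fix x y :: "nat \<Rightarrow> real" assume "\<And>i. m \<le> i \<Longrightarrow> x i = y i"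
    then show "K (m + k) \<phi> x = K (m + k) \<phi> y"
      unfolding K_def by (intro arg_cong[where f = e] ext Suc.prems(2)) simp
  qed
  finally show ?case using EE_K[OF bl(1)] by simp
qed

text \<open>Replacement for the second Borel-Cantelli lemma. The form \<open>1 - \<Prod>\<close>
  matters: its recursion \<open>(1 - P) + P * F\<close> has nonnegative coefficients and so is
  evaluated exactly, whereas the expectation of the bare product would involve the conjugate
  expectations of the factors.\<close>

lemma EE_one_minus_prod:
  assumes "mono \<nu>" and "\<And>i. F i \<in> BL (\<nu> (Suc i))"
    and "\<And>i x y. (\<And>j. \<nu> i \<le> j \<Longrightarrow> x j = y j) \<Longrightarrow> F i x = F i y"
    and "\<And>i x. F i x \<le> 1"
  shows "EE (\<lambda>x. 1 - (\<Prod>i<I. 1 - F i x)) = 1 - (\<Prod>i<I. 1 - EE (F i))"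
proof (induction I)
  case 0
  then show ?case by (simp add: EE_def e_const)
next
  case (Suc I)
  define P where "P x = (\<Prod>i<I. 1 - F i x)" for x
  have P: "P \<in> BL (\<nu> I)"
    unfolding P_def
  proof (rule BL_prod, rule BL_diff[OF BL_const BL_mono[OF assms(2)]])
    fix i assume "i \<in> {..<I}"
    then show "\<nu> (Suc i) \<le> \<nu> I" using assms(1) by (simp add: monoD)
  qed
  have P0: "0 \<le> P x" for x unfolding P_def using assms(4) by (intro prod_nonneg) auto
  have FI: "F I \<in> BL (\<nu> I + (\<nu> (Suc I) - \<nu> I))" using assms(1,2) by (simp add: monoD)
  have c1: "EE (F I) \<le> 1"
    using EE_mono[OF assms(2) BL_const, of I 1] assms(4) by (simp add: EE_def e_const)
  have "EE (\<lambda>x. 1 - (\<Prod>i<Suc I. 1 - F i x)) = EE (\<lambda>x. (1 - P x) + P x * F I x)"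
    by (simp add: P_def algebra_simps)
  also have "\<dots> = EE (\<lambda>x. (1 - P x) + P x * EE (F I))"
    by (rule EE_block[OF FI assms(3) BL_diff[OF BL_const P] P P0])
  also have "\<dots> = EE (\<lambda>x. EE (F I) + (1 - EE (F I)) * (1 - P x))" by (simp add: algebra_simps)
  also have "\<dots> = EE (F I) + (1 - EE (F I)) * EE (\<lambda>x. 1 - P x)"
    unfolding EE_def using c1 unfolding EE_def
    by (intro e_affine joint_fin[OF BL_diff[OF BL_const P]]) simp
  finally show ?case using Suc by (simp add: P_def algebra_simps)
qed

end

section \<open>Pointwise exponential inequalities\<close>

text \<open>Taylor expansion at 0 with the second derivative of \<open>exp\<close> bounded by
  \<open>exp B\<close> to the left of \<open>B\<close>.\<close>

lemma exp_upper_quadratic: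
  fixes z B :: real
  assumes "z \<le> B" "0 \<le> B"
  shows "exp z \<le> 1 + z + z\<^sup>2 / 2 * exp B"
proof -
  define f where "f x = 1 + x + x\<^sup>2 / 2 * exp B - exp x" for x :: real
  have der: "(f has_real_derivative (1 + x * exp B - exp x)) (at x)" for x
    unfolding f_def by (auto intro!: derivative_eq_intros)
  have "f 0 \<le> f z"
  proof (cases "0 \<le> z")
    case True
    show ?thesis
    proof (rule DERIV_nonneg_imp_nondecreasing[where f = f, OF True])
      fix x assume x: "0 \<le> x" "x \<le> z"
      have "exp x - exp 0 \<le> exp x * (x - 0)" by (rule exp_diff_le)
      also have "\<dots> \<le> x * exp B" using x assms by (simp add: mult.commute mult_left_mono)
      finally have "0 \<le> 1 + x * exp B - exp x" by simp
      then show "\<exists>y. (f has_real_derivative y) (at x) \<and> 0 \<le> y" using der[of x] by blast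
    qed
  next
    case False
    show ?thesis
    proof (rule DERIV_nonpos_imp_nonincreasing[where f = f])
      show "z \<le> 0" using False by simp
      fix x :: real assume x: "z \<le> x" "x \<le> 0"
      have "1 + x \<le> exp x" by (rule exp_ge_add_one_self)
      moreover have "x * exp B \<le> x * 1" using x assms by (intro mult_left_mono_neg) auto
      ultimately have "1 + x * exp B - exp x \<le> 0" by linarith
      then show "\<exists>y. (f has_real_derivative y) (at x) \<and> y \<le> 0" using der[of x] by blast
    qed
  qed
  then show ?thesis by (simp add: f_def)
qed

lemma exp_lower_quadratic:
  fixes z B :: real
  assumes "\<bar>z\<bar> \<le> B"
  shows "1 + z + z\<^sup>2 / 2 * exp (- B) \<le> exp z"
proof -
  define f where "f x = exp x - (1 + x + x\<^sup>2 / 2 * exp (- B))" for x :: real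
  have der: "(f has_real_derivative (exp x - (1 + x * exp (- B)))) (at x)" for x
    unfolding f_def by (auto intro!: derivative_eq_intros)
  have "f 0 \<le> f z"
  proof (cases "0 \<le> z")
    case True
    show ?thesis
    proof (rule DERIV_nonneg_imp_nondecreasing[where f = f, OF True])
      fix x assume x: "0 \<le> x" "x \<le> z"
      have "1 + x \<le> exp x" by (rule exp_ge_add_one_self)
      moreover have "x * exp (- B) \<le> x * 1" using x assms by (intro mult_left_mono) auto
      ultimately have "0 \<le> exp x - (1 + x * exp (- B))" by linarith
      then show "\<exists>y. (f has_real_derivative y) (at x) \<and> 0 \<le> y" using der[of x] by blast
    qed
  next
    case False
    show ?thesis
    proof (rule DERIV_nonpos_imp_nonincreasing[where f = f])
      show "z \<le> 0" using False by simp
      fix x :: real assume x: "z \<le> x" "x \<le> 0"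
      have "exp x * (0 - x) \<le> exp 0 - exp x"
        using exp_ge_add_one_self[of "-x"] mult_left_mono[of "1 - x" "exp (-x)" "exp x"]
        by (simp add: algebra_simps flip: exp_add)
      moreover have "x * exp x \<le> x * exp (- B)" using x assms False by (intro mult_left_mono_neg) auto
      ultimately have "exp x - (1 + x * exp (- B)) \<le> 0" by (simp add: algebra_simps)
      then show "\<exists>y. (f has_real_derivative y) (at x) \<and> y \<le> 0" using der[of x] by blast
    qed
  qed
  then show ?thesis by (simp add: f_def)
qed

text \<open>Mean value theorem, with the degenerate endpoints apart. It serves twice: for the local
  Lipschitz bound of truncated powers and for the increments of a power of
  \<open>Lam\<close>.\<close>

lemma powr_diff_le:
  fixes A B p :: real
  assumes "0 \<le> B" "B \<le> A" "1 \<le> p"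
  shows "A powr p - B powr p \<le> p * A powr (p - 1) * (A - B)"
proof (cases "0 < B \<and> B < A")
  case True
  have "\<exists>z>B. z < A \<and> A powr p - B powr p = (A - B) * (p * z powr (p - 1))"
    using True by (intro MVT2) (auto intro!: derivative_eq_intros simp: powr_diff field_simps)
  then obtain z where z: "B < z" "z < A" "A powr p - B powr p = (A - B) * (p * z powr (p - 1))"
    by blast
  have "z powr (p - 1) \<le> A powr (p - 1)" using z True assms by (intro powr_mono2) auto
  then have "(A - B) * (p * z powr (p - 1)) \<le> (A - B) * (p * A powr (p - 1))"
    using assms by (intro mult_left_mono) auto
  then show ?thesis using z by (simp add: mult_ac)
next
  case False
  then consider "A = B" | "B = 0" using assms by linarith
  then show ?thesis
  proof cases
    case 2
    have "A powr p = A powr (p - 1) * A" using assms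
      by (cases "A = 0") (auto simp: powr_diff)
    then show ?thesis using 2 assms mult_right_mono[of 1 p "A powr p"] by (simp add: mult_ac)
  qed simp
qed

lemma powr_le_add_power:
  fixes A q :: real
  assumes "0 \<le> A" "0 \<le> q" "q \<le> real m"
  shows "A powr q \<le> 1 + A ^ m"
proof (cases "A \<le> 1")
  case True
  then have "A powr q \<le> 1" using assms powr_mono2[of q A 1] by simp
  then show ?thesis using zero_le_power[OF assms(1), of m] by linarith
next
  case False
  then have "A powr q \<le> A powr real m" using assms by (intro powr_mono) auto
  then show ?thesis using False by (simp add: powr_realpow)
qed

text \<open>Polynomial growth of the local Lipschitz constant is what membership in \<open>H\<close>
  asks for; the real exponent is rounded up to the natural number \<open>m\<close>.\<close>

lemma tail_powr_diff:
  fixes c p x y :: real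
  assumes "0 \<le> c" "1 \<le> p" "p \<le> real m"
  shows "\<bar>max (\<bar>x\<bar> - c) 0 powr p - max (\<bar>y\<bar> - c) 0 powr p\<bar> \<le> p * (1 + \<bar>x\<bar> ^ m + \<bar>y\<bar> ^ m) * \<bar>x - y\<bar>"
proof -
  have main: "max (\<bar>y\<bar> - c) 0 powr p - max (\<bar>x\<bar> - c) 0 powr p \<le> p * (1 + \<bar>x\<bar> ^ m + \<bar>y\<bar> ^ m) * \<bar>x - y\<bar>"
    for x y :: real
  proof (cases "\<bar>x\<bar> \<le> \<bar>y\<bar>")
    case True
    let ?A = "max (\<bar>y\<bar> - c) 0" and ?B = "max (\<bar>x\<bar> - c) 0"
    have "?A powr p - ?B powr p \<le> p * ?A powr (p - 1) * (?A - ?B)"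
      using True assms by (intro powr_diff_le) auto
    also have "\<dots> \<le> p * (1 + \<bar>x\<bar> ^ m + \<bar>y\<bar> ^ m) * (?A - ?B)"
    proof -
      have "?A powr (p - 1) \<le> 1 + ?A ^ m" using assms by (intro powr_le_add_power) auto
      also have "\<dots> \<le> 1 + \<bar>y\<bar> ^ m" using assms by (intro add_left_mono power_mono) auto
      finally have "?A powr (p - 1) \<le> 1 + \<bar>x\<bar> ^ m + \<bar>y\<bar> ^ m" using zero_le_power_abs[of x m] by linarith
      then show ?thesis using True assms by (intro mult_right_mono mult_left_mono) auto
    qed
    also have "\<dots> \<le> p * (1 + \<bar>x\<bar> ^ m + \<bar>y\<bar> ^ m) * \<bar>x - y\<bar>"
      using assms by (intro mult_left_mono mult_nonneg_nonneg add_nonneg_nonneg) auto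
    finally show ?thesis .
  next
    case False
    then have "max (\<bar>y\<bar> - c) 0 powr p \<le> max (\<bar>x\<bar> - c) 0 powr p" using assms by (intro powr_mono2) auto
    moreover have "0 \<le> p * (1 + \<bar>x\<bar> ^ m + \<bar>y\<bar> ^ m) * \<bar>x - y\<bar>"
      using assms by (intro mult_nonneg_nonneg add_nonneg_nonneg) auto
    ultimately show ?thesis by linarith
  qed
  have "max (\<bar>x\<bar> - c) 0 powr p - max (\<bar>y\<bar> - c) 0 powr p \<le> p * (1 + \<bar>x\<bar> ^ m + \<bar>y\<bar> ^ m) * \<bar>x - y\<bar>"
    using main[of x y] abs_minus_commute[of x y] by (simp add: add_ac)
  moreover have "- (max (\<bar>x\<bar> - c) 0 powr p - max (\<bar>y\<bar> - c) 0 powr p) \<le> p * (1 + \<bar>x\<bar> ^ m + \<bar>y\<bar> ^ m) * \<bar>x - y\<bar>"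
    using main[of y x] by linarith
  ultimately show ?thesis by (rule abs_leI)
qed

section \<open>Tail and clipping functions\<close>

definition tail :: "real \<Rightarrow> real \<Rightarrow> real \<Rightarrow> real" where
  "tail c p x = (max (\<bar>x\<bar> - c) 0 / c) powr p"

definition clip :: "real \<Rightarrow> real \<Rightarrow> real" where
  "clip c x = max (min x c) (- c)"

lemma tail_nonneg: "0 \<le> tail c p x"
  by (simp add: tail_def)

text \<open>This is why truncations are made at \<open>2 * c\<close> while moments are taken beyond
  \<open>c\<close>.\<close>

lemma tail_ge_1: "0 < c \<Longrightarrow> 0 \<le> p \<Longrightarrow> 2 * c \<le> \<bar>x\<bar> \<Longrightarrow> 1 \<le> tail c p x"
  unfolding tail_def by (intro ge_one_powr_ge_zero) (auto simp: field_simps)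

lemma exp_min_le_tail:
  assumes "0 < c" "0 \<le> p" "0 < l" "0 \<le> y"
  shows "exp (l * min x y) \<le> 1 + l * x + (l * x)\<^sup>2 / 2 * exp (2 * l * c) + exp (l * y) * tail c p x"
proof (cases "x \<le> 2 * c")
  case True
  have "exp (l * min x y) \<le> exp (l * x)" using assms by simp
  also have "\<dots> \<le> 1 + l * x + (l * x)\<^sup>2 / 2 * exp (2 * l * c)"
    using assms True mult_left_mono[of x "2 * c" l]
    by (intro exp_upper_quadratic) (auto simp: mult_ac)
  finally show ?thesis using tail_nonneg[of c p x] by (simp add: add_increasing2)
next
  case False
  have "exp (l * min x y) \<le> exp (l * y) * 1" using assms by simp
  also have "\<dots> \<le> exp (l * y) * tail c p x"
    using tail_ge_1[of c p x] False assms by (intro mult_left_mono) auto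
  finally have "exp (l * min x y) \<le> exp (l * y) * tail c p x" .
  moreover have "0 \<le> 1 + l * x + (l * x)\<^sup>2 / 2 * exp (2 * l * c)" using False assms by simp
  ultimately show ?thesis by linarith
qed

text \<open>Refinement of Fuk-Nagaev type gaining the factor \<open>(2 * c / y) powr p\<close>. The
  cut is made where \<open>l * min x y\<close> equals \<open>p\<close>, because beyond that point
  \<open>exp (l * v) / v powr p\<close> increases with \<open>v\<close>; the price is the constant
  \<open>exp p\<close> in the quadratic term.\<close>

lemma exp_min_le_tail':
  assumes "0 < c" "0 < p" "0 < l" "0 < y" "2 * l * c \<le> p"
  shows "exp (l * min x y) \<le>
    1 + l * x + (l * x)\<^sup>2 / 2 * exp p + exp (l * y) * (2 * c / y) powr p * tail c p x"
proof (cases "l * min x y \<le> p")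
  case True
  define v where "v = min x y"
  have "exp (l * v) \<le> 1 + l * v + (l * v)\<^sup>2 / 2 * exp p"
    using True assms by (intro exp_upper_quadratic) (auto simp: v_def)
  also have "\<dots> \<le> 1 + l * x + (l * x)\<^sup>2 / 2 * exp p"
  proof (cases "x \<le> y")
    case True
    then show ?thesis by (simp add: v_def)
  next
    case False
    then have "0 \<le> v" "v \<le> x" using assms by (auto simp: v_def)
    then show ?thesis using assms
      by (intro add_mono mult_right_mono divide_right_mono power_mono mult_left_mono) auto
  qed
  finally show ?thesis using tail_nonneg[of c p x] by (simp add: v_def add_increasing2)
next
  case False
  define v where "v = min x y"
  have lv: "p < l * v" using False by (simp add: v_def)
  then have "0 < l * v" using assms by linarith
  then have v: "0 < v" "v \<le> x" "v \<le> y" using assms by (simp_all add: v_def zero_less_mult_iff)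
  have "2 * l * c < l * v" using lv assms by linarith
  then have "l * (2 * c) < l * v" by (simp add: mult_ac)
  then have "2 * c < v" using assms by (simp add: mult_less_cancel_left_pos)
  then have x2: "2 * c < x" using v by linarith
  \<comment> \<open>Shows \<open>p * ln (y / v) \<le> l * (y - v)\<close>, the monotonicity just
    needed, from \<open>p < l * v\<close>.\<close>
  have "ln (y / v) \<le> y / v - 1" using v assms by (intro ln_le_minus_one) auto
  then have "p * ln (y / v) \<le> p * (y / v - 1)" using assms by (intro mult_left_mono) auto
  also have "\<dots> \<le> l * v * (y / v - 1)" using lv v by (intro mult_right_mono) (auto simp: field_simps)
  also have "\<dots> = l * y - l * v" using v by (simp add: field_simps)
  finally have "exp (l * v) \<le> exp (l * y - p * ln (y / v))" by simp
  also have "\<dots> = exp (l * y) * (v / y) powr p"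
    using v assms by (simp add: powr_def ln_div exp_diff exp_minus field_simps flip: exp_add)
  also have "\<dots> \<le> exp (l * y) * ((2 * c / y) * (max (\<bar>x\<bar> - c) 0 / c)) powr p"
  proof (intro mult_left_mono powr_mono2)
    have "v / y \<le> (2 * (x - c)) / y" using v x2 assms by (intro divide_right_mono) auto
    then show "v / y \<le> 2 * c / y * (max (\<bar>x\<bar> - c) 0 / c)" using x2 assms by (simp add: max_def)
  qed (use v assms in auto)
  also have "\<dots> = exp (l * y) * (2 * c / y) powr p * tail c p x"
    unfolding tail_def using assms by (subst powr_mult) (auto simp: max_def)
  finally have "exp (l * v) \<le> exp (l * y) * (2 * c / y) powr p * tail c p x" .
  moreover have "0 \<le> l * x" using x2 assms by auto
  ultimately show ?thesis by (simp add: v_def add_increasing)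
qed

lemma exp_excess_le_tail:
  assumes "0 < c" "0 \<le> p" "0 < l" "0 \<le> y"
  shows "exp (l * min (max (\<bar>x\<bar> - 2 * c) 0) y) \<le> 1 + exp (l * y) * tail c p x"
proof (cases "\<bar>x\<bar> \<le> 2 * c")
  case True
  then show ?thesis using assms tail_nonneg[of c p x] by (simp add: max_def)
next
  case False
  have "exp (l * min (max (\<bar>x\<bar> - 2 * c) 0) y) \<le> exp (l * y) * 1" using assms by simp
  also have "\<dots> \<le> exp (l * y) * tail c p x"
    using tail_ge_1[of c p x] False assms by (intro mult_left_mono) auto
  finally show ?thesis by linarith
qed

lemma clip_bound: "0 \<le> c \<Longrightarrow> \<bar>clip c x\<bar> \<le> c"
  by (auto simp: clip_def)

lemma clip_abs_le: "0 \<le> c \<Longrightarrow> \<bar>clip c x\<bar> \<le> \<bar>x\<bar>"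
  by (auto simp: clip_def)

lemma clip_diff: "0 \<le> c \<Longrightarrow> \<bar>x - clip c x\<bar> = max (\<bar>x\<bar> - c) 0"
  by (auto simp: clip_def)

lemma clip_lip1: "lip1 (clip c)"
  unfolding clip_def by (rule lip1_comp[OF lip1_max lip1_min])

lemma clip_diff_le_tail:
  assumes "0 < c" "1 \<le> p"
  shows "\<bar>x - clip (2 * c) x\<bar> \<le> c * tail c p x"
proof (cases "\<bar>x\<bar> \<le> 2 * c")
  case True
  then show ?thesis using assms tail_nonneg[of c p x] by (simp add: clip_diff)
next
  case False
  have "(\<bar>x\<bar> - c) / c \<le> ((\<bar>x\<bar> - c) / c) powr p"
    using False assms powr_mono[of 1 p "(\<bar>x\<bar> - c) / c"] by (simp add: field_simps)
  then have "\<bar>x\<bar> - c \<le> c * tail c p x" using False assms by (simp add: tail_def field_simps)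
  then show ?thesis using False assms by (simp add: clip_diff)
qed

text \<open>Beyond \<open>2 * c\<close> the ratio \<open>(\<bar>x\<bar> - c) / c\<close> is at least
  1, so its square is at most its p-th power; the factor 4 comes from
  \<open>\<bar>x\<bar> \<le> 2 * (\<bar>x\<bar> - c)\<close>.\<close>

lemma clip_square_diff_le_tail:
  assumes "0 < c" "2 \<le> p"
  shows "x\<^sup>2 - (clip (2 * c) x)\<^sup>2 \<le> 4 * c\<^sup>2 * tail c p x"
proof (cases "\<bar>x\<bar> \<le> 2 * c")
  case True
  then have "clip (2 * c) x = x" by (auto simp: clip_def)
  then show ?thesis using assms tail_nonneg[of c p x] by simp
next
  case False
  let ?r = "(\<bar>x\<bar> - c) / c"
  have r: "1 \<le> ?r" using False assms by (simp add: field_simps)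
  have "?r ^ 2 \<le> ?r powr p" using r assms powr_mono[of 2 p ?r] by simp
  then have "c\<^sup>2 * ?r ^ 2 \<le> c\<^sup>2 * tail c p x"
    using False assms by (intro mult_left_mono) (auto simp: tail_def max_def)
  then have "(\<bar>x\<bar> - c)\<^sup>2 \<le> c\<^sup>2 * tail c p x" using assms by (simp add: power_divide)
  moreover have "\<bar>x\<bar>\<^sup>2 \<le> (2 * (\<bar>x\<bar> - c))\<^sup>2" using False by (intro power_mono) auto
  moreover have "(2 * (\<bar>x\<bar> - c))\<^sup>2 = 4 * (\<bar>x\<bar> - c)\<^sup>2" by (simp only: power_mult_distrib) simp
  ultimately have "x\<^sup>2 \<le> 4 * c\<^sup>2 * tail c p x" by simp
  then show ?thesis using zero_le_power2[of "clip (2 * c) x"] by linarith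
qed

section \<open>The iterated logarithm\<close>

definition LL :: "real \<Rightarrow> real" where "LL x = Log (Log x)"

lemma max_exp_pos: "0 < max (exp 1) (x::real)"
  by (rule less_le_trans[OF exp_gt_zero max.cobounded1])

lemma Log_ge_1: "1 \<le> Log x"
  unfolding Log_def by (subst ln_ge_iff[OF max_exp_pos]) simp

lemma Log_pos: "0 < Log x"
  by (rule less_le_trans[OF zero_less_one Log_ge_1])

lemma Log_mono: "x \<le> y \<Longrightarrow> Log x \<le> Log y"
  unfolding Log_def by (intro ln_mono max_exp_pos max.mono) auto

text \<open>Crude but multiplicative, so it can be applied twice to control the iterated
  logarithm.\<close>

lemma Log_scale: "1 \<le> c \<Longrightarrow> 0 \<le> x \<Longrightarrow> Log (c * x) \<le> c * Log x"
proof -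
  assume c: "1 \<le> c" "0 \<le> x"
  have "max (exp 1) (c * x) \<le> c * max (exp 1) x"
  proof (rule max.boundedI)
    have "1 * exp 1 \<le> c * max (exp 1) x" using c by (intro mult_mono) auto
    then show "exp 1 \<le> c * max (exp 1) x" by simp
  qed (use c in \<open>simp add: mult_left_mono\<close>)
  then have "Log (c * x) \<le> ln (c * max (exp 1) x)"
    unfolding Log_def using c by (intro ln_mono max_exp_pos) auto
  also have "\<dots> = ln c + Log x" unfolding Log_def using c by (subst ln_mult_pos[OF _ max_exp_pos]) auto
  also have "\<dots> \<le> (c - 1) * 1 + Log x" using c ln_le_minus_one[of c] by simp
  also have "\<dots> \<le> (c - 1) * Log x + Log x" using c Log_ge_1 by (intro add_right_mono mult_left_mono) auto
  finally show ?thesis by (simp add: algebra_simps)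
qed

lemma LL_ge_1: "1 \<le> LL x" by (simp add: LL_def Log_ge_1)

lemma LL_mono: "x \<le> y \<Longrightarrow> LL x \<le> LL y" by (simp add: LL_def Log_mono)

text \<open>In other words \<open>LL x / x\<close> is nonincreasing. The monotonicity of the
  truncation level and the linear growth bound for the normaliser both rest on this.\<close>

lemma LL_ratio: "0 < x \<Longrightarrow> x \<le> y \<Longrightarrow> x * LL y \<le> y * LL x"
proof -
  assume xy: "0 < x" "x \<le> y"
  define c where "c = y / x"
  have c: "1 \<le> c" "y = c * x" using xy by (auto simp: c_def)
  have "LL y \<le> Log (c * Log x)"
    unfolding LL_def using Log_scale[of c x] c xy by (intro Log_mono) auto
  also have "\<dots> \<le> c * LL x"
    unfolding LL_def using c Log_ge_1[of x] by (intro Log_scale) auto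
  finally have "x * LL y \<le> x * (c * LL x)" using xy by (intro mult_left_mono) auto
  then show ?thesis using c by (simp add: mult_ac)
qed

lemma Log_le_exp_LL: "Log x \<le> exp (LL x)"
proof -
  have "ln (Log x) \<le> LL x"
    unfolding LL_def Log_def[of "Log x"] using Log_ge_1[of x] by (intro ln_mono) auto
  then have "exp (ln (Log x)) \<le> exp (LL x)" by simp
  then show ?thesis using Log_ge_1[of x] by simp
qed

text \<open>In fact \<open>exp (LL x)\<close> is the maximum of e and \<open>Log x\<close>. So
  \<open>exp (- q * LL x)\<close> is comparable with \<open>Log x powr (- q)\<close>, which links
  the exponential bounds to the logarithmic series.\<close>

lemma exp_LL_le: "exp (LL x) \<le> exp 1 * Log x"
proof -
  have "max (exp 1) (Log x) \<le> exp 1 * Log x"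
    using Log_ge_1[of x] by (auto simp: max_def mult_le_cancel_right1 intro: order_trans[of _ "exp 1 * 1"] mult_left_mono)
  moreover have "exp (LL x) = max (exp 1) (Log x)"
    unfolding LL_def Log_def[of "Log x"] by (simp add: max_def Log_pos)
  ultimately show ?thesis by simp
qed

lemma Log_power_ge: "1 \<le> b \<Longrightarrow> k * ln b \<le> Log (b ^ k)"
proof -
  assume b: "1 \<le> b"
  have "ln (b ^ k) \<le> Log (b ^ k)" unfolding Log_def using b by (intro ln_mono) auto
  then show ?thesis using b by (simp add: ln_realpow)
qed

lemma filterlim_Log: "filterlim Log at_top at_top"
proof (rule filterlim_at_top_mono[OF ln_at_top])
  show "\<forall>\<^sub>F x in at_top. ln x \<le> Log x"
    using eventually_gt_at_top[of 0]
    by eventually_elim (auto simp: Log_def intro!: ln_mono)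
qed

lemma filterlim_LL: "filterlim LL at_top at_top"
  unfolding LL_def by (rule filterlim_compose[OF filterlim_Log filterlim_Log])

text \<open>Kolmogorov's exponential argument for a sublinear functional: the moment generating function
  at \<open>\<kappa> - \<delta>\<close> and \<open>\<kappa> + \<delta>\<close> shows that the bulk of \<open>exp (2 * \<tau> * \<kappa> * z)\<close> comes from \<open>z \<approx> \<kappa>\<close>.\<close>

lemma exp_tilt_split:
  fixes \<tau> \<kappa> \<delta> z f :: real
  assumes "0 \<le> \<tau>" "0 \<le> \<delta>" "0 \<le> \<kappa>" "0 \<le> f" "\<kappa> - \<delta> \<le> z \<Longrightarrow> f = 1"
  shows "exp (2 * \<tau> * \<kappa> * z) \<le> exp (2 * \<tau> * \<delta> * (\<kappa> - \<delta>)) * exp (2 * \<tau> * (\<kappa> - \<delta>) * z)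
     + exp (- 2 * \<tau> * \<delta> * (\<kappa> + \<delta>)) * exp (2 * \<tau> * (\<kappa> + \<delta>) * z)
     + exp (2 * \<tau> * \<kappa> * (\<kappa> + \<delta>)) * f"
proof -
  have td: "0 \<le> 2 * \<tau> * \<delta>" using assms by simp
  \<comment> \<open>Below the window the lower tilt dominates, above it the upper tilt; inside it
    \<open>f\<close> is 1.\<close>
  consider "z \<le> \<kappa> - \<delta>" | "\<kappa> + \<delta> \<le> z" | "\<kappa> - \<delta> \<le> z" "z \<le> \<kappa> + \<delta>" by linarith
  then show ?thesis
  proof cases
    case 1
    have "2 * \<tau> * \<delta> * z \<le> 2 * \<tau> * \<delta> * (\<kappa> - \<delta>)" using 1 td by (intro mult_left_mono) auto
    then have "exp (2 * \<tau> * \<kappa> * z) \<le> exp (2 * \<tau> * \<delta> * (\<kappa> - \<delta>) + 2 * \<tau> * (\<kappa> - \<delta>) * z)"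
      by (simp add: algebra_simps)
    then show ?thesis using assms by (simp add: exp_add add_increasing2)
  next
    case 2
    have "2 * \<tau> * \<delta> * (\<kappa> + \<delta>) \<le> 2 * \<tau> * \<delta> * z" using 2 td by (intro mult_left_mono) auto
    then have "exp (2 * \<tau> * \<kappa> * z) \<le> exp (- 2 * \<tau> * \<delta> * (\<kappa> + \<delta>) + 2 * \<tau> * (\<kappa> + \<delta>) * z)"
      by (simp add: algebra_simps)
    then have "exp (2 * \<tau> * \<kappa> * z) \<le> exp (- 2 * \<tau> * \<delta> * (\<kappa> + \<delta>)) * exp (2 * \<tau> * (\<kappa> + \<delta>) * z)"
      by (simp only: exp_add)
    moreover have "0 \<le> exp (2 * \<tau> * \<delta> * (\<kappa> - \<delta>)) * exp (2 * \<tau> * (\<kappa> - \<delta>) * z)"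
      "0 \<le> exp (2 * \<tau> * \<kappa> * (\<kappa> + \<delta>)) * f" using assms by auto
    ultimately show ?thesis by linarith
  next
    case 3
    have "exp (2 * \<tau> * \<kappa> * z) \<le> exp (2 * \<tau> * \<kappa> * (\<kappa> + \<delta>)) * f"
      using 3 assms by (simp add: mult_left_mono)
    moreover have "0 \<le> exp (2 * \<tau> * \<delta> * (\<kappa> - \<delta>)) * exp (2 * \<tau> * (\<kappa> - \<delta>) * z)"
      "0 \<le> exp (- 2 * \<tau> * \<delta> * (\<kappa> + \<delta>)) * exp (2 * \<tau> * (\<kappa> + \<delta>) * z)" by auto
    ultimately show ?thesis by linarith
  qed
qed

section \<open>Exponential bounds for one index\<close>

lemma lip1_exp_mult:
  assumes "lip1 g" "\<And>z. g z \<le> B" "0 \<le> l"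
  shows "lip1 (\<lambda>z. exp (l * g z))"
proof -
  have "lip1 (\<lambda>z. exp (min (l * g z + 0) (l * B)))"
    by (rule lip1_comp[OF lip1_exp_min lip1_comp[OF lip1_affine assms(1)]])
  moreover have "min (l * g z + 0) (l * B) = l * g z" for z
    using assms by (simp add: min_def mult_left_mono)
  ultimately show ?thesis by (simp only:)
qed

context independent_square_integrable
begin

text \<open>The index \<open>j\<close> refers to \<open>X (Suc j)\<close>, as for coordinates; sums over \<open>{..<n}\<close> thus run over \<open>X 1, \<dots>, X n\<close>.\<close>

definition v :: "nat \<Rightarrow> real" where "v j = e (\<lambda>\<omega>. (X (Suc j) \<omega>)\<^sup>2)"
text \<open>Under a sub-linear expectation the mean is an interval with endpoints
  \<open>- e (- X)\<close> and \<open>e X\<close>; \<mu> bounds both.\<close>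

definition \<mu> :: "nat \<Rightarrow> real" where "\<mu> j = \<bar>e (X (Suc j))\<bar> + \<bar>e (\<lambda>\<omega>. - X (Suc j) \<omega>)\<bar>"
definition u :: "nat \<Rightarrow> real" where "u n = (\<Sum>j<n. v j)"
definition mu_sum :: "nat \<Rightarrow> real" where "mu_sum n = (\<Sum>j<n. \<mu> j)"
definition tail_e :: "real \<Rightarrow> real \<Rightarrow> nat \<Rightarrow> real" where
  "tail_e c p j = e (\<lambda>\<omega>. tail c p (X (Suc j) \<omega>))"
text \<open>Stated beside \<open>tail_e\<close>, which would read an infinite moment as 0.\<close>

definition tail_fin :: "real \<Rightarrow> real \<Rightarrow> nat \<Rightarrow> bool" where
  "tail_fin c p n \<longleftrightarrow> (\<forall>j<n. (\<lambda>\<omega>. tail c p (X (Suc j) \<omega>)) \<in> fin)"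
definition tail_sum :: "real \<Rightarrow> real \<Rightarrow> nat \<Rightarrow> real" where
  "tail_sum c p n = (\<Sum>j<n. tail_e c p j)"

lemma X_square_fin: "(\<lambda>\<omega>. (X (Suc j) \<omega>)\<^sup>2) \<in> fin"
  using square_H[OF X_Suc_H] square_fin[of "Suc j"] by (simp add: fin_def)

lemma X_fin: "X (Suc j) \<in> fin"
proof (rule fin_dom[OF X_Suc_H fin_add[OF fin_const[of 1] X_square_fin]])
  fix \<omega>
  have "\<bar>x\<bar> \<le> 1 + x\<^sup>2" for x :: real
  proof (cases "\<bar>x\<bar> \<le> 1")
    case False
    then have "\<bar>x\<bar> * 1 \<le> \<bar>x\<bar> * \<bar>x\<bar>" by (intro mult_left_mono) auto
    then show ?thesis by (simp add: power2_eq_square)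
  qed (simp add: add_increasing2)
  then show "\<bar>X (Suc j) \<omega>\<bar> \<le> 1 + (X (Suc j) \<omega>)\<^sup>2" .
qed

lemma v_nonneg: "0 \<le> v j"
  unfolding v_def by (intro e_nonneg X_square_fin) simp

lemma \<mu>_nonneg: "0 \<le> \<mu> j" by (simp add: \<mu>_def)

lemma tail_e_nonneg: "tail_fin c p n \<Longrightarrow> j < n \<Longrightarrow> 0 \<le> tail_e c p j"
  unfolding tail_e_def tail_fin_def by (intro e_nonneg) (auto simp: tail_nonneg)

lemma u_mono: "m \<le> n \<Longrightarrow> u m \<le> u n"
  unfolding u_def by (intro sum_mono2) (auto simp: v_nonneg)

lemma u_nonneg: "0 \<le> u n"
  unfolding u_def by (intro sum_nonneg v_nonneg)

lemma quadratic_tail_fin: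
  assumes "tail_fin c p n" "j < n"
  shows "(\<lambda>\<omega>. b1 * X (Suc j) \<omega> + b2 * (X (Suc j) \<omega>)\<^sup>2 + b3 * tail c p (X (Suc j) \<omega>)) \<in> fin"
  using assms unfolding tail_fin_def by (intro fin_add fin_scale X_fin X_square_fin) auto

lemma e_quadratic_le:
  assumes "tail_fin c p n" "j < n" "0 \<le> b1" "0 \<le> b2" "0 \<le> b3"
  shows "e (\<lambda>\<omega>. b1 * X (Suc j) \<omega> + b2 * (X (Suc j) \<omega>)\<^sup>2 + b3 * tail c p (X (Suc j) \<omega>)) \<le>
    b1 * \<mu> j + b2 * v j + b3 * tail_e c p j"
proof -
  have t: "(\<lambda>\<omega>. tail c p (X (Suc j) \<omega>)) \<in> fin" using assms by (simp add: tail_fin_def)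
  have "e (\<lambda>\<omega>. b1 * X (Suc j) \<omega> + b2 * (X (Suc j) \<omega>)\<^sup>2 + b3 * tail c p (X (Suc j) \<omega>)) \<le>
      e (\<lambda>\<omega>. b1 * X (Suc j) \<omega> + b2 * (X (Suc j) \<omega>)\<^sup>2) + e (\<lambda>\<omega>. b3 * tail c p (X (Suc j) \<omega>))"
    by (intro e_add fin_add fin_scale X_fin X_square_fin t)
  also have "\<dots> \<le> e (\<lambda>\<omega>. b1 * X (Suc j) \<omega>) + e (\<lambda>\<omega>. b2 * (X (Suc j) \<omega>)\<^sup>2) +
      e (\<lambda>\<omega>. b3 * tail c p (X (Suc j) \<omega>))"
    by (intro add_right_mono e_add fin_scale X_fin X_square_fin)
  also have "\<dots> = b1 * e (X (Suc j)) + b2 * v j + b3 * tail_e c p j"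
    using assms e_scale[OF X_fin] e_scale[OF X_square_fin] e_scale[OF t] by (simp add: v_def tail_e_def)
  also have "\<dots> \<le> b1 * \<mu> j + b2 * v j + b3 * tail_e c p j"
    using assms by (intro add_right_mono mult_left_mono) (auto simp: \<mu>_def)
  finally show ?thesis .
qed

text \<open>Common core of the next three maximal inequalities: a pointwise bound for one variable
  becomes, by \<open>1 + z \<le> exp z\<close>, a cost per step, and the costs add up to total mean,
  variance and tail.\<close>

lemma maximal_quadratic:
  assumes "tail_fin c p n" "lip1 g" "\<And>z. g z \<le> B" "0 < l" "0 \<le> b1" "0 \<le> b2" "0 \<le> b3"
    and le: "\<And>z. exp (l * g z) \<le> 1 + b1 * z + b2 * z\<^sup>2 + b3 * tail c p z"
  shows "hat_le {\<omega> \<in> space M. \<exists>m\<in>{1..n}. x \<le> (\<Sum>j<m. g (X (Suc j) \<omega>))}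
           (exp (1 - l * x + (b1 * mu_sum n + b2 * u n + b3 * tail_sum c p n)))"
proof -
  let ?c = "\<lambda>j. b1 * \<mu> j + b2 * v j + b3 * tail_e c p j"
  have eq: "(\<Sum>j<n. ?c j) = b1 * mu_sum n + b2 * u n + b3 * tail_sum c p n"
    by (simp add: mu_sum_def u_def tail_sum_def sum.distrib sum_distrib_left)
  have "e (\<lambda>\<omega>. exp (l * g (X (Suc j) \<omega>))) \<le> exp (?c j)" if "j < n" for j
  proof -
    let ?Q = "\<lambda>\<omega>. b1 * X (Suc j) \<omega> + b2 * (X (Suc j) \<omega>)\<^sup>2 + b3 * tail c p (X (Suc j) \<omega>)"
    have Q: "?Q \<in> fin" by (rule quadratic_tail_fin[OF assms(1) that])
    have f: "(\<lambda>\<omega>. exp (l * g (X (Suc j) \<omega>))) \<in> fin"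
      using assms(3,4)
      by (intro fin_dom[OF H_lip1[OF X_Suc_H lip1_exp_mult[OF assms(2,3)]] fin_const[of "exp (l * B)"]]) auto
    have "e (\<lambda>\<omega>. exp (l * g (X (Suc j) \<omega>))) \<le> e (\<lambda>\<omega>. 1 + 1 * ?Q \<omega>)"
    proof (rule e_mono[OF f fin_add[OF fin_const fin_scale[OF Q]]])
      fix \<omega> show "exp (l * g (X (Suc j) \<omega>)) \<le> 1 + 1 * ?Q \<omega>" using le[of "X (Suc j) \<omega>"] by simp
    qed
    also have "\<dots> = 1 + 1 * e ?Q" by (rule e_affine[OF Q]) simp
    also have "\<dots> \<le> 1 + ?c j" using e_quadratic_le[OF assms(1) that assms(5,6,7)] by simp
    also have "\<dots> \<le> exp (?c j)" by (rule exp_ge_add_one_self)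
    finally show ?thesis .
  qed
  moreover have "0 \<le> ?c j" if "j < n" for j
    using assms(5,6,7) v_nonneg \<mu>_nonneg tail_e_nonneg[OF assms(1) that] by simp
  ultimately have "hat_le {\<omega> \<in> space M. \<exists>m\<in>{1..n}. x \<le> (\<Sum>j<m. g (X (Suc j) \<omega>))}
      (exp (1 - l * x + (\<Sum>j<n. ?c j)))"
    by (intro exponential_maximal[where g = "\<lambda>_. g" and B = "\<lambda>_. B" and c = ?c and \<theta> = l, OF assms(2,3,4)])
  then show ?thesis unfolding eq .
qed

lemma maximal_min:
  assumes "tail_fin c p n" "0 < c" "0 \<le> p" "0 < l" "0 \<le> y"
  shows "hat_le {\<omega> \<in> space M. \<exists>m\<in>{1..n}. x \<le> (\<Sum>j<m. min (X (Suc j) \<omega>) y)}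
     (exp (1 - l * x + (l * mu_sum n + l\<^sup>2 / 2 * exp (2 * l * c) * u n + exp (l * y) * tail_sum c p n)))"
proof (rule maximal_quadratic[where B = y and g = "\<lambda>x. min x y", OF assms(1) lip1_min])
  fix z
  show "exp (l * min z y) \<le> 1 + l * z + l\<^sup>2 / 2 * exp (2 * l * c) * z\<^sup>2 + exp (l * y) * tail c p z"
    using exp_min_le_tail[OF assms(2-5), of z] by (simp add: power_mult_distrib mult_ac)
qed (use assms in auto)

lemma maximal_min':
  assumes "tail_fin c p n" "0 < c" "0 < p" "0 < l" "0 < y" "2 * l * c \<le> p"
  shows "hat_le {\<omega> \<in> space M. \<exists>m\<in>{1..n}. x \<le> (\<Sum>j<m. min (X (Suc j) \<omega>) y)}
     (exp (1 - l * x + (l * mu_sum n + l\<^sup>2 / 2 * exp p * u n + exp (l * y) * (2 * c / y) powr p * tail_sum c p n)))"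
proof (rule maximal_quadratic[where B = y and g = "\<lambda>x. min x y", OF assms(1) lip1_min])
  fix z
  show "exp (l * min z y) \<le> 1 + l * z + l\<^sup>2 / 2 * exp p * z\<^sup>2 + exp (l * y) * (2 * c / y) powr p * tail c p z"
    using exp_min_le_tail'[OF assms(2-6), of z] by (simp add: power_mult_distrib mult_ac)
qed (use assms in auto)

text \<open>The exponent vanishes for variables below \<open>2 * c\<close>, so neither mean nor
  variance enters; the zero coefficients keep the shape of the general bound.\<close>

lemma maximal_excess:
  assumes "tail_fin c p n" "0 < c" "0 \<le> p" "0 < l" "0 \<le> y"
  shows "hat_le {\<omega> \<in> space M. \<exists>m\<in>{1..n}. x \<le> (\<Sum>j<m. min (max (\<bar>X (Suc j) \<omega>\<bar> - 2 * c) 0) y)}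
     (exp (1 - l * x + (0 * mu_sum n + 0 * u n + exp (l * y) * tail_sum c p n)))"
proof (rule maximal_quadratic[where B = y and g = "\<lambda>x. min (max (\<bar>x\<bar> - 2 * c) 0) y", OF assms(1)])
  have "lip1 (\<lambda>x. min (max (1 * \<bar>x\<bar> + (- 2 * c)) 0) y)"
    by (rule lip1_comp[OF lip1_min lip1_comp[OF lip1_max lip1_comp[OF lip1_affine lip1_abs]]])
  then show "lip1 (\<lambda>x. min (max (\<bar>x\<bar> - 2 * c) 0) y)" by simp
  fix z
  show "exp (l * min (max (\<bar>z\<bar> - 2 * c) 0) y) \<le> 1 + 0 * z + 0 * z\<^sup>2 + exp (l * y) * tail c p z"
    using exp_excess_le_tail[OF assms(2-5), of z] by simp
qed (use assms in auto)

section \<open>Exponential moments of clipped block sums\<close>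

definition clip_sum :: "real \<Rightarrow> nat \<Rightarrow> nat \<Rightarrow> (nat \<Rightarrow> real) \<Rightarrow> real" where
  "clip_sum c m n x = (\<Sum>j\<in>{m..<n}. clip c (x j))"

lemma clip_BL: "0 \<le> c \<Longrightarrow> j < n \<Longrightarrow> (\<lambda>x. clip c (x j)) \<in> BL n"
  by (rule BL_coord[OF _ clip_lip1 clip_bound])

lemma clip_sum_BL: "0 \<le> c \<Longrightarrow> clip_sum c m n \<in> BL n"
  unfolding clip_sum_def by (rule BL_sum) (auto intro!: clip_BL)

lemma clip_fin: "0 \<le> c \<Longrightarrow> (\<lambda>\<omega>. clip c (X (Suc j) \<omega>)) \<in> fin"
  using joint_fin[OF clip_BL[of c j "Suc j"]] by simp

lemma exp_clip_fin: "0 \<le> c \<Longrightarrow> (\<lambda>\<omega>. exp (l * clip c (X (Suc j) \<omega>))) \<in> fin"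
  using joint_fin[OF BL_exp[OF BL_scale[OF clip_BL[of c j "Suc j"]]]] by simp

lemma clip_square_fin: "0 \<le> c \<Longrightarrow> (\<lambda>\<omega>. (clip c (X (Suc j) \<omega>))\<^sup>2) \<in> fin"
  using joint_fin[OF BL_square[OF clip_BL[of c j "Suc j"]]] by simp

lemma EE_exp_clip_sum:
  assumes "0 \<le> c" "0 \<le> l" "m \<le> n"
  shows "EE (\<lambda>x. exp (l * clip_sum c m n x)) = (\<Prod>j\<in>{m..<n}. e (\<lambda>\<omega>. exp (l * clip c (X (Suc j) \<omega>))))"
proof -
  \<comment> \<open>Factors below \<open>m\<close> are set to 1, so that the product formula over
    all coordinates covers a block.\<close>
  define G where "G j z = (if j < m then 1 else exp (l * clip c z))" for j z
  have lip: "lip1 (\<lambda>z. exp (l * clip c z))"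
    by (rule lip1_exp_mult[OF clip_lip1 _ assms(2), of c c]) (use clip_bound[OF assms(1)] in \<open>auto simp: abs_le_iff\<close>)
  have bd: "exp (l * clip c z) \<le> exp (l * c)" for z
    using clip_bound[OF assms(1), of z] assms by (simp add: abs_le_iff mult_left_mono)
  have split: "{..<n} = {..<m} \<union> {m..<n}" using assms(3) by auto
  have eq: "(\<lambda>x. exp (l * clip_sum c m n x)) = (\<lambda>x. \<Prod>j<n. G j (x j))"
  proof
    fix x
    have "(\<Prod>j<n. G j (x j)) = (\<Prod>j\<in>{m..<n}. G j (x j))"
      unfolding split by (subst prod.union_disjoint) (auto simp: G_def)
    also have "\<dots> = exp (l * clip_sum c m n x)"
      by (simp add: G_def clip_sum_def sum_distrib_left exp_sum)
    finally show "exp (l * clip_sum c m n x) = (\<Prod>j<n. G j (x j))" by simp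
  qed
  have "EE (\<lambda>x. exp (l * clip_sum c m n x)) = (\<Prod>j<n. e (\<lambda>\<omega>. G j (X (Suc j) \<omega>)))"
    unfolding eq
  proof (rule EE_prod[where B = "\<lambda>j. if j < m then 1 else exp (l * c)"])
    fix j show "lip1 (G j)" using lip lip1_const unfolding G_def by (cases "j < m") simp_all
  qed (use bd in \<open>auto simp: G_def\<close>)
  also have "\<dots> = (\<Prod>j\<in>{m..<n}. e (\<lambda>\<omega>. exp (l * clip c (X (Suc j) \<omega>))))"
    unfolding split by (subst prod.union_disjoint) (auto simp: G_def e_const)
  finally show ?thesis .
qed

text \<open>The clipping errors are dominated pointwise by multiples of \<open>tail\<close>, and
  expectations of variables differ by at most the expectation of a dominating error.\<close>

lemma e_clip_diff:
  assumes "tail_fin c p n" "j < n" "0 < c" "2 \<le> p"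
  shows "e (\<lambda>\<omega>. clip (2 * c) (X (Suc j) \<omega>)) \<le> \<mu> j + c * tail_e c p j"
    and "\<bar>e (\<lambda>\<omega>. - clip (2 * c) (X (Suc j) \<omega>))\<bar> \<le> \<mu> j + c * tail_e c p j"
    and "v j - 4 * c\<^sup>2 * tail_e c p j \<le> e (\<lambda>\<omega>. (clip (2 * c) (X (Suc j) \<omega>))\<^sup>2)"
    and "e (\<lambda>\<omega>. (clip (2 * c) (X (Suc j) \<omega>))\<^sup>2) \<le> v j"
proof -
  have t: "(\<lambda>\<omega>. tail c p (X (Suc j) \<omega>)) \<in> fin" using assms by (simp add: tail_fin_def)
  have cl: "(\<lambda>\<omega>. clip (2 * c) (X (Suc j) \<omega>)) \<in> fin" "(\<lambda>\<omega>. (clip (2 * c) (X (Suc j) \<omega>))\<^sup>2) \<in> fin"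
    using assms by (auto intro!: clip_fin clip_square_fin)
  have d: "\<bar>X (Suc j) \<omega> - clip (2 * c) (X (Suc j) \<omega>)\<bar> \<le> c * tail c p (X (Suc j) \<omega>)" for \<omega>
    by (rule clip_diff_le_tail) (use assms in auto)
  have et: "e (\<lambda>\<omega>. c * tail c p (X (Suc j) \<omega>)) = c * tail_e c p j"
    using e_scale[OF t] assms by (simp add: tail_e_def)
  have "\<bar>e (\<lambda>\<omega>. clip (2 * c) (X (Suc j) \<omega>)) - e (X (Suc j))\<bar> \<le> c * tail_e c p j"
    unfolding et[symmetric] by (rule e_abs_diff_le[OF cl(1) X_fin _ fin_scale[OF t]]) (metis abs_minus_commute d)
  then show "e (\<lambda>\<omega>. clip (2 * c) (X (Suc j) \<omega>)) \<le> \<mu> j + c * tail_e c p j"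
    unfolding \<mu>_def by linarith
  have "\<bar>e (\<lambda>\<omega>. - clip (2 * c) (X (Suc j) \<omega>)) - e (\<lambda>\<omega>. - X (Suc j) \<omega>)\<bar> \<le> c * tail_e c p j"
    unfolding et[symmetric]
    by (rule e_abs_diff_le[OF fin_uminus[OF cl(1)] fin_uminus[OF X_fin] _ fin_scale[OF t]]) (simp add: d)
  then show "\<bar>e (\<lambda>\<omega>. - clip (2 * c) (X (Suc j) \<omega>))\<bar> \<le> \<mu> j + c * tail_e c p j"
    unfolding \<mu>_def by linarith
  have "v j \<le> e (\<lambda>\<omega>. (clip (2 * c) (X (Suc j) \<omega>))\<^sup>2 + 4 * c\<^sup>2 * tail c p (X (Suc j) \<omega>))"
    unfolding v_def
  proof (rule e_mono[OF X_square_fin fin_add[OF cl(2) fin_scale[OF t]]])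
    fix \<omega> show "(X (Suc j) \<omega>)\<^sup>2 \<le> (clip (2 * c) (X (Suc j) \<omega>))\<^sup>2 + 4 * c\<^sup>2 * tail c p (X (Suc j) \<omega>)"
      using clip_square_diff_le_tail[OF assms(3,4), of "X (Suc j) \<omega>"] by linarith
  qed
  also have "\<dots> \<le> e (\<lambda>\<omega>. (clip (2 * c) (X (Suc j) \<omega>))\<^sup>2) + e (\<lambda>\<omega>. 4 * c\<^sup>2 * tail c p (X (Suc j) \<omega>))"
    by (rule e_add[OF cl(2) fin_scale[OF t]])
  also have "e (\<lambda>\<omega>. 4 * c\<^sup>2 * tail c p (X (Suc j) \<omega>)) = 4 * c\<^sup>2 * tail_e c p j"
    unfolding tail_e_def by (rule e_scale[OF t]) simp
  finally show "v j - 4 * c\<^sup>2 * tail_e c p j \<le> e (\<lambda>\<omega>. (clip (2 * c) (X (Suc j) \<omega>))\<^sup>2)" by simp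
  show "e (\<lambda>\<omega>. (clip (2 * c) (X (Suc j) \<omega>))\<^sup>2) \<le> v j"
    unfolding v_def
  proof (rule e_mono[OF cl(2) X_square_fin])
    fix \<omega> show "(clip (2 * c) (X (Suc j) \<omega>))\<^sup>2 \<le> (X (Suc j) \<omega>)\<^sup>2"
      using clip_abs_le[of "2 * c" "X (Suc j) \<omega>"] assms(3) by (simp add: abs_le_square_iff)
  qed
qed

lemma e_exp_clip_upper:
  assumes "tail_fin c p n" "j < n" "0 < c" "2 \<le> p" "0 < l" "2 * l * c \<le> B"
  shows "e (\<lambda>\<omega>. exp (l * clip (2 * c) (X (Suc j) \<omega>))) \<le>
     exp (l * (\<mu> j + c * tail_e c p j) + exp B * (l\<^sup>2 / 2) * v j)"
proof -
  have c0: "0 \<le> 2 * c" using assms by simp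
  have B: "0 \<le> B" using assms by (meson less_imp_le mult_nonneg_nonneg order_trans zero_le_numeral)
  let ?Y = "\<lambda>\<omega>. clip (2 * c) (X (Suc j) \<omega>)"
  have q: "(\<lambda>\<omega>. l * ?Y \<omega> + (l\<^sup>2 / 2 * exp B) * (?Y \<omega>)\<^sup>2) \<in> fin"
    by (intro fin_add fin_scale clip_fin clip_square_fin c0)
  have "e (\<lambda>\<omega>. exp (l * ?Y \<omega>)) \<le> e (\<lambda>\<omega>. 1 + 1 * (l * ?Y \<omega> + (l\<^sup>2 / 2 * exp B) * (?Y \<omega>)\<^sup>2))"
  proof (rule e_mono[OF exp_clip_fin[OF c0] fin_add[OF fin_const fin_scale[OF q]]])
    fix \<omega>
    have "l * ?Y \<omega> \<le> l * (2 * c)" using clip_bound[OF c0, of "X (Suc j) \<omega>"] assms by (intro mult_left_mono) auto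
    then have "l * ?Y \<omega> \<le> B" using assms(6) by (simp add: mult_ac)
    from exp_upper_quadratic[OF this B]
    show "exp (l * ?Y \<omega>) \<le> 1 + 1 * (l * ?Y \<omega> + (l\<^sup>2 / 2 * exp B) * (?Y \<omega>)\<^sup>2)"
      by (simp add: power_mult_distrib mult_ac)
  qed
  also have "\<dots> = 1 + 1 * e (\<lambda>\<omega>. l * ?Y \<omega> + (l\<^sup>2 / 2 * exp B) * (?Y \<omega>)\<^sup>2)"
    by (rule e_affine[OF q]) simp
  also have "e (\<lambda>\<omega>. l * ?Y \<omega> + (l\<^sup>2 / 2 * exp B) * (?Y \<omega>)\<^sup>2) \<le> l * e ?Y + (l\<^sup>2 / 2 * exp B) * e (\<lambda>\<omega>. (?Y \<omega>)\<^sup>2)"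
    using e_add[OF fin_scale[OF clip_fin[OF c0]] fin_scale[OF clip_square_fin[OF c0]], of l j "l\<^sup>2 / 2 * exp B" j]
      e_scale[OF clip_fin[OF c0], of l j] e_scale[OF clip_square_fin[OF c0], of "l\<^sup>2 / 2 * exp B" j] assms(5) by simp
  also have "\<dots> \<le> l * (\<mu> j + c * tail_e c p j) + (l\<^sup>2 / 2 * exp B) * v j"
    using e_clip_diff[OF assms(1-4)] assms(5) by (intro add_mono mult_left_mono) auto
  also have "1 + 1 * (l * (\<mu> j + c * tail_e c p j) + (l\<^sup>2 / 2 * exp B) * v j) \<le>
      exp (l * (\<mu> j + c * tail_e c p j) + exp B * (l\<^sup>2 / 2) * v j)"
    using exp_ge_add_one_self[of "l * (\<mu> j + c * tail_e c p j) + exp B * (l\<^sup>2 / 2) * v j"] by (simp add: mult_ac)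
  finally show ?thesis by simp
qed

text \<open>From below, the linear term is moved out by \<open>e (Y - Z) \<ge> e Y - e Z\<close>,
  which brings in the mean of \<open>- clip\<close>. Passing from \<open>1 + q\<close> to an
  exponential costs \<open>2 * q\<^sup>2\<close>; its part of order \<open>B\<close> times the
  variance is the correction \<open>4 * B\<close>.\<close>

lemma e_exp_clip_lower:
  assumes "tail_fin c p n" "j < n" "0 < c" "2 \<le> p" "0 < l" "2 * l * c \<le> B" "B \<le> 1 / 8"
  shows "exp ((exp (- B) - 4 * B) * (l\<^sup>2 / 2) * v j - 2 * l * \<mu> j - tail_e c p j) \<le>
     e (\<lambda>\<omega>. exp (l * clip (2 * c) (X (Suc j) \<omega>)))"
proof -
  have c0: "0 \<le> 2 * c" using assms by simp
  have B: "0 \<le> B" using assms by (meson less_imp_le mult_nonneg_nonneg order_trans zero_le_numeral)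
  let ?Y = "\<lambda>\<omega>. clip (2 * c) (X (Suc j) \<omega>)"
  have Yb: "\<bar>l * ?Y \<omega>\<bar> \<le> B" for \<omega>
  proof -
    have "l * \<bar>?Y \<omega>\<bar> \<le> l * (2 * c)" using clip_bound[OF c0, of "X (Suc j) \<omega>"] assms by (intro mult_left_mono) auto
    also have "\<dots> \<le> B" using assms(6) by (simp add: mult_ac)
    finally show ?thesis using assms(5) by (simp add: abs_mult)
  qed
  define A where "A = l\<^sup>2 * e (\<lambda>\<omega>. (?Y \<omega>)\<^sup>2)"
  define D where "D = l * e (\<lambda>\<omega>. - ?Y \<omega>)"
  define q where "q = exp (- B) / 2 * A - D"
  have A: "0 \<le> A" "A \<le> B\<^sup>2" "A \<le> l\<^sup>2 * v j" "l\<^sup>2 * v j - 4 * (l * c)\<^sup>2 * tail_e c p j \<le> A"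
  proof -
    show "0 \<le> A" unfolding A_def by (intro mult_nonneg_nonneg e_nonneg clip_square_fin c0) auto
    have "A = e (\<lambda>\<omega>. l\<^sup>2 * (?Y \<omega>)\<^sup>2)" unfolding A_def using e_scale[OF clip_square_fin[OF c0]] by simp
    also have "\<dots> \<le> e (\<lambda>_. B\<^sup>2)"
    proof (rule e_mono[OF fin_scale[OF clip_square_fin[OF c0]] fin_const])
      fix \<omega> show "l\<^sup>2 * (?Y \<omega>)\<^sup>2 \<le> B\<^sup>2"
        using Yb[of \<omega>] B abs_le_square_iff[of "l * ?Y \<omega>" B] by (simp add: power_mult_distrib)
    qed
    finally show "A \<le> B\<^sup>2" by (simp add: e_const)
    show "A \<le> l\<^sup>2 * v j" unfolding A_def using e_clip_diff(4)[OF assms(1-4)] by (intro mult_left_mono) auto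
    have "l\<^sup>2 * (v j - 4 * c\<^sup>2 * tail_e c p j) \<le> A"
      unfolding A_def using e_clip_diff(3)[OF assms(1-4)] by (intro mult_left_mono) auto
    then show "l\<^sup>2 * v j - 4 * (l * c)\<^sup>2 * tail_e c p j \<le> A" by (simp add: algebra_simps power_mult_distrib)
  qed
  have D: "\<bar>D\<bar> \<le> B" "\<bar>D\<bar> \<le> l * \<mu> j + l * c * tail_e c p j"
  proof -
    have "D = e (\<lambda>\<omega>. l * - ?Y \<omega>)" unfolding D_def using e_scale[OF fin_uminus[OF clip_fin[OF c0]], of l] assms by simp
    moreover have "\<bar>e (\<lambda>\<omega>. l * - ?Y \<omega>) - e (\<lambda>_. 0)\<bar> \<le> e (\<lambda>_. B)"
      by (rule e_abs_diff_le[OF fin_scale[OF fin_uminus[OF clip_fin[OF c0]]] fin_const _ fin_const]) (use Yb in simp)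
    ultimately show "\<bar>D\<bar> \<le> B" by (simp add: e_const)
    have "l * \<bar>e (\<lambda>\<omega>. - ?Y \<omega>)\<bar> \<le> l * (\<mu> j + c * tail_e c p j)"
      using e_clip_diff(2)[OF assms(1-4)] assms by (intro mult_left_mono) auto
    then show "\<bar>D\<bar> \<le> l * \<mu> j + l * c * tail_e c p j" using assms by (simp add: D_def abs_mult algebra_simps)
  qed
  have "1 + q \<le> e (\<lambda>\<omega>. exp (l * ?Y \<omega>))"
  proof -
    have f1: "(\<lambda>\<omega>. 1 + (exp (- B) / 2 * l\<^sup>2) * (?Y \<omega>)\<^sup>2) \<in> fin" and f2: "(\<lambda>\<omega>. l * - ?Y \<omega>) \<in> fin"
      by (intro fin_add fin_const fin_scale fin_uminus clip_fin clip_square_fin c0)+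
    have "1 + q = e (\<lambda>\<omega>. 1 + (exp (- B) / 2 * l\<^sup>2) * (?Y \<omega>)\<^sup>2) - e (\<lambda>\<omega>. l * - ?Y \<omega>)"
      unfolding q_def A_def D_def
      using e_affine[OF clip_square_fin[OF c0], of "exp (- B) / 2 * l\<^sup>2" 1 j]
        e_scale[OF fin_uminus[OF clip_fin[OF c0]], of l j] assms(5) by simp
    also have "\<dots> \<le> e (\<lambda>\<omega>. 1 + (exp (- B) / 2 * l\<^sup>2) * (?Y \<omega>)\<^sup>2 - l * - ?Y \<omega>)"
      by (rule e_diff_ge[OF f1 f2])
    also have "\<dots> \<le> e (\<lambda>\<omega>. exp (l * ?Y \<omega>))"
    proof (rule e_mono[OF fin_diff[OF f1 f2] exp_clip_fin[OF c0]])
      fix \<omega>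
      show "1 + (exp (- B) / 2 * l\<^sup>2) * (?Y \<omega>)\<^sup>2 - l * - ?Y \<omega> \<le> exp (l * ?Y \<omega>)"
        using exp_lower_quadratic[OF Yb[of \<omega>]] by (simp add: power_mult_distrib mult_ac)
    qed
    finally show ?thesis .
  qed
  have eB: "exp (- B) \<le> 1" "0 < exp (- B)" using B by auto
  have B2: "B\<^sup>2 \<le> B" using B assms(7) by (simp add: power2_eq_square mult_left_le)
  have eA: "exp (- B) * A \<le> A" using eB A(1) by (simp add: mult_left_le_one_le)
  have qb: "\<bar>q\<bar> \<le> 2 * B" "\<bar>q\<bar> \<le> A / 2 + \<bar>D\<bar>"
  proof -
    have "0 \<le> exp (- B) / 2 * A" using eB A by simp
    then show "\<bar>q\<bar> \<le> A / 2 + \<bar>D\<bar>" unfolding q_def using eA by linarith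
    then show "\<bar>q\<bar> \<le> 2 * B" using A(2) B2 D(1) B by linarith
  qed
  \<comment> \<open>As \<open>\<bar>q\<bar> \<le> 2 * B\<close>, the quadratic loss is a small
    multiple of \<open>\<bar>q\<bar>\<close>, hence of the variance and mean terms.\<close>
  have q2: "2 * q\<^sup>2 \<le> 4 * B * \<bar>q\<bar>"
    using mult_right_mono[OF qb(1), of "2 * \<bar>q\<bar>"] by (simp add: power2_eq_square mult_ac flip: abs_mult)
  have ln: "q - 2 * q\<^sup>2 \<le> ln (1 + q)"
    using abs_ln_one_plus_x_minus_x_bound[of q] qb(1) assms(7) by (simp add: abs_le_iff)
  \<comment> \<open>Gathers all multiples of the tail under the coefficient 1; the hypotheses give
    \<open>l * c \<le> 1 / 16\<close>.\<close>
  have lc: "4 * (l * c)\<^sup>2 / 2 + 2 * (l * c) \<le> 1"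
  proof -
    have lc0: "0 \<le> l * c" "l * c \<le> 1 / 16" using assms by (auto simp: mult_ac)
    then have "(l * c)\<^sup>2 \<le> l * c" by (simp add: power2_eq_square mult_left_le)
    then show ?thesis using lc0 by linarith
  qed
  have G0: "0 \<le> tail_e c p j" by (rule tail_e_nonneg[OF assms(1,2)])
  have "(exp (- B) - 4 * B) * (l\<^sup>2 / 2) * v j - 2 * l * \<mu> j - tail_e c p j \<le> q - 2 * q\<^sup>2"
  proof -
    have "4 * B * \<bar>q\<bar> \<le> 4 * B * (A / 2 + \<bar>D\<bar>)" using qb(2) B by (intro mult_left_mono) auto
    also have "\<dots> \<le> 4 * B * (l\<^sup>2 * v j / 2) + 4 * B * \<bar>D\<bar>"
      using mult_left_mono[OF A(3), of "4 * B"] B by (simp add: algebra_simps)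
    also have "4 * B * \<bar>D\<bar> \<le> 1 * \<bar>D\<bar>" using assms(7) by (intro mult_right_mono) auto
    finally have 1: "2 * q\<^sup>2 \<le> 4 * B * (l\<^sup>2 * v j / 2) + \<bar>D\<bar>" using q2 by linarith
    have "exp (- B) / 2 * (l\<^sup>2 * v j - 4 * (l * c)\<^sup>2 * tail_e c p j) \<le> exp (- B) / 2 * A"
      using A(4) by (intro mult_left_mono) auto
    moreover have "exp (- B) / 2 * (4 * (l * c)\<^sup>2 * tail_e c p j) \<le> 1 / 2 * (4 * (l * c)\<^sup>2 * tail_e c p j)"
      using eB G0 by (intro mult_right_mono) auto
    ultimately have 2: "exp (- B) / 2 * (l\<^sup>2 * v j) - 4 * (l * c)\<^sup>2 / 2 * tail_e c p j - \<bar>D\<bar> \<le> q"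
      unfolding q_def right_diff_distrib by linarith
    have "(4 * (l * c)\<^sup>2 / 2 + 2 * (l * c)) * tail_e c p j \<le> 1 * tail_e c p j"
      using lc G0 by (intro mult_right_mono) auto
    then have 3: "4 * (l * c)\<^sup>2 / 2 * tail_e c p j + 2 * (l * c * tail_e c p j) \<le> tail_e c p j"
      by (simp add: algebra_simps)
    have "(exp (- B) - 4 * B) * (l\<^sup>2 / 2) * v j = exp (- B) / 2 * (l\<^sup>2 * v j) - 4 * B * (l\<^sup>2 * v j / 2)"
      by (simp add: algebra_simps)
    then show ?thesis using 1 2 3 D(2) by linarith
  qed
  then have "exp ((exp (- B) - 4 * B) * (l\<^sup>2 / 2) * v j - 2 * l * \<mu> j - tail_e c p j) \<le> exp (ln (1 + q))"
    using ln by simp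
  also have "\<dots> = 1 + q" using qb(1) assms(7) by (intro exp_ln) (auto simp: abs_le_iff)
  also have "\<dots> \<le> e (\<lambda>\<omega>. exp (l * ?Y \<omega>))" by fact
  finally show ?thesis .
qed

lemma EE_exp_clip_sum_upper:
  assumes "tail_fin c p n" "m \<le> n" "0 < c" "2 \<le> p" "0 < l" "2 * l * c \<le> B" "l * c \<le> 1"
  shows "EE (\<lambda>x. exp (l * clip_sum (2 * c) m n x)) \<le>
     exp (l * mu_sum n + tail_sum c p n + exp B * (l\<^sup>2 / 2) * u n)"
proof -
  let ?f = "\<lambda>j. l * (\<mu> j + c * tail_e c p j) + exp B * (l\<^sup>2 / 2) * v j"
  have "EE (\<lambda>x. exp (l * clip_sum (2 * c) m n x)) = (\<Prod>j\<in>{m..<n}. e (\<lambda>\<omega>. exp (l * clip (2 * c) (X (Suc j) \<omega>))))"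
    using assms by (intro EE_exp_clip_sum) auto
  also have "\<dots> \<le> (\<Prod>j\<in>{m..<n}. exp (?f j))"
    using assms
    by (intro prod_mono conjI e_nonneg exp_clip_fin e_exp_clip_upper[OF assms(1)]) auto
  also have "\<dots> = exp (\<Sum>j\<in>{m..<n}. ?f j)" by (simp add: exp_sum)
  also have "(\<Sum>j\<in>{m..<n}. ?f j) \<le> (\<Sum>j<n. l * \<mu> j + tail_e c p j + exp B * (l\<^sup>2 / 2) * v j)"
  proof -
    have le: "?f j \<le> l * \<mu> j + tail_e c p j + exp B * (l\<^sup>2 / 2) * v j" if "j < n" for j
      using mult_right_mono[OF assms(7) tail_e_nonneg[OF assms(1) that]] by (simp add: algebra_simps)
    have "(\<Sum>j\<in>{m..<n}. ?f j) \<le> (\<Sum>j\<in>{m..<n}. l * \<mu> j + tail_e c p j + exp B * (l\<^sup>2 / 2) * v j)"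
      by (intro sum_mono le) auto
    also have "\<dots> \<le> (\<Sum>j<n. l * \<mu> j + tail_e c p j + exp B * (l\<^sup>2 / 2) * v j)"
      using tail_e_nonneg[OF assms(1)] \<mu>_nonneg v_nonneg assms(5) by (intro sum_mono2) auto
    finally show ?thesis .
  qed
  also have "(\<Sum>j<n. l * \<mu> j + tail_e c p j + exp B * (l\<^sup>2 / 2) * v j) =
      l * mu_sum n + tail_sum c p n + exp B * (l\<^sup>2 / 2) * u n"
    by (simp add: mu_sum_def tail_sum_def u_def sum.distrib sum_distrib_left)
  finally show ?thesis by simp
qed

text \<open>Here the variance has to be that of the block alone, \<open>u n - u m\<close>, while the
  losses from means and tails may be enlarged to all indices below \<open>n\<close>.\<close>

lemma EE_exp_clip_sum_lower:
  assumes "tail_fin c p n" "m \<le> n" "0 < c" "2 \<le> p" "0 < l" "2 * l * c \<le> B" "B \<le> 1 / 8"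
  shows "exp ((exp (- B) - 4 * B) * (l\<^sup>2 / 2) * (u n - u m) - 2 * l * mu_sum n - tail_sum c p n) \<le>
     EE (\<lambda>x. exp (l * clip_sum (2 * c) m n x))"
proof -
  let ?f = "\<lambda>j. (exp (- B) - 4 * B) * (l\<^sup>2 / 2) * v j - 2 * l * \<mu> j - tail_e c p j"
  have "(\<Sum>j<n. v j) = (\<Sum>j<m. v j) + (\<Sum>j\<in>{m..<n}. v j)"
    using assms(2) by (metis lessThan_atLeast0 le0 sum.atLeastLessThan_concat)
  then have un: "u n - u m = (\<Sum>j\<in>{m..<n}. v j)" by (simp add: u_def)
  have "(\<Sum>j\<in>{m..<n}. \<mu> j) \<le> mu_sum n" "(\<Sum>j\<in>{m..<n}. tail_e c p j) \<le> tail_sum c p n"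
    unfolding mu_sum_def tail_sum_def using tail_e_nonneg[OF assms(1)] \<mu>_nonneg
    by (auto intro!: sum_mono2)
  then have "2 * l * (\<Sum>j\<in>{m..<n}. \<mu> j) \<le> 2 * l * mu_sum n" "(\<Sum>j\<in>{m..<n}. tail_e c p j) \<le> tail_sum c p n"
    using assms(5) by (auto intro!: mult_left_mono)
  moreover have "(\<Sum>j\<in>{m..<n}. ?f j) = (exp (- B) - 4 * B) * (l\<^sup>2 / 2) * (u n - u m) -
      2 * l * (\<Sum>j\<in>{m..<n}. \<mu> j) - (\<Sum>j\<in>{m..<n}. tail_e c p j)"
    unfolding un by (simp add: sum_subtractf sum_distrib_left)
  ultimately have "exp ((exp (- B) - 4 * B) * (l\<^sup>2 / 2) * (u n - u m) - 2 * l * mu_sum n - tail_sum c p n)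
      \<le> exp (\<Sum>j\<in>{m..<n}. ?f j)" by simp
  also have "\<dots> = (\<Prod>j\<in>{m..<n}. exp (?f j))" by (simp add: exp_sum)
  also have "\<dots> \<le> (\<Prod>j\<in>{m..<n}. e (\<lambda>\<omega>. exp (l * clip (2 * c) (X (Suc j) \<omega>))))"
    using assms by (intro prod_mono conjI e_exp_clip_lower[OF assms(1)]) auto
  also have "\<dots> = EE (\<lambda>x. exp (l * clip_sum (2 * c) m n x))"
    using assms by (intro EE_exp_clip_sum[symmetric]) auto
  finally show ?thesis .
qed

end

section \<open>Good and bad indices\<close>

text \<open>The power is \<open>(a / c) powr p\<close>, the price of measuring tails at level
  \<open>c\<close> in units of \<open>a\<close>.\<close>

lemma exp_powr_decay:
  fixes \<eta> \<alpha> p :: real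
  assumes "0 < \<eta>" "0 < \<alpha>" "0 \<le> p"
  shows "\<forall>\<^sub>F x in at_top. exp (- \<eta> * x) * (2 * x / \<alpha>) powr p \<le> 1"
proof -
  define k where "k = nat \<lceil>p\<rceil>"
  have k: "p \<le> real k" unfolding k_def by (rule real_nat_ceiling_ge)
  have "((\<lambda>x. (\<eta> * x) ^ k / exp (\<eta> * x)) \<longlongrightarrow> 0) at_top"
    by (rule filterlim_compose[OF tendsto_power_div_exp_0 filterlim_tendsto_pos_mult_at_top[OF tendsto_const assms(1) filterlim_ident]])
  from tendsto_mult_left[OF this, of "(2 / (\<alpha> * \<eta>)) ^ k"]
  have "((\<lambda>x. (2 / (\<alpha> * \<eta>)) ^ k * ((\<eta> * x) ^ k / exp (\<eta> * x))) \<longlongrightarrow> 0) at_top" by simp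
  then have "\<forall>\<^sub>F x in at_top. (2 / (\<alpha> * \<eta>)) ^ k * ((\<eta> * x) ^ k / exp (\<eta> * x)) < 1"
    by (rule order_tendstoD) simp
  then show ?thesis using eventually_ge_at_top[of "\<alpha> / 2"]
  proof eventually_elim
    fix x :: real
    assume x: "(2 / (\<alpha> * \<eta>)) ^ k * ((\<eta> * x) ^ k / exp (\<eta> * x)) < 1" "\<alpha> / 2 \<le> x"
    have "1 \<le> 2 * x / \<alpha>" using x(2) assms by (simp add: field_simps)
    then have "(2 * x / \<alpha>) powr p \<le> (2 * x / \<alpha>) powr real k" using k by (intro powr_mono) auto
    also have "\<dots> = (2 * x / \<alpha>) ^ k" using \<open>1 \<le> 2 * x / \<alpha>\<close> by (intro powr_realpow) auto
    also have "\<dots> = (2 / (\<alpha> * \<eta>)) ^ k * (\<eta> * x) ^ k"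
      unfolding power_mult_distrib[symmetric] using assms by (simp add: field_simps)
    finally have "exp (- \<eta> * x) * (2 * x / \<alpha>) powr p \<le> exp (- \<eta> * x) * ((2 / (\<alpha> * \<eta>)) ^ k * (\<eta> * x) ^ k)"
      by (intro mult_left_mono) auto
    also have "\<dots> = (2 / (\<alpha> * \<eta>)) ^ k * ((\<eta> * x) ^ k / exp (\<eta> * x))"
      by (simp add: exp_minus field_simps)
    finally show "exp (- \<eta> * x) * (2 * x / \<alpha>) powr p \<le> 1" using x(1) by linarith
  qed
qed

section \<open>Normalising sequences and the truncation level\<close>

context independent_square_integrable
begin

definition s :: "nat \<Rightarrow> real" where "s n = sqrt (u n)"
definition \<tau> :: "nat \<Rightarrow> real" where "\<tau> n = LL (u n)"
definition t :: "nat \<Rightarrow> real" where "t n = sqrt (2 * \<tau> n)"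
definition a :: "nat \<Rightarrow> real" where "a n = s n * t n"

lemma \<tau>_ge_1: "1 \<le> \<tau> n" by (simp add: \<tau>_def LL_ge_1)

lemma t_pos: "0 < t n" using \<tau>_ge_1[of n] by (simp add: t_def)

lemma t_square: "t n * t n = 2 * \<tau> n" using \<tau>_ge_1[of n] by (simp add: t_def)

lemma s_pos: "0 < u n \<Longrightarrow> 0 < s n" by (simp add: s_def)

lemma s_nonneg: "0 \<le> s n" by (simp add: s_def u_nonneg)

lemma s_square: "s n * s n = u n" by (simp add: s_def u_nonneg)

lemma a_pos: "0 < u n \<Longrightarrow> 0 < a n" by (simp add: a_def s_pos t_pos)

lemma a_nonneg: "0 \<le> a n" using t_pos[of n] s_nonneg[of n] by (simp add: a_def)

lemma \<tau>_mono: "m \<le> n \<Longrightarrow> \<tau> m \<le> \<tau> n" by (simp add: \<tau>_def LL_mono u_mono)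

lemma a_mono: "m \<le> n \<Longrightarrow> a m \<le> a n"
  unfolding a_def s_def t_def using u_mono u_nonneg \<tau>_ge_1 \<tau>_mono
  by (intro mult_mono) (auto intro: order_trans[OF zero_le_one])

lemma a_square: "(a n)\<^sup>2 = 2 * u n * \<tau> n"
  by (simp add: a_def power2_eq_square mult_ac flip: s_square t_square)

end

locale lil_setting = independent_square_integrable +
  assumes u_top: "filterlim u at_top sequentially"
    and mean_small: "(\<lambda>n. mu_sum n / a n) \<longlonglongrightarrow> 0"
begin

lemma eventually_u_ge: "\<forall>\<^sub>F n in sequentially. x \<le> u n"
  using u_top unfolding filterlim_at_top by blast

lemma eventually_u_pos: "\<forall>\<^sub>F n in sequentially. 0 < u n"
  using eventually_u_ge[of 1] by eventually_elim simp

lemma \<tau>_top: "filterlim \<tau> at_top sequentially"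
  unfolding \<tau>_def by (rule filterlim_compose[OF filterlim_LL u_top])

lemma eventually_\<tau>_ge: "\<forall>\<^sub>F n in sequentially. x \<le> \<tau> n"
  using \<tau>_top unfolding filterlim_at_top by blast

lemma eventually_mu_le: "0 < \<epsilon> \<Longrightarrow> \<forall>\<^sub>F n in sequentially. mu_sum n \<le> \<epsilon> * a n"
proof -
  assume "0 < \<epsilon>"
  from order_tendstoD(2)[OF mean_small this] eventually_u_pos show ?thesis
  proof eventually_elim
    case (elim n)
    then show ?case using a_pos[of n] by (simp add: field_simps)
  qed
qed

end

text \<open>One value of \<alpha> with the exponents belonging to it. \<open>raw_fin\<close>
  supplies the finite moments behind the real quantities \<open>raw\<close>, \<open>Lam\<close> and
  \<open>b\<close>.\<close>

locale lil_truncation = lil_setting +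
  fixes \<alpha> p d :: real
  assumes \<alpha>_pos: "0 < \<alpha>" and p_ge_2: "2 \<le> p" and d_nonneg: "0 \<le> d"
    and raw_fin: "j < n \<Longrightarrow> (\<lambda>\<omega>. max (\<bar>X (Suc j) \<omega>\<bar> - \<alpha> * s n / t n) 0 powr p) \<in> fin"
begin

definition c :: "nat \<Rightarrow> real" where "c n = \<alpha> * s n / t n"
definition raw :: "nat \<Rightarrow> nat \<Rightarrow> real" where
  "raw n j = e (\<lambda>\<omega>. max (\<bar>X (Suc j) \<omega>\<bar> - c n) 0 powr p)"
definition Lam :: "nat \<Rightarrow> real" where "Lam n = (\<Sum>j<n. raw n j)"
definition b :: "nat \<Rightarrow> real" where "b n = Lam n / a n powr p"

lemma c_pos: "0 < u n \<Longrightarrow> 0 < c n"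
  using \<alpha>_pos s_pos t_pos by (simp add: c_def)

lemma tail_raw: "0 < u n \<Longrightarrow> tail (c n) p x = (1 / c n powr p) * max (\<bar>x\<bar> - c n) 0 powr p"
  using c_pos[of n] by (simp add: tail_def powr_divide)

lemma raw_fin': "j < n \<Longrightarrow> (\<lambda>\<omega>. max (\<bar>X (Suc j) \<omega>\<bar> - c n) 0 powr p) \<in> fin"
  using raw_fin[of j n] by (simp add: c_def)

lemma tail_fin_c: "0 < u n \<Longrightarrow> tail_fin (c n) p n"
  unfolding tail_fin_def tail_raw by (intro allI impI fin_scale raw_fin')

lemma raw_nonneg: "j < n \<Longrightarrow> 0 \<le> raw n j"
  unfolding raw_def by (intro e_nonneg raw_fin') auto

lemma Lam_nonneg: "0 \<le> Lam n"
  unfolding Lam_def by (intro sum_nonneg) (auto simp: raw_nonneg)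

lemma b_nonneg: "0 \<le> b n"
  unfolding b_def using Lam_nonneg by simp

lemma a_over_c: "0 < u n \<Longrightarrow> a n / c n = 2 * \<tau> n / \<alpha>"
  using s_pos[of n] t_pos[of n] \<alpha>_pos t_square[of n] by (simp add: a_def c_def field_simps)

lemma tail_sum_eq: "0 < u n \<Longrightarrow> tail_sum (c n) p n = b n * (2 * \<tau> n / \<alpha>) powr p"
proof -
  assume u: "0 < u n"
  have "tail_e (c n) p j = (1 / c n powr p) * raw n j" if "j < n" for j
    unfolding tail_e_def raw_def tail_raw[OF u] by (rule e_scale[OF raw_fin'[OF that]]) simp
  then have "tail_sum (c n) p n = (1 / c n powr p) * Lam n"
    unfolding tail_sum_def Lam_def sum_distrib_left by simp
  also have "\<dots> = b n * (a n / c n) powr p"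
    using a_pos[OF u] c_pos[OF u] by (simp add: b_def powr_divide)
  finally show ?thesis by (simp add: a_over_c[OF u])
qed

text \<open>At good indices the room \<open>\<eta> - q\<close> absorbs the polynomial factor, after
  \<open>exp (q * \<tau> n)\<close> has been spent on truncating at a multiple of
  \<open>a n\<close>.\<close>

lemma eventually_tail_sum_le:
  assumes "0 \<le> q" "q < \<eta>"
  shows "\<forall>\<^sub>F n in sequentially. b n \<le> exp (- \<eta> * \<tau> n) \<longrightarrow> exp (q * \<tau> n) * tail_sum (c n) p n \<le> 1"
proof -
  have "\<forall>\<^sub>F n in sequentially. exp (- (\<eta> - q) * \<tau> n) * (2 * \<tau> n / \<alpha>) powr p \<le> 1"
    using filterlim_iff[THEN iffD1, OF \<tau>_top, rule_format, OF exp_powr_decay[of "\<eta> - q" \<alpha> p]] assms \<alpha>_pos p_ge_2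
    by auto
  then show ?thesis using eventually_u_pos
  proof eventually_elim
    fix n assume 1: "exp (- (\<eta> - q) * \<tau> n) * (2 * \<tau> n / \<alpha>) powr p \<le> 1" and u: "0 < u n"
    show "b n \<le> exp (- \<eta> * \<tau> n) \<longrightarrow> exp (q * \<tau> n) * tail_sum (c n) p n \<le> 1"
    proof
      assume "b n \<le> exp (- \<eta> * \<tau> n)"
      then have "exp (q * \<tau> n) * tail_sum (c n) p n \<le> exp (q * \<tau> n) * (exp (- \<eta> * \<tau> n) * (2 * \<tau> n / \<alpha>) powr p)"
        unfolding tail_sum_eq[OF u] by (intro mult_left_mono mult_right_mono) auto
      also have "\<dots> = exp (- (\<eta> - q) * \<tau> n) * (2 * \<tau> n / \<alpha>) powr p"
        by (simp add: algebra_simps flip: exp_add)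
      finally show "exp (q * \<tau> n) * tail_sum (c n) p n \<le> 1" using 1 by linarith
    qed
  qed
qed

text \<open>The level contributes \<open>- 2 * (1 + \<epsilon>) * \<tau>\<close> and the variance at
  most \<open>(1 + \<epsilon> / 2) * \<tau>\<close>; mean and tail fit into the margin. Jumps up to
  \<open>y * a n\<close> cost \<open>exp (2 * y * \<tau> n)\<close>, whence
  \<open>2 * y < \<eta>\<close>.\<close>

lemma upper_good:
  assumes "0 < \<epsilon>" "exp (2 * \<alpha>) \<le> 1 + \<epsilon> / 2" "0 < y" "2 * y < \<eta>"
  shows "\<forall>\<^sub>F n in sequentially. b n \<le> exp (- \<eta> * \<tau> n) \<longrightarrow>
    hat_le {\<omega> \<in> space M. \<exists>m\<in>{1..n}. (1 + \<epsilon>) * a n \<le> (\<Sum>j<m. min (X (Suc j) \<omega>) (y * a n))}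
      (exp (- (1 + \<epsilon> / 2) * \<tau> n))"
proof -
  have y0: "0 \<le> 2 * y" "0 < \<epsilon> / 8" using assms by auto
  show ?thesis
    using eventually_tail_sum_le[OF y0(1) assms(4)] eventually_mu_le[OF y0(2)]
      eventually_\<tau>_ge[of "4 / \<epsilon>"] eventually_u_pos
proof eventually_elim
  fix n
  assume *: "b n \<le> exp (- \<eta> * \<tau> n) \<longrightarrow> exp (2 * y * \<tau> n) * tail_sum (c n) p n \<le> 1"
    "mu_sum n \<le> \<epsilon> / 8 * a n" "4 / \<epsilon> \<le> \<tau> n" "0 < u n"
  show "b n \<le> exp (- \<eta> * \<tau> n) \<longrightarrow>
    hat_le {\<omega> \<in> space M. \<exists>m\<in>{1..n}. (1 + \<epsilon>) * a n \<le> (\<Sum>j<m. min (X (Suc j) \<omega>) (y * a n))}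
      (exp (- (1 + \<epsilon> / 2) * \<tau> n))"
  proof
    assume "b n \<le> exp (- \<eta> * \<tau> n)"
    then have tl: "exp (2 * y * \<tau> n) * tail_sum (c n) p n \<le> 1" using * by blast
    note pos = s_pos[OF *(4)] t_pos[of n] a_pos[OF *(4)] c_pos[OF *(4)]
    \<comment> \<open>The choice optimal for a Gaussian sum of variance \<open>u n\<close> at level
      \<open>a n\<close>.\<close>
    define l where "l = t n / s n"
    have l: "0 < l" using pos by (simp add: l_def)
    have la: "l * a n = 2 * \<tau> n" using pos t_square[of n] by (simp add: l_def a_def)
    have lu: "l\<^sup>2 * u n = 2 * \<tau> n"
      using pos *(4) t_square[of n] s_square[of n] by (simp add: l_def power2_eq_square field_simps)
    have lc: "l * c n = \<alpha>" using pos by (simp add: l_def c_def)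
    have "hat_le {\<omega> \<in> space M. \<exists>m\<in>{1..n}. (1 + \<epsilon>) * a n \<le> (\<Sum>j<m. min (X (Suc j) \<omega>) (y * a n))}
     (exp (1 - l * ((1 + \<epsilon>) * a n) + (l * mu_sum n + l\<^sup>2 / 2 * exp (2 * l * c n) * u n + exp (l * (y * a n)) * tail_sum (c n) p n)))"
      using pos p_ge_2 l assms by (intro maximal_min[OF tail_fin_c[OF *(4)]]) auto
    moreover have "1 - l * ((1 + \<epsilon>) * a n) + (l * mu_sum n + l\<^sup>2 / 2 * exp (2 * l * c n) * u n + exp (l * (y * a n)) * tail_sum (c n) p n)
        \<le> - (1 + \<epsilon> / 2) * \<tau> n"
    proof -
      have eq1: "l * (k * a n) = k * (2 * \<tau> n)" for k using la by (simp add: mult.left_commute)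
      have lc2: "2 * l * c n = 2 * \<alpha>" using lc by simp
      have "l\<^sup>2 / 2 * exp (2 * \<alpha>) * u n = exp (2 * \<alpha>) * (l\<^sup>2 * u n) / 2" by simp
      also have "\<dots> = exp (2 * \<alpha>) * \<tau> n" unfolding lu by simp
      also have "\<dots> \<le> (1 + \<epsilon> / 2) * \<tau> n"
        using assms \<tau>_ge_1[of n] by (intro mult_right_mono) auto
      also have "\<dots> = \<tau> n + (\<epsilon> * \<tau> n) / 2" by (simp add: algebra_simps)
      finally have e1: "l\<^sup>2 / 2 * exp (2 * l * c n) * u n \<le> \<tau> n + (\<epsilon> * \<tau> n) / 2" unfolding lc2 .
      have e2: "l * mu_sum n \<le> (\<epsilon> * \<tau> n) / 4"
      proof -
        have "l * mu_sum n \<le> l * (\<epsilon> / 8 * a n)" using *(2) l by (intro mult_left_mono) auto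
        also have "\<dots> = \<epsilon> / 8 * (2 * \<tau> n)" by (rule eq1)
        finally show ?thesis by simp
      qed
      have e3: "exp (l * (y * a n)) * tail_sum (c n) p n \<le> 1" using tl unfolding eq1 by (simp add: mult_ac)
      have e4: "4 \<le> \<epsilon> * \<tau> n" using *(3) assms by (simp add: field_simps)
      have e5: "l * ((1 + \<epsilon>) * a n) = 2 * \<tau> n + 2 * (\<epsilon> * \<tau> n)" unfolding eq1 by (simp add: algebra_simps)
      have e6: "- (1 + \<epsilon> / 2) * \<tau> n = - \<tau> n - (\<epsilon> * \<tau> n) / 2" by (simp add: algebra_simps)
      show ?thesis using e1 e2 e3 e4 e5 e6 by linarith
    qed
    ultimately show "hat_le {\<omega> \<in> space M. \<exists>m\<in>{1..n}. (1 + \<epsilon>) * a n \<le> (\<Sum>j<m. min (X (Suc j) \<omega>) (y * a n))}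
      (exp (- (1 + \<epsilon> / 2) * \<tau> n))"
      by (rule hat_le_mono[OF _ Int_lower1 iffD2[OF exp_le_cancel_iff]])
  qed
qed
qed

text \<open>Everything is measured in units of \<open>L = - ln b\<close>. The level contributes
  \<open>- 2 * D * L\<close>, mean and variance give back at most \<open>D * L / 2\<close> each, and
  truncation at \<open>a / (2 * D)\<close> makes \<open>exp (l * y)\<close> equal to
  \<open>1 / b\<close>, which reduces the tail term to a constant. There remains
  \<open>b powr D\<close>. Badness, that is \<open>L < \<eta> * \<tau>\<close>, keeps the variance
  term this small.\<close>

lemma upper_bad:
  assumes "1 \<le> D" "0 < \<eta>" "D * \<eta> * \<alpha> \<le> 1" "D * \<eta> * exp p \<le> 1 / 2"
  shows "\<forall>\<^sub>F n in sequentially. exp (- \<eta> * \<tau> n) < b n \<longrightarrow> b n < 1 \<longrightarrow>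
    hat_le {\<omega> \<in> space M. \<exists>m\<in>{1..n}. a n \<le> (\<Sum>j<m. min (X (Suc j) \<omega>) (a n / (2 * D)))}
      (exp (1 + (4 * D) powr p) * b n powr D)"
proof -
  have q0: "(0::real) < 1 / 4" by simp
  show ?thesis
    using eventually_mu_le[OF q0] eventually_u_pos
proof eventually_elim
  fix n
  assume *: "mu_sum n \<le> 1 / 4 * a n" "0 < u n"
  show "exp (- \<eta> * \<tau> n) < b n \<longrightarrow> b n < 1 \<longrightarrow>
    hat_le {\<omega> \<in> space M. \<exists>m\<in>{1..n}. a n \<le> (\<Sum>j<m. min (X (Suc j) \<omega>) (a n / (2 * D)))}
      (exp (1 + (4 * D) powr p) * b n powr D)"
  proof (intro impI)
    assume bad: "exp (- \<eta> * \<tau> n) < b n" "b n < 1"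
    note pos = s_pos[OF *(2)] t_pos[of n] a_pos[OF *(2)] c_pos[OF *(2)]
    have b0: "0 < b n" using bad(1) exp_gt_zero less_trans by blast
    define L where "L = - ln (b n)"
    have L: "0 < L" "L < \<eta> * \<tau> n" "exp (- L) = b n"
    proof -
      show "0 < L" using bad b0 by (simp add: L_def)
      have "ln (exp (- \<eta> * \<tau> n)) < ln (b n)" using bad b0 by (intro ln_less_cancel_iff[THEN iffD2]) auto
      then show "L < \<eta> * \<tau> n" by (simp add: L_def)
      show "exp (- L) = b n" using b0 by (simp add: L_def)
    qed
    define l where "l = 2 * D * L / a n"
    have \<tau>0: "0 < \<tau> n" using \<tau>_ge_1[of n] by linarith
    have l: "0 < l" using pos L assms by (simp add: l_def)
    have la: "l * a n = 2 * D * L" using pos by (simp add: l_def)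
    have ly: "l * (a n / (2 * D)) = L" using pos assms by (simp add: l_def)
    have lc: "2 * l * c n \<le> p"
    proof -
      have "l * c n * (2 * \<tau> n) = \<alpha> * (l * a n)"
        using a_over_c[OF *(2)] pos \<alpha>_pos by (simp add: field_simps)
      then have "2 * l * c n * \<tau> n = 2 * D * \<alpha> * L" unfolding la by (simp add: mult_ac)
      also have "\<dots> \<le> 2 * D * \<alpha> * (\<eta> * \<tau> n)" using L assms \<alpha>_pos by (intro mult_left_mono) auto
      also have "\<dots> = 2 * (D * \<eta> * \<alpha>) * \<tau> n" by simp
      also have "\<dots> \<le> p * \<tau> n" using assms(3) p_ge_2 \<tau>0 by (intro mult_right_mono) auto
      finally show ?thesis using \<tau>0 by simp
    qed
    have lu: "l\<^sup>2 / 2 * exp p * u n \<le> D * L / 2"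
    proof -
      have "l\<^sup>2 * (2 * u n * \<tau> n) = (2 * D * L)\<^sup>2"
        using pos by (simp add: l_def power_divide flip: a_square)
      then have "l\<^sup>2 / 2 * u n * \<tau> n = D * L * (D * L)" by (simp add: power2_eq_square mult_ac)
      also have "\<dots> \<le> D * L * (D * (\<eta> * \<tau> n))" using L assms by (intro mult_left_mono) auto
      finally have "l\<^sup>2 / 2 * u n * \<tau> n \<le> D * L * (D * \<eta>) * \<tau> n" by (simp add: mult_ac)
      then have "l\<^sup>2 / 2 * u n \<le> D * L * (D * \<eta>)" using \<tau>0 by simp
      then have "l\<^sup>2 / 2 * u n * exp p \<le> D * L * (D * \<eta>) * exp p" by (intro mult_right_mono) auto
      also have "\<dots> = D * L * (D * \<eta> * exp p)" by simp
      also have "\<dots> \<le> D * L * (1 / 2)" using assms L by (intro mult_left_mono) auto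
      finally show ?thesis by (simp add: mult_ac)
    qed
    \<comment> \<open>\<open>exp (l * y)\<close> cancels \<open>b\<close>, and the refined factor
      \<open>(2 * c / y) powr p\<close> cancels the polynomial
      \<open>(a / c) powr p\<close>.\<close>
    have tl: "exp (l * (a n / (2 * D))) * (2 * c n / (a n / (2 * D))) powr p * tail_sum (c n) p n = (4 * D) powr p"
    proof -
      have "2 * c n / (a n / (2 * D)) * (a n / c n) = 4 * D" using pos by (simp add: field_simps)
      moreover have "(2 * c n / (a n / (2 * D))) powr p * (a n / c n) powr p = (2 * c n / (a n / (2 * D)) * (a n / c n)) powr p"
        using pos assms by (intro powr_mult[symmetric]) 
      ultimately have "(2 * c n / (a n / (2 * D))) powr p * (a n / c n) powr p = (4 * D) powr p" by simp
      moreover have "exp L * b n = 1" unfolding L(3)[symmetric] by (simp flip: exp_add)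
      ultimately show ?thesis unfolding ly tail_sum_eq[OF *(2)] a_over_c[OF *(2), symmetric]
        by (metis (no_types, lifting) mult.assoc mult.commute mult.left_neutral)
    qed
    have "hat_le {\<omega> \<in> space M. \<exists>m\<in>{1..n}. a n \<le> (\<Sum>j<m. min (X (Suc j) \<omega>) (a n / (2 * D)))}
     (exp (1 - l * a n + (l * mu_sum n + l\<^sup>2 / 2 * exp p * u n + exp (l * (a n / (2 * D))) * (2 * c n / (a n / (2 * D))) powr p * tail_sum (c n) p n)))"
      using pos p_ge_2 l assms lc by (intro maximal_min'[OF tail_fin_c[OF *(2)]]) auto
    moreover have "exp (1 - l * a n + (l * mu_sum n + l\<^sup>2 / 2 * exp p * u n + exp (l * (a n / (2 * D))) * (2 * c n / (a n / (2 * D))) powr p * tail_sum (c n) p n))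
        \<le> exp (1 + (4 * D) powr p) * b n powr D"
    proof -
      have "4 * (l * mu_sum n) \<le> l * a n" using mult_left_mono[OF *(1), of l] l by simp
      then have "1 - l * a n + (l * mu_sum n + l\<^sup>2 / 2 * exp p * u n + (4 * D) powr p) \<le> 1 + (4 * D) powr p - D * L"
        using lu la by linarith
      then have "exp (1 - l * a n + (l * mu_sum n + l\<^sup>2 / 2 * exp p * u n + (4 * D) powr p)) \<le> exp (1 + (4 * D) powr p - D * L)"
        by simp
      also have "\<dots> = exp (1 + (4 * D) powr p) * b n powr D"
      proof -
        have "b n powr D = exp (- (D * L))" using b0 by (simp add: powr_def L_def)
        then show ?thesis by (simp flip: exp_add)
      qed
      finally show ?thesis unfolding tl .
    qed
    ultimately show "hat_le {\<omega> \<in> space M. \<exists>m\<in>{1..n}. a n \<le> (\<Sum>j<m. min (X (Suc j) \<omega>) (a n / (2 * D)))}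
      (exp (1 + (4 * D) powr p) * b n powr D)"
      by (rule hat_le_mono[OF _ Int_lower1])
  qed
qed
qed

text \<open>\<open>l = 2 * t / (\<epsilon> * s)\<close> turns the level into
  \<open>- 4 * \<tau>\<close>; the \<open>- 2 * \<tau>\<close> that is kept is well inside the range
  summable over blocks.\<close>

lemma excess_good:
  assumes "0 < \<epsilon>" "0 < y" "4 * y / \<epsilon> < \<eta>"
  shows "\<forall>\<^sub>F n in sequentially. b n \<le> exp (- \<eta> * \<tau> n) \<longrightarrow>
    hat_le {\<omega> \<in> space M. \<exists>m\<in>{1..n}. \<epsilon> * a n \<le> (\<Sum>j<m. min (max (\<bar>X (Suc j) \<omega>\<bar> - 2 * c n) 0) (y * a n))}
      (exp (- 2 * \<tau> n))"
proof -
  have y0: "0 \<le> 4 * y / \<epsilon>" using assms by simp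
  show ?thesis
    using eventually_tail_sum_le[OF y0 assms(3)] eventually_u_pos
proof eventually_elim
  fix n
  assume *: "b n \<le> exp (- \<eta> * \<tau> n) \<longrightarrow> exp (4 * y / \<epsilon> * \<tau> n) * tail_sum (c n) p n \<le> 1" "0 < u n"
  show "b n \<le> exp (- \<eta> * \<tau> n) \<longrightarrow>
    hat_le {\<omega> \<in> space M. \<exists>m\<in>{1..n}. \<epsilon> * a n \<le> (\<Sum>j<m. min (max (\<bar>X (Suc j) \<omega>\<bar> - 2 * c n) 0) (y * a n))}
      (exp (- 2 * \<tau> n))"
  proof
    assume "b n \<le> exp (- \<eta> * \<tau> n)"
    then have tl: "exp (4 * y / \<epsilon> * \<tau> n) * tail_sum (c n) p n \<le> 1" using * by blast
    note pos = s_pos[OF *(2)] t_pos[of n] a_pos[OF *(2)] c_pos[OF *(2)]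
    define l where "l = 2 / \<epsilon> * t n / s n"
    have l: "0 < l" using pos assms by (simp add: l_def)
    have la: "l * a n = 4 * \<tau> n / \<epsilon>" using pos t_square[of n] assms by (simp add: l_def a_def field_simps)
    have "hat_le {\<omega> \<in> space M. \<exists>m\<in>{1..n}. \<epsilon> * a n \<le> (\<Sum>j<m. min (max (\<bar>X (Suc j) \<omega>\<bar> - 2 * c n) 0) (y * a n))}
     (exp (1 - l * (\<epsilon> * a n) + (0 * mu_sum n + 0 * u n + exp (l * (y * a n)) * tail_sum (c n) p n)))"
      using pos p_ge_2 l assms by (intro maximal_excess[OF tail_fin_c[OF *(2)]]) auto
    moreover have "1 - l * (\<epsilon> * a n) + (0 * mu_sum n + 0 * u n + exp (l * (y * a n)) * tail_sum (c n) p n) \<le> - 2 * \<tau> n"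
    proof -
      have eq: "l * (y * a n) = y * (l * a n)" by simp
      have "l * (\<epsilon> * a n) = 4 * \<tau> n" using la assms by (simp add: field_simps)
      moreover have "l * (y * a n) = 4 * y / \<epsilon> * \<tau> n" unfolding eq la by simp
      ultimately show ?thesis using tl \<tau>_ge_1[of n] by simp
    qed
    ultimately show "hat_le {\<omega> \<in> space M. \<exists>m\<in>{1..n}. \<epsilon> * a n \<le> (\<Sum>j<m. min (max (\<bar>X (Suc j) \<omega>\<bar> - 2 * c n) 0) (y * a n))}
      (exp (- 2 * \<tau> n))"
      by (rule hat_le_mono[OF _ Int_lower1 iffD2[OF exp_le_cancel_iff]])
  qed
qed
qed

text \<open>Gaussian asymptotics on the exponential scale: for \<open>l = \<kappa> * t / s\<close>
  the variance term \<open>l\<^sup>2 / 2 * u\<close> equals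
  \<open>\<kappa>\<^sup>2 * \<tau>\<close>. The factors \<open>exp (4 * \<alpha>)\<close> and
  \<open>exp (- 4 * \<alpha>) - 16 * \<alpha>\<close> are the distortions for one variable at
  \<open>B = 4 * \<alpha>\<close>, and \<open>1 - \<theta>\<close> is the least share of the
  variance lying in the block.\<close>

lemma mgf_good:
  assumes "0 < \<zeta>" "exp (4 * \<alpha>) \<le> 1 + \<zeta> / 8" "(exp (- 4 * \<alpha>) - 16 * \<alpha>) * (1 - \<theta>) \<ge> 1 - \<zeta> / 8"
    "\<alpha> \<le> 1 / 32" "0 < \<eta>" "0 \<le> exp (- 4 * \<alpha>) - 16 * \<alpha>"
  shows "\<forall>\<^sub>F n in sequentially. b n \<le> exp (- \<eta> * \<tau> n) \<longrightarrow>
    (\<forall>m \<kappa>. m \<le> n \<longrightarrow> u m \<le> \<theta> * u n \<longrightarrow> 0 < \<kappa> \<longrightarrow> \<kappa> \<le> 2 \<longrightarrow>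
      exp ((\<kappa>\<^sup>2 - \<zeta>) * \<tau> n) \<le> EE (\<lambda>x. exp (2 * \<tau> n * \<kappa> * (clip_sum (2 * c n) m n x / a n))) \<and>
      EE (\<lambda>x. exp (2 * \<tau> n * \<kappa> * (clip_sum (2 * c n) m n x / a n))) \<le> exp ((\<kappa>\<^sup>2 + \<zeta>) * \<tau> n))"
proof -
  have z0: "0 < \<zeta> / 32" using assms by simp
  show ?thesis
    using eventually_tail_sum_le[OF order_refl assms(5)] eventually_mu_le[OF z0]
      eventually_\<tau>_ge[of "4 / \<zeta>"] eventually_u_pos
proof (eventually_elim, intro impI allI)
  fix n m and \<kappa> :: real
  assume *: "b n \<le> exp (- \<eta> * \<tau> n) \<longrightarrow> exp (0 * \<tau> n) * tail_sum (c n) p n \<le> 1"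
    "mu_sum n \<le> \<zeta> / 32 * a n" "4 / \<zeta> \<le> \<tau> n" "0 < u n"
    and good: "b n \<le> exp (- \<eta> * \<tau> n)" and m: "m \<le> n" "u m \<le> \<theta> * u n" and \<kappa>: "0 < \<kappa>" "\<kappa> \<le> 2"
  have tl: "tail_sum (c n) p n \<le> 1" using *(1) good by simp
  note pos = s_pos[OF *(4)] t_pos[of n] a_pos[OF *(4)] c_pos[OF *(4)]
  have \<tau>0: "0 < \<tau> n" using \<tau>_ge_1[of n] by linarith
  define l where "l = \<kappa> * t n / s n"
  have l: "0 < l" using pos \<kappa> by (simp add: l_def)
  have la: "l * a n = 2 * \<kappa> * \<tau> n" using pos t_square[of n] by (simp add: l_def a_def mult_ac)
  have lu: "l\<^sup>2 / 2 * u n = \<kappa>\<^sup>2 * \<tau> n"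
    using pos *(4) t_square[of n] s_square[of n] by (simp add: l_def power2_eq_square field_simps)
  have lc: "l * c n = \<kappa> * \<alpha>" using pos by (simp add: l_def c_def)
  have lc4: "2 * l * c n \<le> 4 * \<alpha>"
    using lc mult_right_mono[OF \<kappa>(2), of \<alpha>] \<alpha>_pos by simp
  have lc1: "l * c n \<le> 1" using lc4 assms(4) by linarith
  have \<kappa>4: "\<kappa>\<^sup>2 \<le> 4" using \<kappa> power_mono[of \<kappa> 2 2] by simp
  have lmu: "l * mu_sum n \<le> \<zeta> * \<tau> n / 8"
  proof -
    have "l * mu_sum n \<le> \<zeta> / 32 * (l * a n)" using mult_left_mono[OF *(2), of l] l by (simp add: mult_ac)
    also have "\<dots> = \<zeta> / 16 * \<tau> n * \<kappa>" unfolding la by simp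
    also have "\<dots> \<le> \<zeta> / 16 * \<tau> n * 2" using \<kappa> \<tau>0 assms(1) by (intro mult_left_mono) auto
    finally show ?thesis by simp
  qed
  have one: "1 \<le> \<zeta> * \<tau> n / 4" using *(3) assms(1) by (simp add: field_simps)
  have eq: "(\<lambda>x. exp (2 * \<tau> n * \<kappa> * (clip_sum (2 * c n) m n x / a n))) = (\<lambda>x. exp (l * clip_sum (2 * c n) m n x))"
  proof
    fix x
    have "2 * \<tau> n * \<kappa> * (clip_sum (2 * c n) m n x / a n) = (l * a n) * (clip_sum (2 * c n) m n x / a n)"
      unfolding la by simp
    then show "exp (2 * \<tau> n * \<kappa> * (clip_sum (2 * c n) m n x / a n)) = exp (l * clip_sum (2 * c n) m n x)"
      using pos by simp
  qed
  have z4: "\<zeta> / 8 * \<kappa>\<^sup>2 \<le> \<zeta> / 2" using mult_left_mono[OF \<kappa>4, of "\<zeta> / 8"] assms(1) by simp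
  have low: "exp ((\<kappa>\<^sup>2 - \<zeta>) * \<tau> n) \<le> EE (\<lambda>x. exp (l * clip_sum (2 * c n) m n x))"
  proof -
    let ?B = "4 * \<alpha>"
    have "(1 - \<theta>) * u n \<le> u n - u m" using m(2) by (simp add: algebra_simps)
    then have "(exp (- ?B) - 4 * ?B) * (l\<^sup>2 / 2) * ((1 - \<theta>) * u n) \<le> (exp (- ?B) - 4 * ?B) * (l\<^sup>2 / 2) * (u n - u m)"
      using assms(6) by (intro mult_left_mono) auto
    moreover have "(exp (- ?B) - 4 * ?B) * (l\<^sup>2 / 2) * ((1 - \<theta>) * u n) = ((exp (- 4 * \<alpha>) - 16 * \<alpha>) * (1 - \<theta>)) * (l\<^sup>2 / 2 * u n)"
      by simp
    moreover have "(1 - \<zeta> / 8) * (l\<^sup>2 / 2 * u n) \<le> ((exp (- 4 * \<alpha>) - 16 * \<alpha>) * (1 - \<theta>)) * (l\<^sup>2 / 2 * u n)"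
      using assms(3) *(4) by (intro mult_right_mono) auto
    moreover have "(\<kappa>\<^sup>2 - \<zeta> / 2) * \<tau> n \<le> (1 - \<zeta> / 8) * (l\<^sup>2 / 2 * u n)"
      using mult_right_mono[OF z4, of "\<tau> n"] \<tau>0 unfolding lu by (simp add: algebra_simps)
    ultimately have "(\<kappa>\<^sup>2 - \<zeta> / 2) * \<tau> n \<le> (exp (- ?B) - 4 * ?B) * (l\<^sup>2 / 2) * (u n - u m)"
      by linarith
    moreover have "(\<kappa>\<^sup>2 - \<zeta>) * \<tau> n = (\<kappa>\<^sup>2 - \<zeta> / 2) * \<tau> n - \<zeta> * \<tau> n / 2"
      by (simp add: algebra_simps)
    moreover have "2 * l * mu_sum n \<le> \<zeta> * \<tau> n / 4" using lmu by simp
    ultimately have "(\<kappa>\<^sup>2 - \<zeta>) * \<tau> n \<le>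
        (exp (- ?B) - 4 * ?B) * (l\<^sup>2 / 2) * (u n - u m) - 2 * l * mu_sum n - tail_sum (c n) p n"
      using one tl by linarith
    then have "exp ((\<kappa>\<^sup>2 - \<zeta>) * \<tau> n) \<le>
        exp ((exp (- ?B) - 4 * ?B) * (l\<^sup>2 / 2) * (u n - u m) - 2 * l * mu_sum n - tail_sum (c n) p n)" by simp
    also have "\<dots> \<le> EE (\<lambda>x. exp (l * clip_sum (2 * c n) m n x))"
      using assms(4) by (intro EE_exp_clip_sum_lower[OF tail_fin_c[OF *(4)] m(1) pos(4) p_ge_2 l lc4]) simp
    finally show ?thesis .
  qed
  have up: "EE (\<lambda>x. exp (l * clip_sum (2 * c n) m n x)) \<le> exp ((\<kappa>\<^sup>2 + \<zeta>) * \<tau> n)"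
  proof -
    have "exp (4 * \<alpha>) * (l\<^sup>2 / 2 * u n) \<le> (1 + \<zeta> / 8) * (l\<^sup>2 / 2 * u n)"
      using assms(2) *(4) by (intro mult_right_mono) auto
    also have "\<dots> \<le> (\<kappa>\<^sup>2 + \<zeta> / 2) * \<tau> n"
      using mult_right_mono[OF z4, of "\<tau> n"] \<tau>0 unfolding lu by (simp add: algebra_simps)
    finally have "exp (4 * \<alpha>) * (l\<^sup>2 / 2) * u n \<le> (\<kappa>\<^sup>2 + \<zeta> / 2) * \<tau> n" by simp
    moreover have "(\<kappa>\<^sup>2 + \<zeta>) * \<tau> n = (\<kappa>\<^sup>2 + \<zeta> / 2) * \<tau> n + \<zeta> * \<tau> n / 2"
      by (simp add: algebra_simps)
    ultimately have "l * mu_sum n + tail_sum (c n) p n + exp (4 * \<alpha>) * (l\<^sup>2 / 2) * u n \<le> (\<kappa>\<^sup>2 + \<zeta>) * \<tau> n"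
      using lmu one tl by linarith
    then have "exp (l * mu_sum n + tail_sum (c n) p n + exp (4 * \<alpha>) * (l\<^sup>2 / 2) * u n) \<le> exp ((\<kappa>\<^sup>2 + \<zeta>) * \<tau> n)"
      by (rule iffD2[OF exp_le_cancel_iff])
    with EE_exp_clip_sum_upper[OF tail_fin_c[OF *(4)] m(1) pos(4) p_ge_2 l lc4 lc1]
    show ?thesis by (rule order_trans)
  qed
  show "exp ((\<kappa>\<^sup>2 - \<zeta>) * \<tau> n) \<le> EE (\<lambda>x. exp (2 * \<tau> n * \<kappa> * (clip_sum (2 * c n) m n x / a n))) \<and>
      EE (\<lambda>x. exp (2 * \<tau> n * \<kappa> * (clip_sum (2 * c n) m n x / a n))) \<le> exp ((\<kappa>\<^sup>2 + \<zeta>) * \<tau> n)"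
    using low up eq by simp
qed
qed

end

section \<open>Lower exponential bound and small covers\<close>

context lil_truncation
begin

lemma EE_add: "\<phi> \<in> BL n \<Longrightarrow> \<psi> \<in> BL n \<Longrightarrow> EE (\<lambda>x. \<phi> x + \<psi> x) \<le> EE \<phi> + EE \<psi>"
  unfolding EE_def by (intro e_add joint_fin)

lemma clip_mean_BL: "0 < u n \<Longrightarrow> (\<lambda>x. clip_sum (2 * c n) m n x / a n) \<in> BL n"
  using BL_scale[OF clip_sum_BL[of "2 * c n" m n], of "1 / a n"] c_pos[of n] by simp

text \<open>Three tilts \<open>\<kappa> - \<delta>\<close>, \<kappa>,
  \<open>\<kappa> + \<delta>\<close> are compared. Completing the square, the outer ones lose
  \<open>\<delta>\<^sup>2 * \<tau>\<close>; the tolerance \<open>\<delta>\<^sup>2 / 4\<close> in the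
  exponential moments leaves a gap of \<open>\<delta>\<^sup>2 / 2 * \<tau>\<close>, so the window
  around \<kappa> carries at least half of the middle moment.\<close>

lemma lower_good:
  assumes \<delta>: "0 < \<delta>" "\<delta> \<le> 1 / 10"
    and "exp (4 * \<alpha>) \<le> 1 + \<delta>\<^sup>2 / 32" "(exp (- 4 * \<alpha>) - 16 * \<alpha>) * (1 - \<theta>) \<ge> 1 - \<delta>\<^sup>2 / 32"
    and "\<alpha> \<le> 1 / 32" "0 < \<eta>" "0 \<le> exp (- 4 * \<alpha>) - 16 * \<alpha>"
  shows "\<forall>\<^sub>F n in sequentially. b n \<le> exp (- \<eta> * \<tau> n) \<longrightarrow>
    (\<forall>m. m \<le> n \<longrightarrow> u m \<le> \<theta> * u n \<longrightarrow>
      exp (- (1 - 2 * \<delta>) * \<tau> n) \<le> EE (\<lambda>x. ramp (1 - 4 * \<delta>) \<delta> (clip_sum (2 * c n) m n x / a n)))"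
proof -
  have z: "0 < \<delta>\<^sup>2 / 4" "exp (4 * \<alpha>) \<le> 1 + \<delta>\<^sup>2 / 4 / 8" "(exp (- 4 * \<alpha>) - 16 * \<alpha>) * (1 - \<theta>) \<ge> 1 - \<delta>\<^sup>2 / 4 / 8"
    using assms by simp_all
  show ?thesis
    using mgf_good[OF z(1,2,3) assms(5,6,7)] eventually_\<tau>_ge[of "6 / \<delta>\<^sup>2"] eventually_u_pos
  proof (eventually_elim, intro impI allI)
    fix n m
    assume mgf: "b n \<le> exp (- \<eta> * \<tau> n) \<longrightarrow>
      (\<forall>m \<kappa>. m \<le> n \<longrightarrow> u m \<le> \<theta> * u n \<longrightarrow> 0 < \<kappa> \<longrightarrow> \<kappa> \<le> 2 \<longrightarrow>
      exp ((\<kappa>\<^sup>2 - \<delta>\<^sup>2 / 4) * \<tau> n) \<le> EE (\<lambda>x. exp (2 * \<tau> n * \<kappa> * (clip_sum (2 * c n) m n x / a n))) \<and>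
      EE (\<lambda>x. exp (2 * \<tau> n * \<kappa> * (clip_sum (2 * c n) m n x / a n))) \<le> exp ((\<kappa>\<^sup>2 + \<delta>\<^sup>2 / 4) * \<tau> n))"
      and \<tau>6: "6 / \<delta>\<^sup>2 \<le> \<tau> n" and u: "0 < u n" and good: "b n \<le> exp (- \<eta> * \<tau> n)"
      and m: "m \<le> n" "u m \<le> \<theta> * u n"
    define Z where "Z x = clip_sum (2 * c n) m n x / a n" for x
    define \<phi> where "\<phi> \<kappa> x = exp (2 * \<tau> n * \<kappa> * Z x)" for \<kappa> x
    define f where "f x = ramp (1 - 4 * \<delta>) \<delta> (Z x)" for x
    have Z_BL: "Z \<in> BL n" unfolding Z_def by (rule clip_mean_BL[OF u])
    have \<phi>_BL: "\<phi> \<kappa> \<in> BL n" for \<kappa> unfolding \<phi>_def by (rule BL_exp[OF BL_scale[OF Z_BL]])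
    have f_BL: "f \<in> BL n" unfolding f_def by (rule BL_lip1[OF Z_BL ramp_lip1])
    have \<tau>0: "0 \<le> \<tau> n" using \<tau>_ge_1[of n] by linarith
    have bounds: "exp ((\<kappa>\<^sup>2 - \<delta>\<^sup>2 / 4) * \<tau> n) \<le> EE (\<phi> \<kappa>)" "EE (\<phi> \<kappa>) \<le> exp ((\<kappa>\<^sup>2 + \<delta>\<^sup>2 / 4) * \<tau> n)"
      if "0 < \<kappa>" "\<kappa> \<le> 2" for \<kappa>
      using mgf good m that unfolding \<phi>_def Z_def by blast+
    \<comment> \<open>Then \<open>\<kappa> - \<delta>\<close> is exactly the point from which the
      ramp equals 1.\<close>
    define \<kappa> where "\<kappa> = 1 - 3 * \<delta>"
    have \<kappa>: "0 < \<kappa> - \<delta>" "\<kappa> + \<delta> \<le> 2" using \<delta> by (auto simp: \<kappa>_def)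
    define A1 where "A1 = exp (2 * \<tau> n * \<delta> * (\<kappa> - \<delta>))"
    define A2 where "A2 = exp (- 2 * \<tau> n * \<delta> * (\<kappa> + \<delta>))"
    define A3 where "A3 = exp (2 * \<tau> n * \<kappa> * (\<kappa> + \<delta>))"
    have A: "0 \<le> A1" "0 \<le> A2" "0 < A3" by (auto simp: A1_def A2_def A3_def)
    have 1: "A1 * EE (\<phi> (\<kappa> - \<delta>)) \<le> exp ((\<kappa>\<^sup>2 - 3 / 4 * \<delta>\<^sup>2) * \<tau> n)"
    proof -
      have "A1 * EE (\<phi> (\<kappa> - \<delta>)) \<le> A1 * exp (((\<kappa> - \<delta>)\<^sup>2 + \<delta>\<^sup>2 / 4) * \<tau> n)"
        using \<kappa> \<delta> A by (intro mult_left_mono bounds) auto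
      also have "\<dots> = exp (2 * \<tau> n * \<delta> * (\<kappa> - \<delta>) + ((\<kappa> - \<delta>)\<^sup>2 + \<delta>\<^sup>2 / 4) * \<tau> n)"
        by (simp only: A1_def exp_add)
      also have "2 * \<tau> n * \<delta> * (\<kappa> - \<delta>) + ((\<kappa> - \<delta>)\<^sup>2 + \<delta>\<^sup>2 / 4) * \<tau> n = (\<kappa>\<^sup>2 - 3 / 4 * \<delta>\<^sup>2) * \<tau> n"
        by (simp add: power2_eq_square algebra_simps)
      finally show ?thesis .
    qed
    have 2: "A2 * EE (\<phi> (\<kappa> + \<delta>)) \<le> exp ((\<kappa>\<^sup>2 - 3 / 4 * \<delta>\<^sup>2) * \<tau> n)"
    proof -
      have "A2 * EE (\<phi> (\<kappa> + \<delta>)) \<le> A2 * exp (((\<kappa> + \<delta>)\<^sup>2 + \<delta>\<^sup>2 / 4) * \<tau> n)"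
        using \<kappa> \<delta> A by (intro mult_left_mono bounds) auto
      also have "\<dots> = exp (- 2 * \<tau> n * \<delta> * (\<kappa> + \<delta>) + ((\<kappa> + \<delta>)\<^sup>2 + \<delta>\<^sup>2 / 4) * \<tau> n)"
        by (simp only: A2_def exp_add)
      also have "- 2 * \<tau> n * \<delta> * (\<kappa> + \<delta>) + ((\<kappa> + \<delta>)\<^sup>2 + \<delta>\<^sup>2 / 4) * \<tau> n = (\<kappa>\<^sup>2 - 3 / 4 * \<delta>\<^sup>2) * \<tau> n"
        by (simp add: power2_eq_square algebra_simps)
      finally show ?thesis .
    qed
    have "EE (\<phi> \<kappa>) \<le> EE (\<lambda>x. (A1 * \<phi> (\<kappa> - \<delta>) x + A2 * \<phi> (\<kappa> + \<delta>) x) + A3 * f x)"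
    proof (rule EE_mono[OF \<phi>_BL BL_add[OF BL_add[OF BL_scale[OF \<phi>_BL] BL_scale[OF \<phi>_BL]] BL_scale[OF f_BL]]])
      fix x
      show "\<phi> \<kappa> x \<le> (A1 * \<phi> (\<kappa> - \<delta>) x + A2 * \<phi> (\<kappa> + \<delta>) x) + A3 * f x"
        unfolding \<phi>_def A1_def A2_def A3_def
      proof (rule exp_tilt_split[OF \<tau>0])
        show "f x = 1" if "\<kappa> - \<delta> \<le> Z x"
          unfolding f_def using that \<delta> by (intro ramp_eq_1) (auto simp: \<kappa>_def)
      qed (use \<delta> \<kappa> in \<open>auto simp: f_def ramp_bounds\<close>)
    qed
    also have "\<dots> \<le> EE (\<lambda>x. A1 * \<phi> (\<kappa> - \<delta>) x + A2 * \<phi> (\<kappa> + \<delta>) x) + EE (\<lambda>x. A3 * f x)"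
      by (rule EE_add[OF BL_add[OF BL_scale[OF \<phi>_BL] BL_scale[OF \<phi>_BL]] BL_scale[OF f_BL]])
    also have "\<dots> \<le> EE (\<lambda>x. A1 * \<phi> (\<kappa> - \<delta>) x) + EE (\<lambda>x. A2 * \<phi> (\<kappa> + \<delta>) x) + EE (\<lambda>x. A3 * f x)"
      by (rule add_right_mono, rule EE_add[OF BL_scale[OF \<phi>_BL] BL_scale[OF \<phi>_BL]])
    also have "\<dots> = A1 * EE (\<phi> (\<kappa> - \<delta>)) + A2 * EE (\<phi> (\<kappa> + \<delta>)) + A3 * EE f"
      using EE_scale[OF \<phi>_BL] EE_scale[OF f_BL] A by simp
    finally have main: "exp ((\<kappa>\<^sup>2 - \<delta>\<^sup>2 / 4) * \<tau> n) - 2 * exp ((\<kappa>\<^sup>2 - 3 / 4 * \<delta>\<^sup>2) * \<tau> n) \<le> A3 * EE f"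
      using 1 2 bounds(1)[of \<kappa>] \<kappa> \<delta> by simp
    \<comment> \<open>Makes the gap in the exponent at least 3; since \<open>exp 3 \<ge> 4\<close>,
      the two outer terms together take at most half.\<close>
    have \<delta>\<tau>: "6 \<le> \<delta>\<^sup>2 * \<tau> n" using \<tau>6 \<delta> by (simp add: field_simps)
    have "exp ((\<kappa>\<^sup>2 - 3 / 4 * \<delta>\<^sup>2) * \<tau> n) \<le> exp ((\<kappa>\<^sup>2 - \<delta>\<^sup>2 / 4) * \<tau> n) / 4"
    proof -
      have "1 + 3 \<le> exp (3::real)" by (rule exp_ge_add_one_self)
      moreover have "exp 3 \<le> exp (\<delta>\<^sup>2 / 2 * \<tau> n)" using \<delta>\<tau> by simp
      ultimately have "4 \<le> exp (\<delta>\<^sup>2 / 2 * \<tau> n)" by linarith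
      then have "exp ((\<kappa>\<^sup>2 - 3 / 4 * \<delta>\<^sup>2) * \<tau> n) * 4 \<le> exp ((\<kappa>\<^sup>2 - 3 / 4 * \<delta>\<^sup>2) * \<tau> n) * exp (\<delta>\<^sup>2 / 2 * \<tau> n)"
        by (intro mult_left_mono) auto
      also have "\<dots> = exp ((\<kappa>\<^sup>2 - 3 / 4 * \<delta>\<^sup>2) * \<tau> n + \<delta>\<^sup>2 / 2 * \<tau> n)" by (simp only: exp_add)
      also have "(\<kappa>\<^sup>2 - 3 / 4 * \<delta>\<^sup>2) * \<tau> n + \<delta>\<^sup>2 / 2 * \<tau> n = (\<kappa>\<^sup>2 - \<delta>\<^sup>2 / 4) * \<tau> n" by (simp add: algebra_simps)
      finally show ?thesis by simp
    qed
    with main have half: "exp ((\<kappa>\<^sup>2 - \<delta>\<^sup>2 / 4) * \<tau> n) / 2 \<le> A3 * EE f" by linarith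
    have "A3 * exp (- (1 - 2 * \<delta>) * \<tau> n) \<le> exp ((\<kappa>\<^sup>2 - \<delta>\<^sup>2 / 4) * \<tau> n) / 2"
    proof -
      have "\<delta>\<^sup>2 * \<tau> n \<le> \<delta> * \<tau> n"
        using \<delta> \<tau>0 by (intro mult_right_mono) (auto simp: power2_eq_square mult_left_le)
      then have "1 + 1 \<le> exp (\<delta> * \<tau> n)" using \<delta>\<tau> exp_ge_add_one_self[of "\<delta> * \<tau> n"] by linarith
      then have "A3 * exp (- (1 - 2 * \<delta>) * \<tau> n) * 2 \<le> A3 * exp (- (1 - 2 * \<delta>) * \<tau> n) * exp (\<delta> * \<tau> n)"
        using A by (intro mult_left_mono) auto
      also have "\<dots> = exp (2 * \<tau> n * \<kappa> * (\<kappa> + \<delta>) + - (1 - 2 * \<delta>) * \<tau> n + \<delta> * \<tau> n)"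
        by (simp only: A3_def exp_add)
      also have "\<dots> \<le> exp ((\<kappa>\<^sup>2 - \<delta>\<^sup>2 / 4) * \<tau> n)"
      proof (rule iffD2[OF exp_le_cancel_iff])
        have "2 * \<kappa> * (\<kappa> + \<delta>) - (1 - 2 * \<delta>) + \<delta> \<le> \<kappa>\<^sup>2 - \<delta>\<^sup>2 / 4"
        proof -
          have "13 / 4 * (\<delta> * \<delta>) \<le> 13 / 40 * \<delta>" using mult_left_mono[OF \<delta>(2), of \<delta>] \<delta>(1) by linarith
          moreover have "2 * \<kappa> * (\<kappa> + \<delta>) - (1 - 2 * \<delta>) + \<delta> = 1 - 7 * \<delta> + 12 * (\<delta> * \<delta>)"
            by (simp add: \<kappa>_def algebra_simps)
          moreover have "\<kappa>\<^sup>2 - \<delta>\<^sup>2 / 4 = 1 - 6 * \<delta> + 35 / 4 * (\<delta> * \<delta>)"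
            by (simp add: \<kappa>_def power2_eq_square algebra_simps)
          ultimately show ?thesis using \<delta>(1) by linarith
        qed
        then have "(2 * \<kappa> * (\<kappa> + \<delta>) - (1 - 2 * \<delta>) + \<delta>) * \<tau> n \<le> (\<kappa>\<^sup>2 - \<delta>\<^sup>2 / 4) * \<tau> n"
          using \<tau>0 by (rule mult_right_mono)
        moreover have "(2 * \<kappa> * (\<kappa> + \<delta>) - (1 - 2 * \<delta>) + \<delta>) * \<tau> n = 2 * \<tau> n * \<kappa> * (\<kappa> + \<delta>) + - (1 - 2 * \<delta>) * \<tau> n + \<delta> * \<tau> n"
          by (simp add: algebra_simps)
        ultimately show "2 * \<tau> n * \<kappa> * (\<kappa> + \<delta>) + - (1 - 2 * \<delta>) * \<tau> n + \<delta> * \<tau> n \<le> (\<kappa>\<^sup>2 - \<delta>\<^sup>2 / 4) * \<tau> n" by simp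
      qed
      finally show ?thesis by simp
    qed
    with half have "A3 * exp (- (1 - 2 * \<delta>) * \<tau> n) \<le> A3 * EE f" by linarith
    then have "exp (- (1 - 2 * \<delta>) * \<tau> n) \<le> EE f" using A(3) by simp
    then show "exp (- (1 - 2 * \<delta>) * \<tau> n) \<le> EE (\<lambda>x. ramp (1 - 4 * \<delta>) \<delta> (clip_sum (2 * c n) m n x / a n))"
      unfolding f_def Z_def .
  qed
qed

end

section \<open>Small covers\<close>

context sublinear_expectation_space
begin

text \<open>Each set of the sequence is covered by finitely many members of one sequence of total size
  at most \<open>\<eta>\<close>.  This controls finite unions under a merely finitely sub-additive capacity and
  countable unions under its countably sub-additive extension alike.\<close>

definition small_cover :: "real \<Rightarrow> (nat \<Rightarrow> 'a set) \<Rightarrow> bool" where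
  "small_cover \<eta> A \<longleftrightarrow> (\<exists>(B :: nat \<Rightarrow> 'a set) r. (\<forall>i. B i \<in> sets M \<and> hat_le (B i) (r i)) \<and> (\<forall>I. (\<Sum>i<I. r i) \<le> \<eta>) \<and>
     (\<forall>n. \<exists>I. A n \<subseteq> (\<Union>i<I. B i)))"

lemma hat_le_empty: "hat_le {} 0"
  unfolding hat_le_def by (rule bexI[OF _ zero_fin]) (simp add: e_const)

lemma hat_le_Un: "hat_le A r \<Longrightarrow> hat_le B q \<Longrightarrow> hat_le (A \<union> B) (r + q)"
proof -
  assume "hat_le A r" "hat_le B q"
  then obtain \<xi> \<zeta> where *: "\<xi> \<in> fin" "\<forall>\<omega>\<in>space M. indicator A \<omega> \<le> \<xi> \<omega>" "e \<xi> \<le> r"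
    "\<zeta> \<in> fin" "\<forall>\<omega>\<in>space M. indicator B \<omega> \<le> \<zeta> \<omega>" "e \<zeta> \<le> q"
    unfolding hat_le_def by blast
  show ?thesis unfolding hat_le_def
  proof (intro bexI[OF _ fin_add[OF *(1,4)]] conjI ballI)
    fix \<omega> assume w: "\<omega> \<in> space M"
    have "indicator (A \<union> B) \<omega> \<le> (indicator A \<omega> + indicator B \<omega> :: real)" by (auto simp: indicator_def)
    then show "indicator (A \<union> B) \<omega> \<le> \<xi> \<omega> + \<zeta> \<omega>" using *(2,5) w by fastforce
  next
    show "e (\<lambda>\<omega>. \<xi> \<omega> + \<zeta> \<omega>) \<le> r + q" using e_add[OF *(1,4)] *(3,6) by linarith
  qed
qed

lemma hat_le_UN: "(\<And>i. hat_le (B i) (r i)) \<Longrightarrow> hat_le (\<Union>i<(I::nat). B i) (\<Sum>i<I. r i)"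
proof (induction I)
  case 0
  then show ?case using hat_le_empty by simp
next
  case (Suc I)
  then show ?case using hat_le_Un[OF Suc.IH Suc.prems, of I] by (simp add: lessThan_Suc Un_commute add.commute)
qed

lemma small_cover_I:
  "(\<And>i. A i \<in> sets M) \<Longrightarrow> (\<And>i. hat_le (A i) (r i)) \<Longrightarrow> (\<And>I. (\<Sum>i<I. r i) \<le> \<eta>) \<Longrightarrow> small_cover \<eta> A"
proof -
  assume *: "\<And>i. A i \<in> sets M" "\<And>i. hat_le (A i) (r i)" "\<And>I. (\<Sum>i<I. r i) \<le> \<eta>"
  show ?thesis
    unfolding small_cover_def
  proof (intro exI[of _ A] exI[of _ r] conjI allI)
    show "\<exists>I. A n \<subseteq> (\<Union>i<I. A i)" for n by (rule exI[of _ "Suc n"]) blast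
  qed (rule *)+
qed

lemma small_cover_E:
  assumes "small_cover \<eta> A"
  obtains B r where "\<And>i. B i \<in> sets M" "\<And>i. hat_le (B i) (r i)" "\<And>I. (\<Sum>i<(I::nat). r i) \<le> \<eta>"
    "\<And>n. \<exists>I. A n \<subseteq> (\<Union>i<I. B i)"
  using assms unfolding small_cover_def by blast

text \<open>Covers compose because a finite union of finite unions is finite. The size belongs to
  the covering sequence and does not grow when its members are reused.\<close>

lemma small_cover_cover: "small_cover \<eta> A \<Longrightarrow> (\<And>m. \<exists>I::nat. A' m \<subseteq> (\<Union>i<I. A i)) \<Longrightarrow> small_cover \<eta> A'"
proof -
  assume a: "small_cover \<eta> A" and A': "\<And>m. \<exists>I::nat. A' m \<subseteq> (\<Union>i<I. A i)"
  obtain B r where B: "\<And>i. B i \<in> sets M" "\<And>i. hat_le (B i) (r i)" "\<And>I. (\<Sum>i<(I::nat). r i) \<le> \<eta>"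
    and cov: "\<And>n. \<exists>I. A n \<subseteq> (\<Union>i<I. B i)" using a by (rule small_cover_E) blast
  define J where "J n = (SOME I. A n \<subseteq> (\<Union>i<I. B i))" for n
  have J: "A n \<subseteq> (\<Union>i<J n. B i)" for n unfolding J_def by (rule someI_ex[OF cov])
  have "\<exists>I. A' m \<subseteq> (\<Union>i<I. B i)" for m
  proof -
    obtain I where I: "A' m \<subseteq> (\<Union>i<I. A i)" using A' by blast
    have "(\<Union>i<I. A i) \<subseteq> (\<Union>i<(\<Sum>k<I. J k). B i)"
    proof (rule UN_least)
      fix i assume i: "i \<in> {..<I}"
      then have "J i \<le> (\<Sum>k<I. J k)" by (intro member_le_sum) auto
      then show "A i \<subseteq> (\<Union>i<(\<Sum>k<I. J k). B i)" 
        by (intro order_trans[OF J[of i]] UN_mono) auto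
    qed
    with I show ?thesis by (intro exI[of _ "\<Sum>k<I. J k"]) (rule order_trans)
  qed
  with B have "(\<forall>i. B i \<in> sets M \<and> hat_le (B i) (r i)) \<and> (\<forall>I. (\<Sum>i<I. r i) \<le> \<eta>) \<and>
     (\<forall>n. \<exists>I. A' n \<subseteq> (\<Union>i<I. B i))" by simp
  then show ?thesis unfolding small_cover_def by (intro exI)
qed

lemma small_cover_Un: "small_cover \<eta> A \<Longrightarrow> small_cover \<eta>' A' \<Longrightarrow> small_cover (\<eta> + \<eta>') (\<lambda>n. A n \<union> A' n)"
proof -
  assume a: "small_cover \<eta> A" "small_cover \<eta>' A'"
  obtain B r where B: "\<And>i. B i \<in> sets M" "\<And>i. hat_le (B i) (r i)" "\<And>I. (\<Sum>i<(I::nat). r i) \<le> \<eta>"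
    "\<And>n. \<exists>I. A n \<subseteq> (\<Union>i<I. B i)" using a(1) by (rule small_cover_E) blast
  obtain B' r' where B': "\<And>i. B' i \<in> sets M" "\<And>i. hat_le (B' i) (r' i)"
    "\<And>I. (\<Sum>i<(I::nat). r' i) \<le> \<eta>'" "\<And>n. \<exists>I. A' n \<subseteq> (\<Union>i<I. B' i)" using a(2) by (rule small_cover_E) blast
  have "small_cover (\<eta> + \<eta>') (\<lambda>i. B i \<union> B' i)"
    by (rule small_cover_I[where r = "\<lambda>i. r i + r' i"])
       (auto intro!: hat_le_Un B B' add_mono simp: sum.distrib)
  then show ?thesis
  proof (rule small_cover_cover)
    fix n
    obtain I I' where "A n \<subseteq> (\<Union>i<I. B i)" "A' n \<subseteq> (\<Union>i<I'. B' i)" using B(4)[of n] B'(4)[of n] by blast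
    then have "A n \<union> A' n \<subseteq> (\<Union>i<max I I'. B i \<union> B' i)" by fastforce
    then show "\<exists>I. A n \<union> A' n \<subseteq> (\<Union>i<I. B i \<union> B' i)" by blast
  qed
qed

lemma small_cover_V_le:
  assumes "small_cover \<eta> A" "property_C M H E V" "F \<in> sets M" "F \<inter> space M \<subseteq> (\<Union>i<(n::nat). A i)"
  shows "V F \<le> \<eta>"
proof -
  have "small_cover \<eta> (\<lambda>_::nat. \<Union>i<n. A i)" by (rule small_cover_cover[OF assms(1)]) blast
  then obtain B r where B: "\<And>i. B i \<in> sets M" "\<And>i. hat_le (B i) (r i)" "\<And>I. (\<Sum>i<(I::nat). r i) \<le> \<eta>"
    "\<And>k::nat. \<exists>I. (\<Union>i<n. A i) \<subseteq> (\<Union>i<I. B i)" by (rule small_cover_E) blast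
  obtain I where I: "(\<Union>i<n. A i) \<subseteq> (\<Union>i<(I::nat). B i)" using B(4) by blast
  have "hat_le F \<eta>"
    by (rule hat_le_mono[OF hat_le_UN[of B r I, OF B(2)] order_trans[OF assms(4) I] B(3)])
  then show ?thesis by (rule property_C_le[OF assms(2,3)])
qed

text \<open>The first Borel-Cantelli step: far enough out, the remainder of the series of bounds is
  below \<eta>. Early members are replaced by empty sets so that indices do not shift.\<close>

lemma small_cover_tail:
  assumes "\<forall>\<^sub>F k in sequentially. A k \<in> sets M \<and> hat_le (A k) (r k)" "summable r" "0 < \<eta>"
  shows "\<forall>\<^sub>F k1 in sequentially. small_cover \<eta> (\<lambda>k. if k1 \<le> k then A k else {})"
proof -
  obtain N where N: "\<And>n. n \<ge> N \<Longrightarrow> norm (\<Sum>i. r (i + n)) < \<eta>"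
    using suminf_exist_split[OF assms(3,2)] by blast
  obtain K where K: "\<And>k. k \<ge> K \<Longrightarrow> A k \<in> sets M \<and> hat_le (A k) (r k)"
    using assms(1) unfolding eventually_sequentially by blast
  have "small_cover \<eta> (\<lambda>k. if k1 \<le> k then A k else {})" if k1: "max N K \<le> k1" for k1
  proof (rule small_cover_I[where r = "\<lambda>k. if k1 \<le> k then r k else 0"])
    have r0: "0 \<le> r k" if "k1 \<le> k" for k using K[of k] that k1 hat_le_nonneg by auto
    show "(if k1 \<le> k then A k else {}) \<in> sets M" for k using K[of k] k1 by auto
    show "hat_le (if k1 \<le> k then A k else {}) (if k1 \<le> k then r k else 0)" for k
      using K[of k] k1 hat_le_empty by auto
    show "(\<Sum>k<I. if k1 \<le> k then r k else 0) \<le> \<eta>" for I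
    proof -
      have "(\<Sum>k<I. if k1 \<le> k then r k else 0) \<le> (\<Sum>k<I + k1. if k1 \<le> k then r k else 0)"
        using r0 by (intro sum_mono2) auto
      also have "\<dots> = (\<Sum>k\<in>{k1..<I + k1}. r k)" by (intro sum.mono_neutral_cong_right) auto
      also have "\<dots> = (\<Sum>i<I. r (i + k1))"
        using sum.shift_bounds_nat_ivl[of r 0 k1 I] by (simp add: lessThan_atLeast0)
      also have "\<dots> \<le> (\<Sum>i. r (i + k1))"
        using r0 assms(2) by (intro sum_le_suminf) (auto simp: summable_iff_shift)
      also have "\<dots> \<le> \<eta>" using N[of k1] k1 by simp
      finally show ?thesis .
    qed
  qed
  then show ?thesis unfolding eventually_sequentially by blast
qed

end

section \<open>Blocks of geometrically growing variance\<close>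

text \<open>Summing the recursion bounds each partial sum by \<open>r\<close> times itself plus a
  constant.\<close>

lemma summable_contraction:
  fixes Z y :: "nat \<Rightarrow> real"
  assumes "\<And>k. 0 \<le> Z k" "summable y" "\<And>k. 0 \<le> y k" "\<And>k. Z (Suc k) \<le> r * Z k + y k" "0 \<le> r" "r < 1"
  shows "summable Z"
proof (rule bounded_imp_summable)
  fix n
  let ?S = "\<lambda>n. \<Sum>k\<le>n. Z k"
  have "?S n \<le> Z 0 + r * ?S n + suminf y"
  proof -
    have "?S n \<le> ?S (Suc n)" using assms(1) by simp
    also have "\<dots> = Z 0 + (\<Sum>k\<le>n. Z (Suc k))" by (rule sum.atMost_Suc_shift)
    also have "(\<Sum>k\<le>n. Z (Suc k)) \<le> (\<Sum>k\<le>n. r * Z k + y k)" by (intro sum_mono assms)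
    also have "\<dots> = r * ?S n + (\<Sum>k\<le>n. y k)" by (simp add: sum.distrib sum_distrib_left)
    also have "(\<Sum>k\<le>n. y k) \<le> suminf y" using assms(2,3) by (intro sum_le_suminf) auto
    finally show ?thesis by simp
  qed
  then have "(1 - r) * ?S n \<le> Z 0 + suminf y" by (simp add: algebra_simps)
  then show "?S n \<le> (Z 0 + suminf y) / (1 - r)" using assms(6) by (simp add: field_simps)
qed (rule assms)

text \<open>\<open>a n\<close> as a function of the variance alone, which permits comparison with
  the points \<open>\<Theta> ^ k\<close>, not necessarily values of \<open>u\<close>.\<close>

definition normaliser :: "real \<Rightarrow> real" where "normaliser x = sqrt (2 * x * LL x)"

lemma normaliser_pos: "0 < x \<Longrightarrow> 0 < normaliser x"
  using LL_ge_1[of x] by (simp add: normaliser_def)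

lemma normaliser_mono: "0 \<le> x \<Longrightarrow> x \<le> y \<Longrightarrow> normaliser x \<le> normaliser y"
  unfolding normaliser_def using LL_ge_1[of x] LL_mono[of x y]
  by (intro real_sqrt_le_mono mult_mono) auto

lemma normaliser_ratio: "0 < x \<Longrightarrow> x \<le> y \<Longrightarrow> normaliser y \<le> y / x * normaliser x"
proof -
  assume xy: "0 < x" "x \<le> y"
  have "x * (x * (2 * y * LL y)) = 2 * x * y * (x * LL y)" by simp
  also have "\<dots> \<le> 2 * x * y * (y * LL x)" using xy LL_ratio[OF xy] by (intro mult_left_mono) auto
  also have "\<dots> = y * (y * (2 * x * LL x))" by simp
  finally have "2 * y * LL y \<le> (y / x)\<^sup>2 * (2 * x * LL x)" using xy by (simp add: field_simps power2_eq_square)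
  then have "normaliser y \<le> sqrt ((y / x)\<^sup>2 * (2 * x * LL x))" unfolding normaliser_def by (rule real_sqrt_le_mono)
  also have "\<dots> = y / x * normaliser x" unfolding normaliser_def real_sqrt_mult real_sqrt_abs using xy by simp
  finally show ?thesis .
qed

text \<open>Growth at least like the square root: geometric growth of the variance then yields a
  contraction factor.\<close>

lemma normaliser_ratio': "0 < x \<Longrightarrow> x \<le> y \<Longrightarrow> normaliser x \<le> sqrt (x / y) * normaliser y"
proof -
  assume xy: "0 < x" "x \<le> y"
  have "2 * x * LL x \<le> 2 * x * LL y" using xy LL_mono[of x y] by (intro mult_left_mono) auto
  also have "\<dots> = x / y * (2 * y * LL y)" using xy by simp
  finally show ?thesis unfolding normaliser_def real_sqrt_mult[symmetric] by (rule real_sqrt_le_mono)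
qed

context independent_square_integrable
begin

lemma a_normaliser: "a n = normaliser (u n)"
  unfolding a_def s_def t_def normaliser_def \<tau>_def by (simp add: real_sqrt_mult[symmetric] mult_ac)

definition S :: "nat \<Rightarrow> 'a \<Rightarrow> real" where "S m \<omega> = (\<Sum>j<m. X (Suc j) \<omega>)"

lemma X_measurable [measurable]: "X (Suc j) \<in> borel_measurable M"
  by (rule measurable_H[OF X_Suc_H])

lemma S_measurable [measurable]: "S m \<in> borel_measurable M"
  unfolding S_def by measurable

lemma hat_le_chebyshev:
  assumes "0 < x"
  shows "hat_le {\<omega> \<in> space M. x \<le> \<bar>X (Suc j) \<omega>\<bar>} (v j / x\<^sup>2)"
  unfolding hat_le_def
proof (rule bexI[OF _ fin_scale[OF X_square_fin, of "1 / x\<^sup>2"]], intro conjI ballI)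
  fix \<omega>
  show "indicator {\<omega> \<in> space M. x \<le> \<bar>X (Suc j) \<omega>\<bar>} \<omega> \<le> 1 / x\<^sup>2 * (X (Suc j) \<omega>)\<^sup>2"
  proof (cases "x \<le> \<bar>X (Suc j) \<omega>\<bar>")
    case True
    then have "x\<^sup>2 \<le> (X (Suc j) \<omega>)\<^sup>2" using assms by (simp add: abs_le_square_iff[symmetric])
    then show ?thesis using assms by (simp add: indicator_def)
  qed (simp add: indicator_def)
next
  show "e (\<lambda>\<omega>. 1 / x\<^sup>2 * (X (Suc j) \<omega>)\<^sup>2) \<le> v j / x\<^sup>2"
    using e_scale[OF X_square_fin, of "1 / x\<^sup>2" j] by (simp add: v_def)
qed

end

context lil_setting
begin

text \<open>The set is nonempty because \<open>u 0 = 0\<close> and finite because \<open>u\<close>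
  tends to infinity, so \<open>Max\<close> is meaningful.\<close>

definition block_end :: "real \<Rightarrow> nat \<Rightarrow> nat" where "block_end \<Theta> k = Max {n. u n < \<Theta> ^ Suc k}"

lemma finite_u_less: "finite {n. u n < x}"
proof -
  obtain N where "\<And>n. N \<le> n \<Longrightarrow> x \<le> u n"
    using eventually_u_ge[of x] unfolding eventually_sequentially by blast
  then have "{n. u n < x} \<subseteq> {..<N}" by (force simp: not_le[symmetric])
  then show ?thesis by (rule finite_subset) simp
qed

lemma block_end_props:
  assumes "1 < \<Theta>"
  shows u_block_end_less: "u (block_end \<Theta> k) < \<Theta> ^ Suc k" and block_end_less_imp: "block_end \<Theta> k < n \<Longrightarrow> \<Theta> ^ Suc k \<le> u n"
    and le_block_end_iff: "n \<le> block_end \<Theta> k \<longleftrightarrow> u n < \<Theta> ^ Suc k"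
proof -
  have "0 \<in> {n. u n < \<Theta> ^ Suc k}" using assms by (simp add: u_def)
  then have "block_end \<Theta> k \<in> {n. u n < \<Theta> ^ Suc k}"
    unfolding block_end_def using finite_u_less by (intro Max_in) auto
  then show 1: "u (block_end \<Theta> k) < \<Theta> ^ Suc k" by simp
  show 2: "\<Theta> ^ Suc k \<le> u n" if "block_end \<Theta> k < n" for n
  proof (rule ccontr)
    assume "\<not> \<Theta> ^ Suc k \<le> u n"
    then have "n \<le> block_end \<Theta> k" unfolding block_end_def by (intro Max_ge finite_u_less) auto
    then show False using that by simp
  qed
  show "n \<le> block_end \<Theta> k \<longleftrightarrow> u n < \<Theta> ^ Suc k"
    using 1 2[of n] u_mono[of n "block_end \<Theta> k"] by (meson le_less_trans not_le)
qed

lemma block_end_mono: "1 < \<Theta> \<Longrightarrow> k \<le> l \<Longrightarrow> block_end \<Theta> k \<le> block_end \<Theta> l"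
proof -
  assume \<Theta>: "1 < \<Theta>" and "k \<le> l"
  then have "\<Theta> ^ Suc k \<le> \<Theta> ^ Suc l" by (intro power_increasing) auto
  with u_block_end_less[OF \<Theta>, of k] have "u (block_end \<Theta> k) < \<Theta> ^ Suc l" by (rule less_le_trans)
  then show ?thesis by (simp only: le_block_end_iff[OF \<Theta>])
qed

lemma block_end_top: "1 < \<Theta> \<Longrightarrow> filterlim (block_end \<Theta>) at_top sequentially"
  unfolding filterlim_at_top eventually_sequentially
proof
  fix Z assume \<Theta>: "1 < \<Theta>"
  obtain K where K: "u Z < \<Theta> ^ K" using real_arch_pow[OF \<Theta>] by blast
  have "Z \<le> block_end \<Theta> n" if "K \<le> n" for n
    using K power_increasing[of K "Suc n" \<Theta>] that \<Theta> by (subst le_block_end_iff[OF \<Theta>]) auto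
  then show "\<exists>N. \<forall>n\<ge>N. Z \<le> block_end \<Theta> n" by blast
qed

text \<open>One large variance may jump over a whole interval from \<open>\<Theta> ^ k\<close> to
  \<open>\<Theta> ^ Suc k\<close>; the block end then belongs to an earlier block and would be
  counted again.\<close>

definition nonempty_block :: "real \<Rightarrow> nat \<Rightarrow> bool" where "nonempty_block \<Theta> k \<longleftrightarrow> \<Theta> ^ k \<le> u (block_end \<Theta> k)"

lemma eventually_block_end: "1 < \<Theta> \<Longrightarrow> \<forall>\<^sub>F n in sequentially. P n \<Longrightarrow> \<forall>\<^sub>F k in sequentially. P (block_end \<Theta> k)"
  using block_end_top unfolding filterlim_iff by blast

text \<open>The least \<open>k\<close> with \<open>m\<close> at most the block end: minimality
  bounds \<open>u m\<close> from below, and a variance ratio below \<Theta> bounds the ratio of the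
  normalisers.\<close>

lemma block_exists:
  assumes "1 < \<Theta>" "block_end \<Theta> k1 < m"
  obtains k where "k1 < k" "m \<le> block_end \<Theta> k" "\<Theta> ^ k \<le> u m" "nonempty_block \<Theta> k" "a (block_end \<Theta> k) \<le> \<Theta> * a m"
proof -
  define k where "k = (LEAST k. m \<le> block_end \<Theta> k)"
  obtain l where "m \<le> block_end \<Theta> l"
    using block_end_top[OF assms(1)] unfolding filterlim_at_top eventually_sequentially by blast
  then have k: "m \<le> block_end \<Theta> k" unfolding k_def by (rule LeastI)
  have k1: "k1 < k"
  proof (rule ccontr)
    assume "\<not> k1 < k"
    then have "block_end \<Theta> k \<le> block_end \<Theta> k1" using assms(1) by (intro block_end_mono) auto
    then show False using k assms(2) by simp
  qed
  then obtain k' where k': "k = Suc k'" by (cases k) auto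
  have "\<not> m \<le> block_end \<Theta> k'" using not_less_Least[of k' "\<lambda>k. m \<le> block_end \<Theta> k"] k' k_def by auto
  then have um: "\<Theta> ^ k \<le> u m" using block_end_less_imp[OF assms(1), of k' m] k' by simp
  have nonempty_block: "nonempty_block \<Theta> k" unfolding nonempty_block_def using um u_mono[OF k] by linarith
  have \<Theta>0: "0 < \<Theta> ^ k" using assms(1) by simp
  have "a (block_end \<Theta> k) \<le> u (block_end \<Theta> k) / u m * a m"
    unfolding a_normaliser using um \<Theta>0 u_mono[OF k] by (intro normaliser_ratio) auto
  also have "\<dots> \<le> \<Theta> * a m"
  proof (rule mult_right_mono[OF _ a_nonneg])
    have "u (block_end \<Theta> k) \<le> \<Theta> * \<Theta> ^ k" using u_block_end_less[OF assms(1), of k] by simp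
    also have "\<dots> \<le> \<Theta> * u m" using um assms(1) by (intro mult_left_mono) auto
    finally show "u (block_end \<Theta> k) / u m \<le> \<Theta>" using um \<Theta>0 by (simp add: field_simps)
  qed
  finally show ?thesis using that k k1 um nonempty_block by blast
qed

end

text \<open>\<open>exceed\<close> speaks of \<open>hat_le\<close> because covers are measured by
  dominating variables; the passage from \<open>V\<close> is made once, when the hypotheses are
  unpacked.\<close>

locale lil_full = lil_truncation +
  assumes sum_b: "summable (\<lambda>n. raw (Suc n) n / a (Suc n) powr p * b (Suc n) powr d)"
    and exceed: "0 < \<epsilon> \<Longrightarrow> \<exists>r. summable r \<and>
      (\<forall>j. hat_le {\<omega> \<in> space M. \<epsilon> * a (Suc j) \<le> \<bar>X (Suc j) \<omega>\<bar>} (r j))"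
begin

text \<open>\<open>c\<close> is proportional to \<open>s / t\<close>, whose square
  \<open>u / (2 * \<tau>)\<close> is nondecreasing since \<open>LL x / x\<close> is
  nonincreasing.\<close>

lemma c_mono: "m \<le> n \<Longrightarrow> c m \<le> c n"
proof -
  assume mn: "m \<le> n"
  show ?thesis
  proof (cases "0 < u m")
    case True
    have n: "0 < u n" using True u_mono[OF mn] by linarith
    have "u m * \<tau> n \<le> u n * \<tau> m" unfolding \<tau>_def using True u_mono[OF mn] by (rule LL_ratio)
    moreover have "(s i * t j)\<^sup>2 = u i * (2 * \<tau> j)" for i j
    proof -
      have "(s i * t j)\<^sup>2 = (s i * s i) * (t j * t j)" by (simp add: power2_eq_square)
      then show ?thesis unfolding s_square t_square .
    qed
    ultimately have "(s m * t n)\<^sup>2 \<le> (s n * t m)\<^sup>2" by simp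
    then have "s m * t n \<le> s n * t m" by (rule power2_le_imp_le) (simp add: s_nonneg less_imp_le[OF t_pos])
    then have "s m / t m \<le> s n / t n" using t_pos[of m] t_pos[of n] by (simp add: field_simps)
    then show ?thesis using \<alpha>_pos mult_left_mono[of "s m / t m" "s n / t n" \<alpha>] by (simp add: c_def)
  next
    case False
    then have "u m = 0" using u_nonneg[of m] by linarith
    then show ?thesis using \<alpha>_pos s_nonneg[of n] t_pos[of n] by (simp add: c_def s_def)
  qed
qed

text \<open>A larger \<open>n\<close> raises the truncation level and so lowers every earlier
  moment; only the new index adds to the sum.\<close>

lemma Lam_step: "Lam (Suc n) \<le> Lam n + raw (Suc n) n"
proof -
  have "raw (Suc n) j \<le> raw n j" if "j < n" for j
    unfolding raw_def
  proof (rule e_mono[OF raw_fin' raw_fin'])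
    fix \<omega>
    show "max (\<bar>X (Suc j) \<omega>\<bar> - c (Suc n)) 0 powr p \<le> max (\<bar>X (Suc j) \<omega>\<bar> - c n) 0 powr p"
      using c_mono[of n "Suc n"] p_ge_2 by (intro powr_mono2) auto
  qed (use that in auto)
  then have "(\<Sum>j<n. raw (Suc n) j) \<le> Lam n" unfolding Lam_def by (intro sum_mono) auto
  then show ?thesis by (simp add: Lam_def)
qed

abbreviation "DD \<equiv> d + 1"

definition lam_increment :: "nat \<Rightarrow> real" where "lam_increment n = raw (Suc n) n / a (Suc n) powr p * b (Suc n) powr d"

lemma lam_increment_nonneg: "0 \<le> lam_increment n"
  unfolding lam_increment_def by (intro mult_nonneg_nonneg divide_nonneg_nonneg raw_nonneg) auto

text \<open>Discrete chain rule: the increment is at most \<open>DD * Lam powr d\<close> times the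
  new moment, and that is the summand of the hypothesis rescaled by
  \<open>a powr (p * DD)\<close>.\<close>

lemma Lam_power_step:
  assumes "0 < u (Suc n)"
  shows "Lam (Suc n) powr DD \<le> Lam n powr DD + DD * (a (Suc n) powr (p * DD) * lam_increment n)"
proof -
  have a: "0 < a (Suc n)" by (rule a_pos[OF assms])
  have Lb: "Lam (Suc n) = b (Suc n) * a (Suc n) powr p" using a by (simp add: b_def)
  have eq: "Lam (Suc n) powr d * raw (Suc n) n = a (Suc n) powr (p * DD) * lam_increment n"
  proof -
    have "Lam (Suc n) powr d = b (Suc n) powr d * a (Suc n) powr (p * d)"
      unfolding Lb using b_nonneg a by (simp add: powr_mult powr_powr)
    moreover have "a (Suc n) powr (p * DD) = a (Suc n) powr (p * d) * a (Suc n) powr p"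
      by (simp add: powr_add[symmetric] algebra_simps)
    ultimately show ?thesis using a by (simp add: lam_increment_def)
  qed
  show ?thesis
  proof (cases "Lam (Suc n) \<le> Lam n")
    case True
    then have "Lam (Suc n) powr DD \<le> Lam n powr DD" using Lam_nonneg d_nonneg by (intro powr_mono2) auto
    moreover have "0 \<le> DD * (a (Suc n) powr (p * DD) * lam_increment n)" using d_nonneg lam_increment_nonneg by simp
    ultimately show ?thesis by linarith
  next
    case False
    have "Lam (Suc n) powr DD - Lam n powr DD \<le> DD * Lam (Suc n) powr (DD - 1) * (Lam (Suc n) - Lam n)"
      using False Lam_nonneg d_nonneg by (intro powr_diff_le) auto
    also have "\<dots> \<le> DD * Lam (Suc n) powr (DD - 1) * raw (Suc n) n"
      using Lam_step[of n] d_nonneg by (intro mult_left_mono) auto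
    finally show ?thesis using eq by (simp add: mult.assoc)
  qed
qed

lemma Lam_power_sum:
  assumes "m \<le> n" "0 < u (Suc m)"
  shows "Lam n powr DD \<le> Lam m powr DD + DD * (a n powr (p * DD) * (\<Sum>i\<in>{m..<n}. lam_increment i))"
proof -
  have "Lam n powr DD \<le> Lam m powr DD + (\<Sum>i\<in>{m..<n}. DD * (a (Suc i) powr (p * DD) * lam_increment i))"
    using assms(1)
  proof (induction n rule: dec_induct)
    case (step k)
    have "0 < u (Suc k)" using assms(2) u_mono[of "Suc m" "Suc k"] step by simp
    from Lam_power_step[OF this] step show ?case by simp
  qed simp
  also have "(\<Sum>i\<in>{m..<n}. DD * (a (Suc i) powr (p * DD) * lam_increment i)) \<le> (\<Sum>i\<in>{m..<n}. DD * (a n powr (p * DD) * lam_increment i))"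
    using d_nonneg p_ge_2
    by (intro sum_mono mult_left_mono mult_right_mono powr_mono2 a_mono) (auto simp: lam_increment_nonneg a_nonneg)
  also have "\<dots> = DD * (a n powr (p * DD) * (\<Sum>i\<in>{m..<n}. lam_increment i))" by (simp add: sum_distrib_left)
  finally show ?thesis by simp
qed

text \<open>After division by a power of the normaliser the values of \<open>Lam powr DD\<close> at
  block ends obey a contraction with summable perturbation: the normaliser grows by at least
  \<open>sqrt \<Theta>\<close> per block, and the increments are those of the given convergent
  series.\<close>

lemma summable_b_blocks:
  assumes \<Theta>: "1 < \<Theta>"
  shows "summable (\<lambda>k. if nonempty_block \<Theta> k then b (block_end \<Theta> k) powr DD else 0)"
proof -
  let ?N = "block_end \<Theta>"
  define q where "q = p * DD"
  have q: "0 < q" using p_ge_2 d_nonneg by (simp add: q_def)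
  \<comment> \<open>Used instead of \<open>a\<close> at the block end so that the recursion runs
    through empty blocks too; the two are compared at the end, on nonempty blocks.\<close>
  define g where "g k = normaliser (\<Theta> ^ k)" for k :: nat
  have g: "0 < g k" for k unfolding g_def using \<Theta> by (intro normaliser_pos) simp
  define Z where "Z k = Lam (?N k) powr DD / g k powr q" for k
  define r where "r = sqrt (1 / \<Theta>) powr q"
  define y where "y k = DD * \<Theta> powr q * (\<Sum>i\<in>{?N k..<?N (Suc k)}. lam_increment i)" for k
  have r: "0 \<le> r" "r < 1"
  proof -
    have "sqrt (1 / \<Theta>) < 1" using \<Theta> by (simp add: real_sqrt_lt_1_iff)
    then show "r < 1" unfolding r_def using q \<Theta> powr_less_mono2[of q "sqrt (1 / \<Theta>)" 1] by simp
  qed (simp add: r_def)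
  have step: "Z (Suc k) \<le> r * Z k + y k" for k
  proof -
    have u1: "0 < u (Suc (?N k))" using block_end_less_imp[OF \<Theta>, of k "Suc (?N k)"] \<Theta>
      by (meson lessI less_le_trans zero_less_one less_trans zero_less_power)
    have aN: "a (?N (Suc k)) \<le> \<Theta> * g (Suc k)"
    proof -
      have "a (?N (Suc k)) \<le> normaliser (\<Theta> ^ Suc (Suc k))"
        unfolding a_normaliser using u_block_end_less[OF \<Theta>, of "Suc k"] u_nonneg by (intro normaliser_mono) auto
      also have "\<dots> \<le> \<Theta> ^ Suc (Suc k) / \<Theta> ^ Suc k * normaliser (\<Theta> ^ Suc k)"
        using \<Theta> by (intro normaliser_ratio power_increasing) auto
      also have "\<dots> = \<Theta> * g (Suc k)" using \<Theta> by (simp add: g_def)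
      finally show ?thesis .
    qed
    have "Lam (?N (Suc k)) powr DD \<le> Lam (?N k) powr DD + DD * (a (?N (Suc k)) powr q * (\<Sum>i\<in>{?N k..<?N (Suc k)}. lam_increment i))"
      unfolding q_def by (rule Lam_power_sum[OF block_end_mono[OF \<Theta>] u1]) simp
    also have "\<dots> \<le> Lam (?N k) powr DD + DD * ((\<Theta> * g (Suc k)) powr q * (\<Sum>i\<in>{?N k..<?N (Suc k)}. lam_increment i))"
      using aN a_nonneg q d_nonneg
      by (intro add_left_mono mult_left_mono mult_right_mono powr_mono2 sum_nonneg) (auto simp: lam_increment_nonneg)
    also have "(\<Theta> * g (Suc k)) powr q = \<Theta> powr q * g (Suc k) powr q"
      by (rule powr_mult)
    finally have "Lam (?N (Suc k)) powr DD \<le> Z k * g k powr q + y k * g (Suc k) powr q"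
      using g[of k] by (simp add: Z_def y_def mult_ac)
    also have "Z k * g k powr q \<le> Z k * (r * g (Suc k) powr q)"
    proof (rule mult_left_mono)
      have "g k \<le> sqrt (\<Theta> ^ k / \<Theta> ^ Suc k) * g (Suc k)"
        unfolding g_def using \<Theta> by (intro normaliser_ratio' power_increasing) auto
      also have "\<Theta> ^ k / \<Theta> ^ Suc k = 1 / \<Theta>" using \<Theta> by simp
      finally have "g k powr q \<le> (sqrt (1 / \<Theta>) * g (Suc k)) powr q"
        using g[of k] q by (intro powr_mono2) auto
      also have "\<dots> = r * g (Suc k) powr q" unfolding r_def by (rule powr_mult)
      finally show "g k powr q \<le> r * g (Suc k) powr q" .
      show "0 \<le> Z k" by (simp add: Z_def)
    qed
    finally have "Lam (?N (Suc k)) powr DD \<le> (r * Z k + y k) * g (Suc k) powr q" by (simp add: algebra_simps)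
    then show ?thesis unfolding Z_def[of "Suc k"] using g[of "Suc k"] by (simp add: divide_le_eq)
  qed
  have y0: "0 \<le> y k" for k unfolding y_def by (intro mult_nonneg_nonneg sum_nonneg lam_increment_nonneg) (use d_nonneg in simp_all)
  have "summable y"
  proof (rule bounded_imp_summable[OF y0])
    fix n
    have "(\<Sum>k\<le>n. \<Sum>i\<in>{?N k..<?N (Suc k)}. lam_increment i) = (\<Sum>i\<in>{?N 0..<?N (Suc n)}. lam_increment i)"
    proof (induction n)
      case (Suc n)
      have "?N 0 \<le> ?N (Suc n)" "?N (Suc n) \<le> ?N (Suc (Suc n))" by (intro block_end_mono \<Theta>; simp)+
      then show ?case using Suc sum.atLeastLessThan_concat[of "?N 0" "?N (Suc n)" "?N (Suc (Suc n))" lam_increment] by simp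
    qed simp
    also have "\<dots> \<le> suminf lam_increment"
      using sum_b unfolding lam_increment_def[symmetric] by (intro sum_le_suminf) (auto simp: lam_increment_nonneg)
    finally have "(\<Sum>k\<le>n. \<Sum>i\<in>{?N k..<?N (Suc k)}. lam_increment i) \<le> suminf lam_increment" .
    then have "DD * \<Theta> powr q * (\<Sum>k\<le>n. \<Sum>i\<in>{?N k..<?N (Suc k)}. lam_increment i) \<le> DD * \<Theta> powr q * suminf lam_increment"
      using d_nonneg by (intro mult_left_mono) auto
    then show "(\<Sum>k\<le>n. y k) \<le> DD * \<Theta> powr q * suminf lam_increment" unfolding y_def by (simp add: sum_distrib_left)
  qed
  then have Zs: "summable Z"
    using step r y0 by (intro summable_contraction[of Z y r]) (auto simp: Z_def)
  show ?thesis
  proof (rule summable_comparison_test'[OF Zs, of 0])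
    fix k
    show "norm (if nonempty_block \<Theta> k then b (?N k) powr DD else 0) \<le> Z k"
    proof (cases "nonempty_block \<Theta> k")
      case True
      have \<Theta>k: "0 < \<Theta> ^ k" using \<Theta> by simp
      then have uN: "0 < u (?N k)" using True unfolding nonempty_block_def by linarith
      have "g k \<le> a (?N k)" unfolding g_def a_normaliser using True \<Theta>k by (intro normaliser_mono) (auto simp: nonempty_block_def)
      then have "g k powr q \<le> a (?N k) powr q" using g[of k] q by (intro powr_mono2) auto
      moreover have "b (?N k) powr DD = Lam (?N k) powr DD / a (?N k) powr q"
        unfolding b_def q_def using Lam_nonneg by (simp add: powr_divide powr_powr)
      moreover have "Lam (?N k) powr DD / a (?N k) powr q \<le> Lam (?N k) powr DD / g k powr q"
        using calculation(1) g[of k] by (intro divide_left_mono mult_pos_pos) auto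
      ultimately show ?thesis using True by (simp add: Z_def)
    qed (simp add: Z_def)
  qed
qed

text \<open>At the end of a nonempty block \<open>exp \<tau>\<close> is at least
  \<open>k * ln \<Theta>\<close>, so a convergent power series in \<open>k\<close>
  dominates.\<close>

lemma summable_exp_\<tau>:
  assumes \<Theta>: "1 < \<Theta>" and "1 < q"
  shows "summable (\<lambda>k. if nonempty_block \<Theta> k then exp (- q * \<tau> (block_end \<Theta> k)) else 0)"
proof (rule summable_comparison_test')
  have "summable (\<lambda>k::nat. real k powr (- q))" using assms(2) by (simp add: summable_real_powr_iff)
  then show "summable (\<lambda>k. ln \<Theta> powr (- q) * real k powr (- q))" by (rule summable_mult)
  fix k :: nat assume k: "1 \<le> k"
  show "norm (if nonempty_block \<Theta> k then exp (- q * \<tau> (block_end \<Theta> k)) else 0) \<le> ln \<Theta> powr (- q) * real k powr (- q)"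
  proof (cases "nonempty_block \<Theta> k")
    case True
    have "real k * ln \<Theta> \<le> Log (\<Theta> ^ k)" using \<Theta> by (intro Log_power_ge) simp
    also have "\<dots> \<le> Log (u (block_end \<Theta> k))" using True by (intro Log_mono) (simp add: nonempty_block_def)
    also have "\<dots> \<le> exp (\<tau> (block_end \<Theta> k))" unfolding \<tau>_def by (rule Log_le_exp_LL)
    finally have le: "real k * ln \<Theta> \<le> exp (\<tau> (block_end \<Theta> k))" .
    have "exp (- q * \<tau> (block_end \<Theta> k)) = exp (\<tau> (block_end \<Theta> k)) powr (- q)" by (simp add: powr_def)
    also have "\<dots> \<le> (real k * ln \<Theta>) powr (- q)"
      using le k \<Theta> assms(2) by (intro powr_mono2') auto
    also have "\<dots> = ln \<Theta> powr (- q) * real k powr (- q)" using \<Theta> by (subst powr_mult) auto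
    finally show ?thesis using True by simp
  qed simp
qed

lemma eventually_b_less_1:
  assumes \<Theta>: "1 < \<Theta>"
  shows "\<forall>\<^sub>F k in sequentially. nonempty_block \<Theta> k \<longrightarrow> b (block_end \<Theta> k) < 1"
proof -
  have "\<forall>\<^sub>F k in sequentially. (if nonempty_block \<Theta> k then b (block_end \<Theta> k) powr DD else 0) < 1"
    using order_tendstoD(2)[OF summable_LIMSEQ_zero[OF summable_b_blocks[OF \<Theta>]], of 1] by simp
  then show ?thesis
  proof eventually_elim
    case (elim k)
    show ?case
    proof
      assume "nonempty_block \<Theta> k"
      then have "b (block_end \<Theta> k) powr DD < 1" using elim by simp
      then show "b (block_end \<Theta> k) < 1" using d_nonneg ge_one_powr_ge_zero[of "b (block_end \<Theta> k)" DD] by fastforce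
    qed
  qed
qed

text \<open>\<open>exceed\<close> compares each variable with its own \<open>a (Suc j)\<close>,
  while truncation needs one threshold \<open>y * a n\<close> for all \<open>j < n\<close>. Late
  variables inherit it by monotonicity of \<open>a\<close>; the finitely many early ones are handled
  by Chebyshev once \<open>a n\<close> is large.\<close>

lemma small_exceedance:
  assumes "0 < y" "0 < \<eta>"
  shows "\<exists>N0 J. small_cover \<eta> J \<and> (\<forall>n\<ge>N0. \<forall>j<n. \<exists>i. {\<omega> \<in> space M. y * a n \<le> \<bar>X (Suc j) \<omega>\<bar>} \<subseteq> J i)"
proof -
  obtain r where r: "summable r" "\<And>j. hat_le {\<omega> \<in> space M. y * a (Suc j) \<le> \<bar>X (Suc j) \<omega>\<bar>} (r j)"
    using exceed[OF assms(1)] by blast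
  have "\<forall>\<^sub>F k1 in sequentially. small_cover (\<eta> / 2) (\<lambda>j. if k1 \<le> j then {\<omega> \<in> space M. y * a (Suc j) \<le> \<bar>X (Suc j) \<omega>\<bar>} else {})"
    by (rule small_cover_tail[OF _ r(1)]) (use r(2) assms in auto)
  then obtain j1 where j1: "small_cover (\<eta> / 2) (\<lambda>j. if j1 \<le> j then {\<omega> \<in> space M. y * a (Suc j) \<le> \<bar>X (Suc j) \<omega>\<bar>} else {})"
    unfolding eventually_sequentially by blast
  \<comment> \<open>Chosen so that the Chebyshev bounds of the first \<open>j1\<close> variables sum
    to at most \<open>\<eta> / 2\<close>; the summand 1 makes \<open>u N1\<close> positive.\<close>
  obtain N1 where N1: "1 + 2 * u j1 / (\<eta> * y\<^sup>2) \<le> u N1"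
    using eventually_u_ge[of "1 + 2 * u j1 / (\<eta> * y\<^sup>2)"] unfolding eventually_sequentially by blast
  have q0: "0 \<le> 2 * u j1 / (\<eta> * y\<^sup>2)" using assms u_nonneg by simp
  have uN1: "0 < u N1" using N1 q0 by linarith
  have aN1: "0 < a N1" by (rule a_pos[OF uN1])
  have SC2: "small_cover (\<eta> / 2) (\<lambda>j. if j < j1 then {\<omega> \<in> space M. y * a N1 \<le> \<bar>X (Suc j) \<omega>\<bar>} else {})"
  proof (rule small_cover_I[where r = "\<lambda>j. if j < j1 then v j / (y * a N1)\<^sup>2 else 0"])
    show "(if j < j1 then {\<omega> \<in> space M. y * a N1 \<le> \<bar>X (Suc j) \<omega>\<bar>} else {}) \<in> sets M" for j by simp
    show "hat_le (if j < j1 then {\<omega> \<in> space M. y * a N1 \<le> \<bar>X (Suc j) \<omega>\<bar>} else {})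
        (if j < j1 then v j / (y * a N1)\<^sup>2 else 0)" for j
      using hat_le_chebyshev[of "y * a N1" j] assms aN1 hat_le_empty by simp
    show "(\<Sum>j<I. if j < j1 then v j / (y * a N1)\<^sup>2 else 0) \<le> \<eta> / 2" for I
    proof -
      have "(\<Sum>j<I. if j < j1 then v j / (y * a N1)\<^sup>2 else 0) \<le> (\<Sum>j<I + j1. if j < j1 then v j / (y * a N1)\<^sup>2 else 0)"
        by (intro sum_mono2) (auto simp: v_nonneg)
      also have "\<dots> = (\<Sum>j<j1. v j / (y * a N1)\<^sup>2)" by (intro sum.mono_neutral_cong_right) auto
      also have "\<dots> = u j1 / (y\<^sup>2 * (2 * u N1 * \<tau> N1))"
        by (simp add: u_def sum_divide_distrib power_mult_distrib a_square)
      finally have le: "(\<Sum>j<I. if j < j1 then v j / (y * a N1)\<^sup>2 else 0) \<le> u j1 / (y\<^sup>2 * (2 * u N1 * \<tau> N1))" .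
      have "2 * u j1 / (\<eta> * y\<^sup>2) \<le> u N1" using N1 by linarith
      also have "u N1 \<le> 2 * u N1 * \<tau> N1" using uN1 \<tau>_ge_1[of N1] by simp
      finally have "2 * u j1 \<le> \<eta> * (y\<^sup>2 * (2 * u N1 * \<tau> N1))" using assms by (simp add: field_simps)
      moreover have "0 < y\<^sup>2 * (2 * u N1 * \<tau> N1)" using assms uN1 \<tau>_ge_1[of N1] by simp
      ultimately have "u j1 / (y\<^sup>2 * (2 * u N1 * \<tau> N1)) \<le> \<eta> / 2" by (subst pos_divide_le_eq) linarith+
      with le show ?thesis by linarith
    qed
  qed
  let ?J = "\<lambda>j. (if j1 \<le> j then {\<omega> \<in> space M. y * a (Suc j) \<le> \<bar>X (Suc j) \<omega>\<bar>} else {}) \<union>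
    (if j < j1 then {\<omega> \<in> space M. y * a N1 \<le> \<bar>X (Suc j) \<omega>\<bar>} else {})"
  have "small_cover \<eta> ?J" using small_cover_Un[OF j1 SC2] by simp
  moreover have "{\<omega> \<in> space M. y * a n \<le> \<bar>X (Suc j) \<omega>\<bar>} \<subseteq> ?J j" if "N1 \<le> n" "j < n" for n j
  proof -
    have "y * a (Suc j) \<le> y * a n" "y * a N1 \<le> y * a n"
      using that assms by (auto intro!: mult_left_mono a_mono)
    then show ?thesis by (auto split: if_splits)
  qed
  ultimately show ?thesis by blast
qed

end

section \<open>Upper half and divergence of the block series\<close>

text \<open>Allows every other block to be skipped without losing divergence.\<close>

lemma not_summable_parity:
  fixes g :: "nat \<Rightarrow> real"
  assumes "\<not> summable g" "\<And>k. 0 \<le> g k"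
  shows "\<exists>c\<in>{0, 1}. \<not> summable (\<lambda>i. g (2 * i + c))"
proof (rule ccontr)
  assume "\<not> ?thesis"
  then have s: "summable (\<lambda>i. g (2 * i))" "summable (\<lambda>i. g (2 * i + 1))" by auto
  have "summable g"
  proof (rule bounded_imp_summable[OF assms(2)])
    fix n
    have split: "(\<Sum>k<2 * n. g k) = (\<Sum>i<n. g (2 * i)) + (\<Sum>i<n. g (2 * i + 1))" for n
      by (induction n) auto
    have "(\<Sum>k\<le>n. g k) \<le> (\<Sum>k<2 * Suc n. g k)" using assms(2) by (intro sum_mono2) auto
    also have "\<dots> \<le> (\<Sum>i. g (2 * i)) + (\<Sum>i. g (2 * i + 1))"
      unfolding split using s assms(2) by (intro add_mono sum_le_suminf) auto
    finally show "(\<Sum>k\<le>n. g k) \<le> (\<Sum>i. g (2 * i)) + (\<Sum>i. g (2 * i + 1))" .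
  qed
  then show False using assms(1) by blast
qed

lemma prod_one_minus_le_exp:
  fixes w :: "nat \<Rightarrow> real"
  assumes "\<And>i. i < I \<Longrightarrow> w i \<le> 1"
  shows "(\<Prod>i<I. 1 - w i) \<le> exp (- (\<Sum>i<I. w i))"
proof -
  have "(\<Prod>i<I. 1 - w i) \<le> (\<Prod>i<I. exp (- w i))"
    using assms exp_ge_add_one_self[of "- w _"] by (intro prod_mono) auto
  then show ?thesis by (simp add: exp_sum sum_negf[symmetric])
qed

context sublinear_expectation_space
begin

lemma small_cover_finite_cover:
  assumes "small_cover \<eta> A"
  shows "\<exists>C\<in>sets M. (\<Union>i<(n::nat). A i) \<subseteq> C \<and> hat_le C \<eta>"
proof -
  have "small_cover \<eta> (\<lambda>_::nat. \<Union>i<n. A i)" by (rule small_cover_cover[OF assms]) blast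
  then obtain B r where B: "\<And>i. B i \<in> sets M" "\<And>i. hat_le (B i) (r i)" "\<And>I. (\<Sum>i<(I::nat). r i) \<le> \<eta>"
    "\<And>k::nat. \<exists>I. (\<Union>i<n. A i) \<subseteq> (\<Union>i<I. B i)" by (rule small_cover_E) blast
  obtain I where I: "(\<Union>i<n. A i) \<subseteq> (\<Union>i<(I::nat). B i)" using B(4) by blast
  have "hat_le (\<Union>i<I. B i) \<eta>"
    by (rule hat_le_mono[OF hat_le_UN[of B r I, OF B(2)] Int_lower1 B(3)])
  moreover have "(\<Union>i<I. B i) \<in> sets M" using B(1) by (intro sets.finite_UN) auto
  ultimately show ?thesis using I by blast
qed

end

context lil_full
begin

lemma small_exceedance_union:
  assumes "0 < y" "0 < \<eta>"
  shows "\<exists>N0 J. small_cover \<eta> J \<and> (\<forall>n\<ge>N0. \<exists>K. {\<omega> \<in> space M. \<exists>j<n. y * a n \<le> \<bar>X (Suc j) \<omega>\<bar>} \<subseteq> (\<Union>i<(K::nat). J i))"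
proof -
  obtain N0 J where J: "small_cover \<eta> J" and cov: "\<And>n j. N0 \<le> n \<Longrightarrow> j < n \<Longrightarrow> \<exists>i. {\<omega> \<in> space M. y * a n \<le> \<bar>X (Suc j) \<omega>\<bar>} \<subseteq> J i"
    using small_exceedance[OF assms] by blast
  have "\<exists>K. {\<omega> \<in> space M. \<exists>j<n. y * a n \<le> \<bar>X (Suc j) \<omega>\<bar>} \<subseteq> (\<Union>i<K. J i)" if "N0 \<le> n" for n
  proof -
    have "\<exists>i. {\<omega> \<in> space M. y * a n \<le> \<bar>X (Suc j) \<omega>\<bar>} \<subseteq> J i" if "j < n" for j
      using cov[OF \<open>N0 \<le> n\<close> that] .
    then obtain f where f: "\<And>j. j < n \<Longrightarrow> {\<omega> \<in> space M. y * a n \<le> \<bar>X (Suc j) \<omega>\<bar>} \<subseteq> J (f j)" by metis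
    have "{\<omega> \<in> space M. \<exists>j<n. y * a n \<le> \<bar>X (Suc j) \<omega>\<bar>} \<subseteq> (\<Union>i<Suc (\<Sum>j<n. f j). J i)"
    proof
      fix \<omega> assume "\<omega> \<in> {\<omega> \<in> space M. \<exists>j<n. y * a n \<le> \<bar>X (Suc j) \<omega>\<bar>}"
      then obtain j where j: "j < n" "\<omega> \<in> {\<omega> \<in> space M. y * a n \<le> \<bar>X (Suc j) \<omega>\<bar>}" by blast
      then have "\<omega> \<in> J (f j)" using f by blast
      moreover have "f j \<le> (\<Sum>j<n. f j)" using j by (intro member_le_sum) auto
      ultimately show "\<omega> \<in> (\<Union>i<Suc (\<Sum>j<n. f j). J i)" by (intro UN_I[of "f j"]) auto
    qed
    then show ?thesis by blast
  qed
  then show ?thesis using J by blast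
qed

text \<open>Each late \<open>m\<close> is moved to the end of its block at the cost of a factor
  \<Theta> in the normaliser. There either some variable exceeds \<open>y * a\<close>, or the
  truncated maximal event occurs, to which the good or the bad estimate applies.\<close>

lemma upper_small_cover:
  assumes \<epsilon>: "0 < \<epsilon>" "\<epsilon> \<le> 1" and al: "exp (2 * \<alpha>) \<le> 1 + \<epsilon> / 4" and \<eta>0: "0 < \<eta>0"
  shows "\<exists>n1. small_cover \<eta>0 (\<lambda>m. if n1 \<le> m then {\<omega> \<in> space M. (1 + \<epsilon>) * a m < S m \<omega>} else {})"
proof -
  \<comment> \<open>Close enough to 1 for
    \<open>(1 + \<epsilon> / 2) * \<Theta> \<le> 1 + \<epsilon>\<close>.\<close>
  define \<Theta> where "\<Theta> = 1 + \<epsilon> / 4"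
  have \<Theta>: "1 < \<Theta>" using \<epsilon> by (simp add: \<Theta>_def)
  have D1: "1 \<le> DD" using d_nonneg by simp
  \<comment> \<open>The two constraints of \<open>upper_bad\<close>, for the power \<open>DD\<close>
    that is summable over blocks.\<close>
  define \<eta> where "\<eta> = min (1 / (DD * \<alpha>)) (1 / (2 * DD * exp p))"
  have \<eta>: "0 < \<eta>" "DD * \<eta> * \<alpha> \<le> 1" "DD * \<eta> * exp p \<le> 1 / 2"
  proof -
    show "0 < \<eta>" using D1 \<alpha>_pos by (simp add: \<eta>_def)
    have "\<eta> \<le> 1 / (DD * \<alpha>)" "\<eta> \<le> 1 / (2 * DD * exp p)" by (simp_all add: \<eta>_def)
    moreover have "0 < DD * \<alpha>" "0 < 2 * DD * exp p" using D1 \<alpha>_pos by simp_all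
    ultimately have "\<eta> * (DD * \<alpha>) \<le> 1" "\<eta> * (2 * DD * exp p) \<le> 1"
      by (simp_all only: pos_le_divide_eq)
    moreover have "DD * \<eta> * \<alpha> = \<eta> * (DD * \<alpha>)" "DD * \<eta> * exp p = \<eta> * (2 * DD * exp p) / 2" by simp_all
    ultimately show "DD * \<eta> * \<alpha> \<le> 1" "DD * \<eta> * exp p \<le> 1 / 2" by linarith+
  qed
  \<comment> \<open>Small enough for the good estimate, and for truncation at \<open>y * a\<close>
    to imply the one at \<open>a / (2 * DD)\<close> in the bad estimate.\<close>
  define y where "y = min (\<eta> / 4) (1 / (2 * DD))"
  have y: "0 < y" "2 * y < \<eta>" "y \<le> 1 / (2 * DD)" using \<eta> D1 by (auto simp: y_def min_def)
  define C where "C = exp (1 + (4 * DD) powr p)"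
  define G where "G n = {\<omega> \<in> space M. (\<exists>m\<in>{1..n}. (1 + \<epsilon> / 2) * a n \<le> S m \<omega>) \<and> (\<forall>j<n. \<bar>X (Suc j) \<omega>\<bar> < y * a n)}" for n
  have G_sets: "G n \<in> sets M" for n unfolding G_def by measurable
  have trunc: "G n \<subseteq> {\<omega> \<in> space M. \<exists>m\<in>{1..n}. x \<le> (\<Sum>j<m. min (X (Suc j) \<omega>) (z * a n))}"
    if "x \<le> (1 + \<epsilon> / 2) * a n" "y \<le> z" for n x z
  proof
    fix \<omega> assume w: "\<omega> \<in> G n"
    then obtain m where m: "m \<in> {1..n}" "(1 + \<epsilon> / 2) * a n \<le> S m \<omega>" by (auto simp: G_def)
    have "min (X (Suc j) \<omega>) (z * a n) = X (Suc j) \<omega>" if "j < n" for j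
    proof -
      have "\<bar>X (Suc j) \<omega>\<bar> < y * a n" using w that by (simp add: G_def)
      also have "\<dots> \<le> z * a n" using \<open>y \<le> z\<close> a_nonneg by (rule mult_right_mono)
      finally show ?thesis by simp
    qed
    then have "(\<Sum>j<m. min (X (Suc j) \<omega>) (z * a n)) = S m \<omega>" unfolding S_def using m by (intro sum.cong) auto
    then show "\<omega> \<in> {\<omega> \<in> space M. \<exists>m\<in>{1..n}. x \<le> (\<Sum>j<m. min (X (Suc j) \<omega>) (z * a n))}"
      using w m that(1) by (auto simp: G_def intro!: bexI[of _ m])
  qed
  \<comment> \<open>The sum of both bounds, so that one summable majorant serves in either
    case.\<close>
  define r where "r k = (if nonempty_block \<Theta> k then exp (- (1 + \<epsilon> / 2 / 2) * \<tau> (block_end \<Theta> k)) else 0) + C * (if nonempty_block \<Theta> k then b (block_end \<Theta> k) powr DD else 0)" for k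
  have r_summable: "summable r"
    unfolding r_def by (intro summable_add summable_mult summable_exp_\<tau> summable_b_blocks \<Theta>) (use \<epsilon> in simp)
  define A where "A k = (if nonempty_block \<Theta> k then G (block_end \<Theta> k) else {})" for k
  have e2: "0 < \<epsilon> / 2" "exp (2 * \<alpha>) \<le> 1 + \<epsilon> / 2 / 2" using \<epsilon> al by auto
  have ev: "\<forall>\<^sub>F k in sequentially. A k \<in> sets M \<and> hat_le (A k) (r k)"
    using eventually_block_end[OF \<Theta> upper_good[OF e2 y(1,2)]] eventually_block_end[OF \<Theta> upper_bad[OF D1 \<eta>]]
      eventually_b_less_1[OF \<Theta>]
  proof eventually_elim
    case (elim k)
    show ?case
    proof (cases "nonempty_block \<Theta> k")
      case True
      have "hat_le (G (block_end \<Theta> k)) (r k)"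
      proof (cases "b (block_end \<Theta> k) \<le> exp (- \<eta> * \<tau> (block_end \<Theta> k))")
        case good: True
        have "hat_le {\<omega> \<in> space M. \<exists>m\<in>{1..block_end \<Theta> k}. (1 + \<epsilon> / 2) * a (block_end \<Theta> k) \<le> (\<Sum>j<m. min (X (Suc j) \<omega>) (y * a (block_end \<Theta> k)))}
            (exp (- (1 + \<epsilon> / 2 / 2) * \<tau> (block_end \<Theta> k)))" using elim(1) good by blast
        then show ?thesis
        proof (rule hat_le_mono)
          show "G (block_end \<Theta> k) \<inter> space M \<subseteq> {\<omega> \<in> space M. \<exists>m\<in>{1..block_end \<Theta> k}. (1 + \<epsilon> / 2) * a (block_end \<Theta> k) \<le> (\<Sum>j<m. min (X (Suc j) \<omega>) (y * a (block_end \<Theta> k)))}"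
            by (rule order_trans[OF Int_lower1 trunc]) auto
          show "exp (- (1 + \<epsilon> / 2 / 2) * \<tau> (block_end \<Theta> k)) \<le> r k"
            using True by (simp add: r_def C_def)
        qed
      next
        case False
        have "hat_le {\<omega> \<in> space M. \<exists>m\<in>{1..block_end \<Theta> k}. a (block_end \<Theta> k) \<le> (\<Sum>j<m. min (X (Suc j) \<omega>) (a (block_end \<Theta> k) / (2 * DD)))}
            (exp (1 + (4 * DD) powr p) * b (block_end \<Theta> k) powr DD)" using elim(2,3) False True by simp
        then show ?thesis
        proof (rule hat_le_mono)
          have "1 * a (block_end \<Theta> k) \<le> (1 + \<epsilon> / 2) * a (block_end \<Theta> k)" using \<epsilon> a_nonneg by (intro mult_right_mono) auto
          then have "G (block_end \<Theta> k) \<subseteq> {\<omega> \<in> space M. \<exists>m\<in>{1..block_end \<Theta> k}. a (block_end \<Theta> k) \<le> (\<Sum>j<m. min (X (Suc j) \<omega>) (1 / (2 * DD) * a (block_end \<Theta> k)))}"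
            using y by (intro trunc) auto
          then show "G (block_end \<Theta> k) \<inter> space M \<subseteq> {\<omega> \<in> space M. \<exists>m\<in>{1..block_end \<Theta> k}. a (block_end \<Theta> k) \<le> (\<Sum>j<m. min (X (Suc j) \<omega>) (a (block_end \<Theta> k) / (2 * DD)))}"
            by (simp add: le_infI1)
          show "exp (1 + (4 * DD) powr p) * b (block_end \<Theta> k) powr DD \<le> r k"
            using True by (simp add: r_def C_def)
        qed
      qed
      then show ?thesis using True G_sets by (simp add: A_def)
    next
      case False
      then show ?thesis using hat_le_empty by (simp add: A_def r_def)
    qed
  qed
  obtain k1 where k1: "small_cover (\<eta>0 / 2) (\<lambda>k. if k1 \<le> k then A k else {})"
    using small_cover_tail[OF ev r_summable, of "\<eta>0 / 2"] \<eta>0 unfolding eventually_sequentially by auto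
  obtain N0 J where J: "small_cover (\<eta>0 / 2) J" and
    Jc: "\<And>n. N0 \<le> n \<Longrightarrow> \<exists>K. {\<omega> \<in> space M. \<exists>j<n. y * a n \<le> \<bar>X (Suc j) \<omega>\<bar>} \<subseteq> (\<Union>i<(K::nat). J i)"
    using small_exceedance_union[OF y(1), of "\<eta>0 / 2"] \<eta>0 by auto
  obtain n2 where n2: "\<And>m. n2 \<le> m \<Longrightarrow> 0 < u m"
    using eventually_u_pos unfolding eventually_sequentially by blast
  let ?A = "\<lambda>k. if k1 \<le> k then A k else {}"
  have SCA: "small_cover \<eta>0 (\<lambda>k. ?A k \<union> J k)" using small_cover_Un[OF k1 J] by simp
  define n1 where "n1 = Suc (block_end \<Theta> k1) + N0 + n2"
  have "small_cover \<eta>0 (\<lambda>m. if n1 \<le> m then {\<omega> \<in> space M. (1 + \<epsilon>) * a m < S m \<omega>} else {})"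
  proof (rule small_cover_cover[OF SCA])
    fix m
    show "\<exists>I. (if n1 \<le> m then {\<omega> \<in> space M. (1 + \<epsilon>) * a m < S m \<omega>} else {}) \<subseteq> (\<Union>i<I. ?A i \<union> J i)"
    proof (cases "n1 \<le> m")
      case True
      then have m: "block_end \<Theta> k1 < m" "N0 \<le> m" "n2 \<le> m" by (auto simp: n1_def)
      obtain k where k: "k1 < k" "m \<le> block_end \<Theta> k" "nonempty_block \<Theta> k" "a (block_end \<Theta> k) \<le> \<Theta> * a m"
        using block_exists[OF \<Theta> m(1)] by blast
      have "N0 \<le> block_end \<Theta> k" using m k by linarith
      then obtain K where K: "{\<omega> \<in> space M. \<exists>j<block_end \<Theta> k. y * a (block_end \<Theta> k) \<le> \<bar>X (Suc j) \<omega>\<bar>} \<subseteq> (\<Union>i<K. J i)"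
        using Jc[OF \<open>N0 \<le> block_end \<Theta> k\<close>] by (elim exE)
      have am: "0 < a m" using n2[OF m(3)] a_pos by blast
      have "(1 + \<epsilon> / 2) * a (block_end \<Theta> k) \<le> (1 + \<epsilon> / 2) * (\<Theta> * a m)" using k \<epsilon> by (intro mult_left_mono) auto
      also have "\<dots> = ((1 + \<epsilon> / 2) * \<Theta>) * a m" by simp
      also have "\<dots> \<le> (1 + \<epsilon>) * a m"
      proof (rule mult_right_mono)
        have "\<epsilon> * \<epsilon> \<le> \<epsilon> * 1" using \<epsilon> by (intro mult_left_mono) auto
        moreover have "(1 + \<epsilon> / 2) * \<Theta> = 1 + 3 / 4 * \<epsilon> + \<epsilon> * \<epsilon> / 8" by (simp add: \<Theta>_def algebra_simps)
        ultimately show "(1 + \<epsilon> / 2) * \<Theta> \<le> 1 + \<epsilon>" using \<epsilon> by linarith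
      qed (use am in simp)
      finally have aa: "(1 + \<epsilon> / 2) * a (block_end \<Theta> k) \<le> (1 + \<epsilon>) * a m" .
      have "{\<omega> \<in> space M. (1 + \<epsilon>) * a m < S m \<omega>} \<subseteq> (\<Union>i<max (Suc k) K. ?A i \<union> J i)"
      proof
        fix \<omega> assume w: "\<omega> \<in> {\<omega> \<in> space M. (1 + \<epsilon>) * a m < S m \<omega>}"
        show "\<omega> \<in> (\<Union>i<max (Suc k) K. ?A i \<union> J i)"
        proof (cases "\<exists>j<block_end \<Theta> k. y * a (block_end \<Theta> k) \<le> \<bar>X (Suc j) \<omega>\<bar>")
          case True
          then have "\<omega> \<in> (\<Union>i<K. J i)" using K w by blast
          then show ?thesis by (auto simp: less_max_iff_disj)
        next
          case False
          have "m \<in> {1..block_end \<Theta> k}" using m k by auto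
          moreover have "(1 + \<epsilon> / 2) * a (block_end \<Theta> k) \<le> S m \<omega>" using aa w by simp
          ultimately have "\<omega> \<in> G (block_end \<Theta> k)" using w False by (auto simp: G_def not_le)
          then have "\<omega> \<in> ?A k" using k by (simp add: A_def)
          then show ?thesis by (intro UN_I[of k]) auto
        qed
      qed
      then show ?thesis using True by auto
    qed auto
  qed
  then show ?thesis by blast
qed

text \<open>Within a block \<open>u\<close> and \<open>Log u\<close> vary by bounded factors and the
  variances add up to a bounded multiple of \<open>u\<close>. So the block's share of the divergent
  series is at most a constant times \<open>exp (- (1 - \<delta>) * \<tau>)\<close>.\<close>

lemma not_summable_exp_\<tau>:
  assumes \<Theta>: "1 < \<Theta>" and \<delta>: "0 < \<delta>" "\<delta> < 1"
    and div: "\<not> summable (\<lambda>n. Log (u (Suc n)) powr (\<delta> - 1) / u (Suc n) * v n)"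
  shows "\<not> summable (\<lambda>k. if nonempty_block \<Theta> k then exp (- (1 - \<delta>) * \<tau> (block_end \<Theta> k)) else 0)"
proof
  let ?w = "\<lambda>k. if nonempty_block \<Theta> k then exp (- (1 - \<delta>) * \<tau> (block_end \<Theta> k)) else 0"
  let ?f = "\<lambda>n. Log (u (Suc n)) powr (\<delta> - 1) / u (Suc n) * v n"
  let ?N = "block_end \<Theta>"
  define C where "C = \<Theta> * (exp 1 * \<Theta>) powr (1 - \<delta>)"
  have C: "0 \<le> C" using \<Theta> by (simp add: C_def)
  assume w: "summable ?w"
  have f0: "0 \<le> ?f n" for n using u_nonneg v_nonneg by simp
  \<comment> \<open>The summand at \<open>n\<close> involves \<open>u (Suc n)\<close>, so the
    indices from one block end to the next belong to block \<open>Suc k\<close>.\<close>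
  have block: "(\<Sum>n\<in>{?N k..<?N (Suc k)}. ?f n) \<le> C * ?w (Suc k)" for k
  proof -
    have \<Theta>k: "0 < \<Theta> ^ Suc k" using \<Theta> by simp
    have trm: "nonempty_block \<Theta> (Suc k) \<and> ?f n \<le> (exp 1 * \<Theta>) powr (1 - \<delta>) * exp (- (1 - \<delta>) * \<tau> (?N (Suc k))) / \<Theta> ^ Suc k * v n"
      if n: "n \<in> {?N k..<?N (Suc k)}" for n
    proof -
      have u1: "\<Theta> ^ Suc k \<le> u (Suc n)" using n by (intro block_end_less_imp[OF \<Theta>]) auto
      have u2: "u (Suc n) \<le> u (?N (Suc k))" using n by (intro u_mono) auto
      have nonempty_block: "nonempty_block \<Theta> (Suc k)" unfolding nonempty_block_def using u1 u2 by linarith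
      have "exp (\<tau> (?N (Suc k))) \<le> exp 1 * Log (u (?N (Suc k)))" unfolding \<tau>_def by (rule exp_LL_le)
      also have "\<dots> \<le> exp 1 * (\<Theta> * Log (u (Suc n)))"
      proof (rule mult_left_mono)
        have "Log (u (?N (Suc k))) \<le> Log (\<Theta> * \<Theta> ^ Suc k)"
          using u_block_end_less[OF \<Theta>, of "Suc k"] by (intro Log_mono) simp
        also have "\<dots> \<le> \<Theta> * Log (\<Theta> ^ Suc k)" using \<Theta> \<Theta>k by (intro Log_scale) auto
        also have "\<dots> \<le> \<Theta> * Log (u (Suc n))" using \<Theta> u1 by (intro mult_left_mono Log_mono) auto
        finally show "Log (u (?N (Suc k))) \<le> \<Theta> * Log (u (Suc n))" .
      qed simp
      finally have le: "exp (\<tau> (?N (Suc k))) \<le> (exp 1 * \<Theta>) * Log (u (Suc n))" by simp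
      have "((exp 1 * \<Theta>) * Log (u (Suc n))) powr (\<delta> - 1) \<le> exp (\<tau> (?N (Suc k))) powr (\<delta> - 1)"
        using le \<delta> by (intro powr_mono2') auto
      also have "\<dots> = exp (- (1 - \<delta>) * \<tau> (?N (Suc k)))" by (simp add: powr_def)
      finally have "(exp 1 * \<Theta>) powr (\<delta> - 1) * Log (u (Suc n)) powr (\<delta> - 1) \<le> exp (- (1 - \<delta>) * \<tau> (?N (Suc k)))"
        by (simp only: powr_mult)
      then have "(exp 1 * \<Theta>) powr (1 - \<delta>) * ((exp 1 * \<Theta>) powr (\<delta> - 1) * Log (u (Suc n)) powr (\<delta> - 1)) \<le>
          (exp 1 * \<Theta>) powr (1 - \<delta>) * exp (- (1 - \<delta>) * \<tau> (?N (Suc k)))"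
        by (rule mult_left_mono) simp
      moreover have "(exp 1 * \<Theta>) powr (1 - \<delta>) * (exp 1 * \<Theta>) powr (\<delta> - 1) = 1"
        using \<Theta> by (simp flip: powr_add)
      ultimately have L: "Log (u (Suc n)) powr (\<delta> - 1) \<le> (exp 1 * \<Theta>) powr (1 - \<delta>) * exp (- (1 - \<delta>) * \<tau> (?N (Suc k)))"
        by (metis mult.assoc mult_1)
      have "?f n \<le> (exp 1 * \<Theta>) powr (1 - \<delta>) * exp (- (1 - \<delta>) * \<tau> (?N (Suc k))) / \<Theta> ^ Suc k * v n"
        by (rule mult_right_mono[OF frac_le[OF _ L \<Theta>k u1] v_nonneg]) simp
      then show ?thesis using nonempty_block by blast
    qed
    show ?thesis
    proof (cases "nonempty_block \<Theta> (Suc k)")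
      case True
      have N: "?N k \<le> ?N (Suc k)" by (intro block_end_mono \<Theta>) simp
      have "(\<Sum>n\<in>{?N k..<?N (Suc k)}. ?f n) \<le>
        (\<Sum>n\<in>{?N k..<?N (Suc k)}. (exp 1 * \<Theta>) powr (1 - \<delta>) * exp (- (1 - \<delta>) * \<tau> (?N (Suc k))) / \<Theta> ^ Suc k * v n)"
        using trm by (intro sum_mono) blast
      also have "\<dots> = (exp 1 * \<Theta>) powr (1 - \<delta>) * exp (- (1 - \<delta>) * \<tau> (?N (Suc k))) / \<Theta> ^ Suc k * (\<Sum>n\<in>{?N k..<?N (Suc k)}. v n)"
        by (rule sum_distrib_left[symmetric])
      also have "\<dots> \<le> (exp 1 * \<Theta>) powr (1 - \<delta>) * exp (- (1 - \<delta>) * \<tau> (?N (Suc k))) / \<Theta> ^ Suc k * (\<Theta> * \<Theta> ^ Suc k)"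
      proof (rule mult_left_mono)
        have "(\<Sum>n\<in>{?N k..<?N (Suc k)}. v n) \<le> u (?N (Suc k))"
          unfolding u_def using v_nonneg by (intro sum_mono2) auto
        then show "(\<Sum>n\<in>{?N k..<?N (Suc k)}. v n) \<le> \<Theta> * \<Theta> ^ Suc k"
          using u_block_end_less[OF \<Theta>, of "Suc k"] by simp
      qed (use \<Theta> in simp)
      also have "\<dots> = C * ?w (Suc k)" using True \<Theta>k by (simp add: C_def)
      finally show ?thesis .
    next
      case False
      then have "{?N k..<?N (Suc k)} = {}" using trm by blast
      then show ?thesis using False by (simp only: sum.empty) simp
    qed
  qed
  have "summable ?f"
  proof (rule bounded_imp_summable[OF f0])
    fix n
    obtain K where K: "n < ?N K"
      using block_end_top[OF \<Theta>] unfolding filterlim_at_top eventually_sequentially by (metis Suc_le_eq order_refl)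
    have tel: "(\<Sum>n<?N K. ?f n) = (\<Sum>n<?N 0. ?f n) + (\<Sum>k<K. \<Sum>n\<in>{?N k..<?N (Suc k)}. ?f n)" for K
    proof (induction K)
      case (Suc K)
      have "?N K \<le> ?N (Suc K)" by (intro block_end_mono \<Theta>) simp
      then have "(\<Sum>n<?N (Suc K). ?f n) = (\<Sum>n<?N K. ?f n) + (\<Sum>n\<in>{?N K..<?N (Suc K)}. ?f n)"
        unfolding lessThan_atLeast0 by (intro sum.atLeastLessThan_concat[symmetric]) auto
      then show ?case using Suc by simp
    qed simp
    have "(\<Sum>i\<le>n. ?f i) \<le> (\<Sum>n<?N K. ?f n)" using K f0 by (intro sum_mono2) auto
    also have "\<dots> \<le> (\<Sum>n<?N 0. ?f n) + (\<Sum>k<K. C * ?w (Suc k))" unfolding tel[of K] by (intro add_left_mono sum_mono block)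
    also have "(\<Sum>k<K. C * ?w (Suc k)) = C * (\<Sum>k<K. ?w (Suc k))" by (rule sum_distrib_left[symmetric])
    also have "\<dots> \<le> C * (\<Sum>k. ?w (Suc k))"
    proof (rule mult_left_mono[OF sum_le_suminf C])
      show "summable (\<lambda>k. ?w (Suc k))" by (rule iffD2[OF summable_Suc_iff w])
    qed auto
    finally show "(\<Sum>i\<le>n. ?f i) \<le> (\<Sum>n<?N 0. ?f n) + C * (\<Sum>k. ?w (Suc k))" by simp
  qed
  then show False using div by blast
qed

definition good :: "real \<Rightarrow> real \<Rightarrow> nat \<Rightarrow> bool" where
  "good \<Theta> \<eta> k \<longleftrightarrow> nonempty_block \<Theta> k \<and> b (block_end \<Theta> k) \<le> exp (- \<eta> * \<tau> (block_end \<Theta> k))"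

text \<open>At a bad block end \<open>b powr DD\<close> exceeds
  \<open>exp (- \<eta> * DD * \<tau>)\<close>, which is at least the term in question. Bad terms are
  therefore summable and the divergence comes from good ends.\<close>

lemma not_summable_good:
  assumes \<Theta>: "1 < \<Theta>" and "\<eta> * DD \<le> 1 - \<delta>" "0 < \<eta>"
    and "\<not> summable (\<lambda>k. if nonempty_block \<Theta> k then exp (- (1 - \<delta>) * \<tau> (block_end \<Theta> k)) else 0)"
  shows "\<not> summable (\<lambda>k. if good \<Theta> \<eta> k then exp (- (1 - \<delta>) * \<tau> (block_end \<Theta> k)) else 0)"
proof
  assume "summable (\<lambda>k. if good \<Theta> \<eta> k then exp (- (1 - \<delta>) * \<tau> (block_end \<Theta> k)) else 0)"
  from summable_add[OF this summable_b_blocks[OF \<Theta>]]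
  have "summable (\<lambda>k. if nonempty_block \<Theta> k then exp (- (1 - \<delta>) * \<tau> (block_end \<Theta> k)) else 0)"
  proof (rule summable_comparison_test'[where N = 0])
    fix k
    show "norm (if nonempty_block \<Theta> k then exp (- (1 - \<delta>) * \<tau> (block_end \<Theta> k)) else 0) \<le>
        (if good \<Theta> \<eta> k then exp (- (1 - \<delta>) * \<tau> (block_end \<Theta> k)) else 0) + (if nonempty_block \<Theta> k then b (block_end \<Theta> k) powr DD else 0)"
    proof (cases "nonempty_block \<Theta> k \<and> \<not> good \<Theta> \<eta> k")
      case True
      then have "exp (- \<eta> * \<tau> (block_end \<Theta> k)) \<le> b (block_end \<Theta> k)" by (auto simp: good_def)
      then have "exp (- \<eta> * \<tau> (block_end \<Theta> k)) powr DD \<le> b (block_end \<Theta> k) powr DD"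
        using d_nonneg by (intro powr_mono2) auto
      moreover have "exp (- (1 - \<delta>) * \<tau> (block_end \<Theta> k)) \<le> exp (- \<eta> * \<tau> (block_end \<Theta> k)) powr DD"
      proof -
        have "\<eta> * DD * \<tau> (block_end \<Theta> k) \<le> (1 - \<delta>) * \<tau> (block_end \<Theta> k)"
          using assms(2) \<tau>_ge_1[of "block_end \<Theta> k"] by (intro mult_right_mono) auto
        then have "exp (- (1 - \<delta>) * \<tau> (block_end \<Theta> k)) \<le> exp (- (\<eta> * DD * \<tau> (block_end \<Theta> k)))"
          unfolding exp_le_cancel_iff mult_minus_left by linarith
        also have "\<dots> = exp (- \<eta> * \<tau> (block_end \<Theta> k)) powr DD" by (simp add: powr_def algebra_simps)
        finally show ?thesis .
      qed
      ultimately show ?thesis using True by simp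
    qed (auto simp: good_def)
  qed
  then show False using assms(4) by blast
qed

end

section \<open>Lower half\<close>

context lil_full
begin

text \<open>By divergence and block independence some clipped block sum is large with upper
  expectation near 1. It forces the partial sum to be large unless the preceding sum is very
  negative, the overshoots beyond clipping add up, or one variable is huge; these have a small
  cover. Of the loss \<open>7 * \<delta>\<close>, the bottom of the ramp takes
  \<open>5 * \<delta>\<close>, the preceding sum and the overshoots \<delta> each.\<close>

lemma lower_main:
  assumes V: "subadditive_capacity M V" "property_C M H E V"
    and \<delta>: "0 < \<delta>" "\<delta> \<le> 1 / 10"
    and \<Theta>: "1 < \<Theta>" "2 * sqrt (1 / \<Theta>) \<le> \<delta>"
    and al: "exp (4 * \<alpha>) \<le> 1 + \<delta>\<^sup>2 / 32" "(exp (- 4 * \<alpha>) - 16 * \<alpha>) * (1 - 1 / \<Theta>) \<ge> 1 - \<delta>\<^sup>2 / 32"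
      "\<alpha> \<le> 1 / 32" "0 \<le> exp (- 4 * \<alpha>) - 16 * \<alpha>"
    and neg: "\<And>\<eta>. 0 < \<eta> \<Longrightarrow> \<exists>n1. small_cover \<eta> (\<lambda>m. if n1 \<le> m then {\<omega> \<in> space M. 2 * a m < - S m \<omega>} else {})"
    and div: "\<not> summable (\<lambda>n. Log (u (Suc n)) powr (2 * \<delta> - 1) / u (Suc n) * v n)"
    and \<eta>0: "0 < \<eta>0"
  shows "\<exists>N\<ge>n0. 1 - \<eta>0 \<le> V {\<omega> \<in> space M. \<exists>m\<in>{n0..N}. (1 - 7 * \<delta>) * a m \<le> S m \<omega>}"
proof -
  have D1: "1 \<le> DD" using d_nonneg by simp
  \<comment> \<open>The largest value for which bad block ends can be discarded.\<close>
  define \<eta> where "\<eta> = (1 - 2 * \<delta>) / DD"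
  have \<eta>: "0 < \<eta>" "\<eta> * DD \<le> 1 - 2 * \<delta>" using D1 \<delta> by (auto simp: \<eta>_def)
  define y where "y = \<delta> * \<eta> / 8"
  have y: "0 < y" "4 * y / \<delta> < \<eta>" using \<eta> \<delta> by (auto simp: y_def)
  define w where "w k = (if good \<Theta> \<eta> k then exp (- (1 - 2 * \<delta>) * \<tau> (block_end \<Theta> k)) else 0)" for k
  have w0: "0 \<le> w k" for k by (simp add: w_def)
  have "\<not> summable w"
    unfolding w_def using \<delta> \<eta> \<Theta>(1) by (intro not_summable_good not_summable_exp_\<tau> div) auto
  \<comment> \<open>Skipping the block in between leaves the variance up to \<open>\<nu> i\<close>
    at most the share \<open>1 / \<Theta>\<close> of that up to
    \<open>\<nu> (Suc i)\<close>.\<close>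
  then obtain q where q: "\<not> summable (\<lambda>i. w (2 * i + q))"
    using not_summable_parity[of w] w0 by blast
  define \<nu> where "\<nu> i = block_end \<Theta> (2 * i + q)" for i
  define kk where "kk i = 2 * Suc i + q" for i
  have \<nu>_Suc: "\<nu> (Suc i) = block_end \<Theta> (kk i)" for i by (simp add: \<nu>_def kk_def)
  have \<nu>_mono: "mono \<nu>" unfolding \<nu>_def by (intro monoI block_end_mono \<Theta>) simp
  have al': "(exp (- 4 * \<alpha>) - 16 * \<alpha>) * (1 - 1 / \<Theta>) \<ge> 1 - \<delta>\<^sup>2 / 32" by (rule al(2))
  obtain n3 where n3: "\<And>n m. n3 \<le> n \<Longrightarrow> b n \<le> exp (- \<eta> * \<tau> n) \<Longrightarrow> m \<le> n \<Longrightarrow> u m \<le> 1 / \<Theta> * u n \<Longrightarrow>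
      exp (- (1 - 2 * \<delta>) * \<tau> n) \<le> EE (\<lambda>x. ramp (1 - 4 * \<delta>) \<delta> (clip_sum (2 * c n) m n x / a n))"
    using lower_good[OF \<delta> al(1) al' al(3) \<eta>(1) al(4)] unfolding eventually_sequentially by blast
  define R where "R n = {\<omega> \<in> space M. \<exists>m\<in>{1..n}. \<delta> * a n \<le> (\<Sum>j<m. min (max (\<bar>X (Suc j) \<omega>\<bar> - 2 * c n) 0) (y * a n))}" for n
  define AR where "AR k = (if good \<Theta> \<eta> k then R (block_end \<Theta> k) else {})" for k
  define rR where "rR k = (if nonempty_block \<Theta> k then exp (- 2 * \<tau> (block_end \<Theta> k)) else 0)" for k
  have "\<forall>\<^sub>F k in sequentially. AR k \<in> sets M \<and> hat_le (AR k) (rR k)"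
    using eventually_block_end[OF \<Theta>(1) excess_good[OF \<delta>(1) y]]
  proof eventually_elim
    case (elim k)
    have "R n \<in> sets M" for n unfolding R_def by measurable
    moreover have "hat_le (AR k) (rR k)"
    proof (cases "good \<Theta> \<eta> k")
      case True
      then show ?thesis using elim unfolding AR_def rR_def R_def by (simp add: good_def)
    next
      case False
      have "0 \<le> rR k" by (simp add: rR_def)
      then show ?thesis using False hat_le_mono[OF hat_le_empty, of "{}" "rR k"] by (simp add: AR_def)
    qed
    ultimately show ?case by (simp add: AR_def)
  qed
  moreover have "summable rR" unfolding rR_def by (rule summable_exp_\<tau>[OF \<Theta>(1)]) simp
  ultimately obtain k1 where k1: "small_cover (\<eta>0 / 4) (\<lambda>k. if k1 \<le> k then AR k else {})"
    using small_cover_tail[of AR rR "\<eta>0 / 4"] \<eta>0 unfolding eventually_sequentially by auto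
  obtain N0 J where J: "small_cover (\<eta>0 / 4) J" and
    Jc: "\<And>n. N0 \<le> n \<Longrightarrow> \<exists>K. {\<omega> \<in> space M. \<exists>j<n. y * a n \<le> \<bar>X (Suc j) \<omega>\<bar>} \<subseteq> (\<Union>i<(K::nat). J i)"
    using small_exceedance_union[OF y(1), of "\<eta>0 / 4"] \<eta>0 by auto
  obtain n1 where n1: "small_cover (\<eta>0 / 4) (\<lambda>m. if n1 \<le> m then {\<omega> \<in> space M. 2 * a m < - S m \<omega>} else {})"
    using neg[of "\<eta>0 / 4"] \<eta>0 by auto
  let ?A1 = "\<lambda>m. if n1 \<le> m then {\<omega> \<in> space M. 2 * a m < - S m \<omega>} else {}"
  let ?A2 = "\<lambda>k. if k1 \<le> k then AR k else {}"
  have SCb: "small_cover (3 / 4 * \<eta>0) (\<lambda>k. (?A1 k \<union> ?A2 k) \<union> J k)"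
    using small_cover_Un[OF small_cover_Un[OF n1 k1] J] by simp
  obtain n2 where n2: "\<And>m. n2 \<le> m \<Longrightarrow> 0 < u m"
    using eventually_u_pos unfolding eventually_sequentially by blast
  obtain K0 where K0: "\<And>k. K0 \<le> k \<Longrightarrow> n0 + n1 + n2 + n3 + N0 + 1 \<le> block_end \<Theta> k"
    using block_end_top[OF \<Theta>(1)] unfolding filterlim_at_top eventually_sequentially by blast
  define i0 where "i0 = K0 + k1"
  have i0: "n0 + n1 + n2 + n3 + N0 + 1 \<le> \<nu> i" "n0 + n1 + n2 + n3 + N0 + 1 \<le> \<nu> (Suc i)" "k1 \<le> kk i" if "i0 \<le> i" for i
    unfolding \<nu>_def using that K0[of "2 * i + q"] K0[of "2 * Suc i + q"] by (auto simp: i0_def kk_def)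
  \<comment> \<open>Inactive indices get a zero function \<open>F\<close>, so that the blocks remain
    consecutive for the product formula.\<close>
  define act where "act i \<longleftrightarrow> i0 \<le> i \<and> good \<Theta> \<eta> (kk i)" for i
  define F where "F i x = (if act i then ramp (1 - 4 * \<delta>) \<delta> (clip_sum (2 * c (\<nu> (Suc i))) (\<nu> i) (\<nu> (Suc i)) x / a (\<nu> (Suc i))) else 0)" for i x
  have posn: "0 < u (\<nu> (Suc i))" if "act i" for i
    using n2[of "\<nu> (Suc i)"] i0(2)[of i] that by (simp add: act_def)
  have F_BL: "F i \<in> BL (\<nu> (Suc i))" for i
  proof (cases "act i")
    case True
    then show ?thesis unfolding F_def using BL_lip1[OF clip_mean_BL[OF posn[OF True]] ramp_lip1] by simp
  next
    case False
    then show ?thesis unfolding F_def using BL_const by simp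
  qed
  have F_bd: "0 \<le> F i x" "F i x \<le> 1" for i x unfolding F_def using ramp_bounds by auto
  have F_coords: "F i x = F i z" if "\<And>j. \<nu> i \<le> j \<Longrightarrow> x j = z j" for i x z
  proof -
    have "clip_sum C (\<nu> i) n x = clip_sum C (\<nu> i) n z" for C n
      unfolding clip_sum_def using that by (intro sum.cong) auto
    then show ?thesis unfolding F_def by simp
  qed
  have uratio: "u (\<nu> i) \<le> 1 / \<Theta> * u (\<nu> (Suc i))" if "act i" for i
  proof -
    have "u (\<nu> i) < \<Theta> ^ Suc (2 * i + q)" unfolding \<nu>_def by (rule u_block_end_less[OF \<Theta>(1)])
    moreover have "\<Theta> ^ kk i \<le> u (\<nu> (Suc i))" using that unfolding act_def good_def nonempty_block_def \<nu>_Suc by simp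
    moreover have "1 / \<Theta> * \<Theta> ^ kk i = \<Theta> ^ Suc (2 * i + q)" using \<Theta> by (simp add: kk_def)
    moreover have "1 / \<Theta> * \<Theta> ^ kk i \<le> 1 / \<Theta> * u (\<nu> (Suc i))" using calculation(2) \<Theta> by (intro mult_left_mono) auto
    ultimately show ?thesis by linarith
  qed
  define W where "W i = (if i0 \<le> i then w (kk i) else 0)" for i
  have EEF: "W i \<le> EE (F i)" "EE (F i) \<le> 1" for i
  proof -
    show "EE (F i) \<le> 1"
      using EE_mono[OF F_BL BL_const, of i 1] F_bd by (simp add: EE_def e_const)
    show "W i \<le> EE (F i)"
    proof (cases "act i")
      case True
      have "exp (- (1 - 2 * \<delta>) * \<tau> (\<nu> (Suc i))) \<le> EE (\<lambda>x. ramp (1 - 4 * \<delta>) \<delta> (clip_sum (2 * c (\<nu> (Suc i))) (\<nu> i) (\<nu> (Suc i)) x / a (\<nu> (Suc i))))"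
      proof (rule n3)
        show "n3 \<le> \<nu> (Suc i)" using i0(2)[of i] True by (simp add: act_def)
        show "b (\<nu> (Suc i)) \<le> exp (- \<eta> * \<tau> (\<nu> (Suc i)))" using True unfolding act_def good_def \<nu>_Suc by simp
        show "\<nu> i \<le> \<nu> (Suc i)" by (rule monoD[OF \<nu>_mono]) simp
      qed (rule uratio[OF True])
      moreover have "F i = (\<lambda>x. ramp (1 - 4 * \<delta>) \<delta> (clip_sum (2 * c (\<nu> (Suc i))) (\<nu> i) (\<nu> (Suc i)) x / a (\<nu> (Suc i))))"
        unfolding F_def using True by simp
      moreover have "W i = exp (- (1 - 2 * \<delta>) * \<tau> (\<nu> (Suc i)))"
        using True by (simp add: W_def w_def act_def \<nu>_Suc)
      ultimately show ?thesis by simp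
    next
      case False
      have "0 \<le> EE (F i)" unfolding EE_def by (rule e_nonneg[OF joint_fin[OF F_BL] F_bd(1)])
      moreover have "W i = 0" using False by (auto simp: W_def w_def act_def)
      ultimately show ?thesis by simp
    qed
  qed
  have W0: "0 \<le> W i" for i by (simp add: W_def w0)
  have W_div: "\<not> summable W"
  proof
    assume "summable W"
    moreover have "\<forall>\<^sub>F i in sequentially. W i = w (2 * Suc i + q)"
      using eventually_ge_at_top[of i0] by eventually_elim (simp add: W_def kk_def)
    ultimately have "summable (\<lambda>i. w (2 * Suc i + q))" using summable_cong[of W "\<lambda>i. w (2 * Suc i + q)"] by blast
    then show False using q summable_Suc_iff[of "\<lambda>i. w (2 * i + q)"] by blast
  qed
  \<comment> \<open>Enough blocks to push the failure bound \<open>exp (- (\<Sum>i<I. W i))\<close>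
    down to \<open>\<eta>0 / 4\<close>.\<close>
  have "\<exists>n. - ln (\<eta>0 / 4) < (\<Sum>i\<le>n. W i)"
  proof (rule ccontr)
    assume "\<not> ?thesis"
    then have "(\<Sum>i\<le>n. W i) \<le> - ln (\<eta>0 / 4)" for n by (simp add: not_less)
    then have "summable W" by (rule bounded_imp_summable[OF W0])
    then show False using W_div by blast
  qed
  then obtain n where n: "- ln (\<eta>0 / 4) < (\<Sum>i\<le>n. W i)" by (elim exE)
  define I where "I = Suc n"
  have I: "- ln (\<eta>0 / 4) \<le> (\<Sum>i<I. W i)" using n by (simp add: I_def lessThan_Suc_atMost)
  define \<Phi> where "\<Phi> x = 1 - (\<Prod>i<I. 1 - F i x)" for x
  have \<Phi>_BL: "\<Phi> \<in> BL (\<nu> I)"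
    unfolding \<Phi>_def
  proof (rule BL_diff[OF BL_const BL_prod], rule BL_diff[OF BL_const BL_mono[OF F_BL]])
    fix i assume "i \<in> {..<I}"
    then show "\<nu> (Suc i) \<le> \<nu> I" by (intro monoD[OF \<nu>_mono]) simp
  qed
  have "1 - \<eta>0 / 4 \<le> EE \<Phi>"
  proof -
    have "(\<Prod>i<I. 1 - EE (F i)) \<le> exp (- (\<Sum>i<I. EE (F i)))" by (rule prod_one_minus_le_exp[OF EEF(2)])
    also have "\<dots> \<le> exp (ln (\<eta>0 / 4))"
      using I sum_mono[of "{..<I}" W "\<lambda>i. EE (F i)"] EEF(1) by simp
    also have "\<dots> = \<eta>0 / 4" using \<eta>0 by simp
    finally show ?thesis unfolding \<Phi>_def using EE_one_minus_prod[OF \<nu>_mono F_BL F_coords F_bd(2), of I] by simp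
  qed
  define N where "N = n0 + \<nu> I"
  define Tgt where "Tgt = {\<omega> \<in> space M. \<exists>m\<in>{n0..N}. (1 - 7 * \<delta>) * a m \<le> S m \<omega>}"
  have Tgt_sets: "Tgt \<in> sets M" unfolding Tgt_def by measurable
  define Bad where "Bad i = ({\<omega> \<in> space M. 2 * a (\<nu> i) < - S (\<nu> i) \<omega>} \<union> R (\<nu> (Suc i))) \<union>
      {\<omega> \<in> space M. \<exists>j<\<nu> (Suc i). y * a (\<nu> (Suc i)) \<le> \<bar>X (Suc j) \<omega>\<bar>}" for i
  have SCBad: "small_cover (3 / 4 * \<eta>0) (\<lambda>i. if act i then Bad i else {})"
  proof (rule small_cover_cover[OF SCb])
    fix i
    show "\<exists>K. (if act i then Bad i else {}) \<subseteq> (\<Union>k<K. (?A1 k \<union> ?A2 k) \<union> J k)"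
    proof (cases "act i")
      case True
      then have ii: "i0 \<le> i" "good \<Theta> \<eta> (kk i)" by (auto simp: act_def)
      have "N0 \<le> \<nu> (Suc i)" using i0(2)[OF ii(1)] by simp
      from Jc[OF this] obtain K where K: "{\<omega> \<in> space M. \<exists>j<\<nu> (Suc i). y * a (\<nu> (Suc i)) \<le> \<bar>X (Suc j) \<omega>\<bar>} \<subseteq> (\<Union>i<K. J i)"
        by (elim exE)
      define L where "L = max K (Suc (max (\<nu> i) (kk i)))"
      have L: "K \<le> L" "\<nu> i < L" "kk i < L" by (auto simp: L_def)
      have 1: "{\<omega> \<in> space M. 2 * a (\<nu> i) < - S (\<nu> i) \<omega>} \<subseteq> (?A1 (\<nu> i) \<union> ?A2 (\<nu> i)) \<union> J (\<nu> i)"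
        using i0(1)[OF ii(1)] by auto
      have 2: "R (\<nu> (Suc i)) \<subseteq> (?A1 (kk i) \<union> ?A2 (kk i)) \<union> J (kk i)"
        using i0(3)[OF ii(1)] ii(2) by (auto simp: AR_def \<nu>_Suc)
      have "Bad i \<subseteq> (\<Union>k<L. (?A1 k \<union> ?A2 k) \<union> J k)"
        unfolding Bad_def
      proof (intro Un_least)
        show "{\<omega> \<in> space M. 2 * a (\<nu> i) < - S (\<nu> i) \<omega>} \<subseteq> (\<Union>k<L. (?A1 k \<union> ?A2 k) \<union> J k)"
          by (rule order_trans[OF 1]) (rule UN_upper, simp add: L)
        show "R (\<nu> (Suc i)) \<subseteq> (\<Union>k<L. (?A1 k \<union> ?A2 k) \<union> J k)"
          by (rule order_trans[OF 2]) (rule UN_upper, simp add: L)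
        show "{\<omega> \<in> space M. \<exists>j<\<nu> (Suc i). y * a (\<nu> (Suc i)) \<le> \<bar>X (Suc j) \<omega>\<bar>} \<subseteq> (\<Union>k<L. (?A1 k \<union> ?A2 k) \<union> J k)"
          by (rule order_trans[OF K]) (rule UN_mono, use L in auto)
      qed
      then show ?thesis using True by auto
    qed auto
  qed
  \<comment> \<open>The bad events of the first \<open>I\<close> blocks are enclosed in one
    measurable set, so that finite sub-additivity of \<open>V\<close> is applied only once.\<close>
  obtain C where C: "C \<in> sets M" "(\<Union>i<I. if act i then Bad i else {}) \<subseteq> C" "hat_le C (3 / 4 * \<eta>0)"
    using small_cover_finite_cover[OF SCBad, of I] by blast
  \<comment> \<open>Off \<open>Tgt\<close> and \<open>C\<close> the clipped block sum is at most
    \<open>(1 - 7 * \<delta>) + \<delta> + \<delta>\<close> times \<open>a n\<close>, which is the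
    bottom of the ramp.\<close>
  have F0: "F i (\<lambda>j. X (Suc j) \<omega>) = 0" if \<omega>: "\<omega> \<in> space M" "\<omega> \<notin> Tgt" "\<omega> \<notin> C" and i: "i < I" for \<omega> i
  proof (cases "act i")
    case True
    then have ii: "i0 \<le> i" by (simp add: act_def)
    define m where "m = \<nu> i"
    define n where "n = \<nu> (Suc i)"
    have mn: "m \<le> n" unfolding m_def n_def by (rule monoD[OF \<nu>_mono]) simp
    have un: "0 < u n" unfolding n_def by (rule posn[OF True])
    have an: "0 < a n" by (rule a_pos[OF un])
    have cn: "0 < c n" by (rule c_pos[OF un])
    have "\<omega> \<notin> Bad i" using C(2) \<omega>(3) i True by auto
    then have nb: "- 2 * a m \<le> S m \<omega>" "\<omega> \<notin> R n" "\<And>j. j < n \<Longrightarrow> \<bar>X (Suc j) \<omega>\<bar> < y * a n"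
      using \<omega>(1) by (simp_all add: Bad_def m_def n_def not_le not_less) (metis not_le)
    let ?ex = "\<lambda>j. max (\<bar>X (Suc j) \<omega>\<bar> - 2 * c n) 0"
    have ex: "(\<Sum>j<n. ?ex j) < \<delta> * a n"
    proof -
      have "min (?ex j) (y * a n) = ?ex j" if "j < n" for j
        using nb(3)[OF that] cn abs_ge_zero[of "X (Suc j) \<omega>"] by (auto simp: min_def max_def)
      then have "(\<Sum>j<n. min (?ex j) (y * a n)) = (\<Sum>j<n. ?ex j)" by (intro sum.cong) auto
      moreover have "n \<in> {1..n}" using i0(2)[OF ii] by (simp add: n_def)
      ultimately have "\<omega> \<in> R n" if "\<delta> * a n \<le> (\<Sum>j<n. ?ex j)"
        unfolding R_def using that by (intro CollectI conjI \<omega>(1) bexI[of _ n]) simp_all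
      then show ?thesis using nb(2) not_le by blast
    qed
    have am: "a m \<le> sqrt (1 / \<Theta>) * a n"
    proof (cases "0 < u m")
      case um: True
      have "a m \<le> sqrt (u m / u n) * a n" unfolding a_normaliser by (rule normaliser_ratio'[OF um u_mono[OF mn]])
      also have "\<dots> \<le> sqrt (1 / \<Theta>) * a n"
      proof (rule mult_right_mono[OF real_sqrt_le_mono a_nonneg])
        have "u m \<le> 1 / \<Theta> * u n" unfolding m_def n_def by (rule uratio[OF True])
        then show "u m / u n \<le> 1 / \<Theta>" using un by (simp only: pos_divide_le_eq)
      qed
      finally show ?thesis .
    next
      case False
      then have "u m = 0" using u_nonneg[of m] by linarith
      then have "a m = 0" by (simp add: a_def s_def)
      then show ?thesis using an \<Theta> by simp
    qed
    have "2 * a m \<le> \<delta> * a n"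
      using am mult_right_mono[OF \<Theta>(2) less_imp_le[OF an]] by linarith
    then have Sm: "- \<delta> * a n \<le> S m \<omega>" using nb(1) by simp
    have "S n \<omega> < (1 - 7 * \<delta>) * a n"
    proof (rule ccontr)
      assume "\<not> S n \<omega> < (1 - 7 * \<delta>) * a n"
      moreover have "n \<in> {n0..N}"
        using i0(2)[OF ii] monoD[OF \<nu>_mono, of "Suc i" I] i by (simp add: n_def N_def)
      ultimately have "\<omega> \<in> Tgt" unfolding Tgt_def using \<omega>(1) by (auto simp: not_less)
      then show False using \<omega>(2) by blast
    qed
    moreover have "S n \<omega> = S m \<omega> + (\<Sum>j\<in>{m..<n}. X (Suc j) \<omega>)"
      unfolding S_def lessThan_atLeast0 using mn by (intro sum.atLeastLessThan_concat[symmetric]) auto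
    moreover have "clip_sum (2 * c n) m n (\<lambda>j. X (Suc j) \<omega>) - (\<Sum>j<n. ?ex j) \<le> (\<Sum>j\<in>{m..<n}. X (Suc j) \<omega>)"
    proof -
      have "(\<Sum>j\<in>{m..<n}. ?ex j) \<le> (\<Sum>j<n. ?ex j)" by (intro sum_mono2) auto
      moreover have "(\<Sum>j\<in>{m..<n}. clip (2 * c n) (X (Suc j) \<omega>)) \<le> (\<Sum>j\<in>{m..<n}. X (Suc j) \<omega> + ?ex j)"
      proof (rule sum_mono)
        fix j
        show "clip (2 * c n) (X (Suc j) \<omega>) \<le> X (Suc j) \<omega> + ?ex j"
          using clip_diff[of "2 * c n" "X (Suc j) \<omega>"] cn by linarith
      qed
      ultimately show ?thesis unfolding clip_sum_def by (simp add: sum.distrib)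
    qed
    ultimately have "clip_sum (2 * c n) m n (\<lambda>j. X (Suc j) \<omega>) \<le> (1 - 7 * \<delta>) * a n + \<delta> * a n + \<delta> * a n"
      using ex Sm by linarith
    then have "clip_sum (2 * c n) m n (\<lambda>j. X (Suc j) \<omega>) \<le> (1 - 4 * \<delta> - \<delta>) * a n" by (simp add: algebra_simps)
    then have "clip_sum (2 * c n) m n (\<lambda>j. X (Suc j) \<omega>) / a n \<le> 1 - 4 * \<delta> - \<delta>" using an by (simp only: pos_divide_le_eq)
    then show ?thesis unfolding F_def m_def n_def using True ramp_eq_0[OF \<delta>(1)] by simp
  next
    case False
    then show ?thesis by (simp add: F_def)
  qed
  \<comment> \<open>\<Phi> lies below the indicator of the union, so property (C) bounds
    \<open>V\<close> from below; sub-additivity then removes \<open>C\<close>.\<close>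
  have "e (\<lambda>\<omega>. \<Phi> (\<lambda>j. X (Suc j) \<omega>)) \<le> V (Tgt \<union> C)"
  proof (rule property_C_ge[OF V(2) _ joint_fin[OF \<Phi>_BL]])
    show "Tgt \<union> C \<in> sets M" using Tgt_sets C(1) by simp
    fix \<omega> assume w: "\<omega> \<in> space M"
    show "\<Phi> (\<lambda>j. X (Suc j) \<omega>) \<le> indicator (Tgt \<union> C) \<omega>"
    proof (cases "\<omega> \<in> Tgt \<union> C")
      case True
      have "0 \<le> (\<Prod>i<I. 1 - F i (\<lambda>j. X (Suc j) \<omega>))" using F_bd by (intro prod_nonneg) simp
      then show ?thesis using True by (simp add: \<Phi>_def)
    next
      case False
      then have "(\<Prod>i<I. 1 - F i (\<lambda>j. X (Suc j) \<omega>)) = 1" using F0[OF w] by (intro prod.neutral) simp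
      then show ?thesis using False by (simp add: \<Phi>_def)
    qed
  qed
  also have "V (Tgt \<union> C) \<le> V Tgt + V C"
    using V(1) Tgt_sets C(1) unfolding subadditive_capacity_def by blast
  also have "V C \<le> 3 / 4 * \<eta>0" by (rule property_C_le[OF V(2) C(1,3)])
  finally have "1 - \<eta>0 \<le> V Tgt" using \<open>1 - \<eta>0 / 4 \<le> EE \<Phi>\<close> unfolding EE_def by simp
  then show ?thesis unfolding Tgt_def by (intro exI[of _ N]) (simp add: N_def)
qed

end

section \<open>From the hypotheses to the truncated setting\<close>

lemma summable_of_ereal_suminf:
  fixes f :: "nat \<Rightarrow> real"
  assumes "\<And>n. 0 \<le> f n" "(\<Sum>n. ereal (f n)) < \<infinity>"
  shows "summable f"
proof -
  have nn: "0 \<le> (\<Sum>n. ereal (f n))" by (rule suminf_0_le) (use assms in simp)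
  obtain B where B: "(\<Sum>n. ereal (f n)) = ereal B" using assms(2) nn by (cases "\<Sum>n. ereal (f n)") auto
  show ?thesis
  proof (rule summableI_nonneg_bounded)
    fix n
    have "(\<Sum>i<n. ereal (f i)) \<le> (\<Sum>n. ereal (f n))" by (rule suminf_upper) (use assms in auto)
    then show "(\<Sum>i<n. f i) \<le> B" unfolding B by simp
  qed (rule assms(1))
qed

lemma not_summable_of_ereal_suminf:
  fixes f :: "nat \<Rightarrow> real"
  assumes "(\<Sum>n. ereal (f n)) = \<infinity>"
  shows "\<not> summable f"
proof
  assume "summable f"
  then have "(\<lambda>n. ereal (f n)) sums ereal (suminf f)" unfolding sums_ereal by (rule summable_sums)
  then show False using assms by (simp add: sums_iff)
qed

text \<open>Transfers finiteness of a truncated moment from one level to every other.\<close>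

lemma max_tail_powr_le:
  fixes p C C' x :: real
  assumes "0 \<le> C" "0 \<le> C'" "0 \<le> p"
  shows "max (\<bar>x\<bar> - C') 0 powr p \<le> 2 powr p * (max (\<bar>x\<bar> - C) 0 powr p + C powr p)"
proof -
  let ?m = "max (\<bar>x\<bar> - C) 0"
  have "max (\<bar>x\<bar> - C') 0 \<le> 2 * max ?m C" using assms unfolding max_def by (auto split: if_splits)
  then have "max (\<bar>x\<bar> - C') 0 powr p \<le> (2 * max ?m C) powr p" using assms by (intro powr_mono2) auto
  also have "\<dots> = 2 powr p * max ?m C powr p" by (rule powr_mult)
  also have "max ?m C powr p \<le> ?m powr p + C powr p" by (cases "?m \<le> C") (simp_all add: max_def)
  finally show ?thesis by simp
qed

context independent_square_integrable
begin

lemma s_seq_eq: "s_seq E X n = s n"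
proof -
  have "(\<Sum>k=1..n. real_of_ereal (E (\<lambda>\<omega>. (X k \<omega>)\<^sup>2))) = u n"
    unfolding u_def v_def e_def by (simp add: sum.atLeast1_atMost_eq)
  then show ?thesis by (simp add: s_seq_def s_def)
qed

lemma s_seq_square: "(s_seq E X n)\<^sup>2 = u n"
  unfolding s_seq_eq power2_eq_square by (rule s_square)

lemma t_seq_eq: "t_seq E X n = t n"
  unfolding t_seq_def s_seq_eq t_def \<tau>_def LL_def by (simp add: power2_eq_square s_square)

lemma a_seq_eq: "a_seq E X n = a n"
  by (simp add: a_seq_def a_def s_seq_eq t_seq_eq)

lemma partial_sum_eq: "partial_sum X n \<omega> = S n \<omega>"
  by (simp add: partial_sum_def S_def sum.atLeast1_atMost_eq)

lemma tail_powr_H: "0 \<le> C \<Longrightarrow> 1 \<le> p \<Longrightarrow> (\<lambda>\<omega>. max (\<bar>X (Suc j) \<omega>\<bar> - C) 0 powr p) \<in> H"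
  by (rule H_compose[OF X_Suc_H tail_powr_diff[where m = "nat \<lceil>p\<rceil>"], of C p]) (auto simp: real_nat_ceiling_ge)

end

text \<open>The hypotheses in extended-real form, gathered in a locale so that they can be
  instantiated at \<open>- X\<close> too.\<close>

locale lil_hypotheses = independent_square_integrable M H E X
  for M :: "'a measure" and H E and X :: "nat \<Rightarrow> 'a \<Rightarrow> real" +
  fixes V :: "'a set \<Rightarrow> real"
  assumes cap: "subadditive_capacity M V" and propC: "property_C M H E V"
    and exceedances: "\<epsilon> > 0 \<Longrightarrow>
           (\<Sum>n. ereal (V {\<omega> \<in> space M. \<bar>X (Suc n) \<omega>\<bar> \<ge> \<epsilon> * a_seq E X (Suc n)})) < \<infinity>"
    and truncated: "\<alpha> > 0 \<Longrightarrow> \<exists>p\<ge>2. \<exists>d\<ge>0.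
           (\<Sum>n. Gamma_trunc E X (Suc n) p \<alpha> / ereal (a_seq E X (Suc n) powr p) *
                 ereal_powr (Lambda_trunc E X (Suc n) p \<alpha> / ereal (a_seq E X (Suc n) powr p)) d) < \<infinity>"
    and variance: "\<delta> > 0 \<Longrightarrow>
           (\<Sum>n. ereal (1 / (s_seq E X (Suc n))\<^sup>2 * Log ((s_seq E X (Suc n))\<^sup>2) powr (\<delta> - 1))
                 * E (\<lambda>\<omega>. (X (Suc n) \<omega>)\<^sup>2)) = \<infinity>"
    and means: "(\<lambda>n. ((\<Sum>j=1..n. \<bar>E (X j)\<bar>) + (\<Sum>j=1..n. \<bar>conjugate_expectation E (X j)\<bar>)) / ereal (a_seq E X n))
           \<longlonglongrightarrow> 0"
begin

lemma diverge:
  assumes "0 < \<delta>"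
  shows "\<not> summable (\<lambda>n. Log (u (Suc n)) powr (\<delta> - 1) / u (Suc n) * v n)"
proof (rule not_summable_of_ereal_suminf)
  have "ereal (1 / (s_seq E X (Suc n))\<^sup>2 * Log ((s_seq E X (Suc n))\<^sup>2) powr (\<delta> - 1)) * E (\<lambda>\<omega>. (X (Suc n) \<omega>)\<^sup>2) =
      ereal (Log (u (Suc n)) powr (\<delta> - 1) / u (Suc n) * v n)" for n
    unfolding s_seq_square E_fin[OF X_square_fin] by (simp add: v_def)
  then show "(\<Sum>n. ereal (Log (u (Suc n)) powr (\<delta> - 1) / u (Suc n) * v n)) = \<infinity>"
    using variance[OF assms] by (simp only:)
qed

text \<open>\<delta> = 1 removes the logarithm: the series of \<open>v n / u (Suc n)\<close>
  diverges, but would converge for bounded \<open>u\<close>. If \<open>u\<close> vanishes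
  identically, all quotients are 0 by the convention on division by zero.\<close>

lemma u_unbounded: "\<exists>n. B \<le> u n"
proof (rule ccontr)
  assume "\<not> ?thesis"
  then have B: "u n \<le> B" for n by (simp add: not_le less_imp_le)
  have v: "summable v"
    by (rule summableI_nonneg_bounded[OF v_nonneg]) (use B in \<open>simp add: u_def\<close>)
  have one: "Log (u (Suc n)) powr (1 - 1) / u (Suc n) * v n = v n / u (Suc n)" for n
    using Log_pos[of "u (Suc n)"] by simp
  have "summable (\<lambda>n. v n / u (Suc n))"
  proof (cases "\<exists>m. 0 < u m")
    case True
    then obtain m where m: "0 < u m" by blast
    have "summable (\<lambda>n. v n / u m)" using v by (rule summable_divide)
    then show ?thesis
    proof (rule summable_comparison_test'[where N = m])
      fix n assume "m \<le> n"
      then have "u m \<le> u (Suc n)" by (intro u_mono) simp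
      then show "norm (v n / u (Suc n)) \<le> v n / u m"
        using m v_nonneg[of n] u_nonneg[of "Suc n"] by (simp add: frac_le)
    qed
  next
    case False
    then have "u n = 0" for n using u_nonneg[of n] by (meson antisym not_less)
    then show ?thesis by simp
  qed
  then show False using diverge[of 1] unfolding one by simp
qed

lemma lil_setting: "lil_setting M H E X"
proof
  show utop: "filterlim u at_top sequentially"
    unfolding filterlim_at_top eventually_sequentially
  proof
    fix Z
    obtain n where "Z \<le> u n" using u_unbounded by blast
    then have "\<forall>m\<ge>n. Z \<le> u m" using u_mono order_trans by blast
    then show "\<exists>N. \<forall>n\<ge>N. Z \<le> u n" by blast
  qed
  have "\<forall>\<^sub>F n in sequentially. 1 \<le> u n" using utop unfolding filterlim_at_top by blast
  then have ev: "\<forall>\<^sub>F n in sequentially.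
      ((\<Sum>j=1..n. \<bar>E (X j)\<bar>) + (\<Sum>j=1..n. \<bar>conjugate_expectation E (X j)\<bar>)) / ereal (a_seq E X n) = ereal (mu_sum n / a n)"
  proof eventually_elim
    case (elim n)
    have an: "0 < a n" using elim by (intro a_pos) simp
    have "conjugate_expectation E (X (Suc j)) = ereal (- e (\<lambda>\<omega>. - X (Suc j) \<omega>))" for j
      unfolding conjugate_expectation_def using E_fin[OF fin_uminus[OF X_fin]] by simp
    then have "(\<Sum>j=1..n. \<bar>E (X j)\<bar>) + (\<Sum>j=1..n. \<bar>conjugate_expectation E (X j)\<bar>) = ereal (mu_sum n)"
      unfolding mu_sum_def \<mu>_def by (simp add: sum.atLeast1_atMost_eq E_fin[OF X_fin] sum.distrib)
    then show ?case using an by (simp add: a_seq_eq)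
  qed
  have "(\<lambda>n. ereal (mu_sum n / a n)) \<longlonglongrightarrow> ereal 0"
    using means tendsto_cong[OF ev] by (simp add: zero_ereal_def)
  then show "(\<lambda>n. mu_sum n / a n) \<longlonglongrightarrow> 0" by (simp only: lim_ereal)
qed

text \<open>A ramp rising between the levels \<open>\<epsilon> / 2\<close> and \<epsilon> lies below
  the indicator of the larger event and above that of the smaller one. So the bound on
  \<open>V\<close> becomes one by a dominating variable at the price of halving the level.\<close>

lemma exceed_hat:
  assumes "0 < \<epsilon>"
  shows "\<exists>r. summable r \<and> (\<forall>j. hat_le {\<omega> \<in> space M. \<epsilon> * a (Suc j) \<le> \<bar>X (Suc j) \<omega>\<bar>} (r j))"
proof -
  interpret lil_setting M H E X by (rule lil_setting)
  define A where "A j = {\<omega> \<in> space M. \<bar>X (Suc j) \<omega>\<bar> \<ge> \<epsilon> / 2 * a (Suc j)}" for j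
  have A_sets: "A j \<in> sets M" for j unfolding A_def by measurable
  have V0: "0 \<le> V (A j)" for j
    using cap A_sets unfolding subadditive_capacity_def capacity_def by blast
  \<comment> \<open>While \<open>u\<close> is 0 the level \<open>a\<close> is 0 and no ramp fits;
    the trivial bound 1 is used for these finitely many indices.\<close>
  define r where "r j = (if 0 < u (Suc j) then V (A j) else 1)" for j
  have "summable (\<lambda>j. V (A j))"
    by (rule summable_of_ereal_suminf[OF V0]) (use exceedances[of "\<epsilon> / 2"] assms in \<open>simp add: A_def a_seq_eq\<close>)
  moreover have "\<forall>\<^sub>F j in sequentially. r j = V (A j)"
  proof -
    obtain m where "\<And>n. m \<le> n \<Longrightarrow> 0 < u n" using eventually_u_pos unfolding eventually_sequentially by blast
    then show ?thesis unfolding eventually_sequentially r_def by (intro exI[of _ m]) simp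
  qed
  ultimately have "summable r" using summable_cong[of r "\<lambda>j. V (A j)"] by blast
  moreover have "hat_le {\<omega> \<in> space M. \<epsilon> * a (Suc j) \<le> \<bar>X (Suc j) \<omega>\<bar>} (r j)" for j
  proof (cases "0 < u (Suc j)")
    case True
    let ?x = "\<epsilon> * a (Suc j)"
    have x: "0 < ?x" using assms a_pos[OF True] by simp
    let ?\<xi> = "\<lambda>\<omega>. ramp ?x (?x / 2) \<bar>X (Suc j) \<omega>\<bar>"
    have \<xi>: "?\<xi> \<in> fin"
      by (rule fin_dom[OF H_lip1[OF abs_H[OF X_Suc_H] ramp_lip1] fin_const[of 1]])
         (use ramp_bounds in \<open>simp add: abs_le_iff order_trans[OF _ ramp_bounds(1)]\<close>)
    have "e ?\<xi> \<le> V (A j)"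
    proof (rule property_C_ge[OF propC A_sets \<xi>])
      fix \<omega> assume "\<omega> \<in> space M"
      then show "?\<xi> \<omega> \<le> indicator (A j) \<omega>"
        using ramp_bounds(2) ramp_eq_0[of "?x / 2" "\<bar>X (Suc j) \<omega>\<bar>" ?x] x
        by (cases "\<omega> \<in> A j") (auto simp: A_def not_le)
    qed
    moreover have "indicator {\<omega> \<in> space M. ?x \<le> \<bar>X (Suc j) \<omega>\<bar>} \<omega> \<le> ?\<xi> \<omega>" for \<omega>
      using ramp_bounds(1) ramp_eq_1[of "?x / 2" ?x "\<bar>X (Suc j) \<omega>\<bar>"] x by (simp add: indicator_def)
    ultimately show ?thesis unfolding hat_le_def r_def using True \<xi> by (intro bexI[OF _ \<xi>]) simp
  next
    case False
    then show ?thesis unfolding hat_le_def r_def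
      by (intro bexI[OF _ fin_const[of 1]]) (simp_all add: e_const indicator_le_1)
  qed
  ultimately show ?thesis by blast
qed

text \<open>A finite series of nonnegative terms has finite terms, and an infinite
  \<open>Gamma_trunc\<close> would make \<open>Lambda_trunc\<close> at the same index, hence the
  term, infinite. So each moment is finite at its own level, thus at every level, and the series can
  be read in the reals.\<close>

lemma lil_full_exists:
  assumes \<alpha>: "0 < \<alpha>"
  shows "\<exists>p d. lil_full M H E X \<alpha> p d"
proof -
  obtain p d where p: "2 \<le> p" and d: "0 \<le> d" and fin_sum:
    "(\<Sum>n. Gamma_trunc E X (Suc n) p \<alpha> / ereal (a_seq E X (Suc n) powr p) *
       ereal_powr (Lambda_trunc E X (Suc n) p \<alpha> / ereal (a_seq E X (Suc n) powr p)) d) < \<infinity>"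
    using truncated[OF \<alpha>] by blast
  interpret L: lil_setting M H E X by (rule lil_setting)
  define T where "T n j \<omega> = max (\<bar>X (Suc j) \<omega>\<bar> - \<alpha> * s n / t n) 0 powr p" for n j \<omega>
  have c0: "0 \<le> \<alpha> * s n / t n" for n using \<alpha> s_nonneg[of n] t_pos[of n] by simp
  have Teq: "T n j = (\<lambda>\<omega>. max (\<bar>X (Suc j) \<omega>\<bar> - \<alpha> * s n / t n) 0 powr p)" for n j
    by (rule ext) (rule T_def)
  have TH: "T n j \<in> H" for n j unfolding T_def using c0 p by (intro tail_powr_H) auto
  have E0: "0 \<le> E (T n j)" for n j by (rule E_nonneg[OF TH]) (simp add: T_def)
  have G: "Gamma_trunc E X (Suc n) p \<alpha> = E (T (Suc n) n)" for n
    unfolding Gamma_trunc_def T_def s_seq_eq t_seq_eq by simp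
  have Lm: "Lambda_trunc E X n p \<alpha> = (\<Sum>j<n. E (T n j))" for n
    unfolding Lambda_trunc_def T_def s_seq_eq t_seq_eq by (simp add: sum.atLeast1_atMost_eq)
  define trm where "trm n = Gamma_trunc E X (Suc n) p \<alpha> / ereal (a_seq E X (Suc n) powr p) *
       ereal_powr (Lambda_trunc E X (Suc n) p \<alpha> / ereal (a_seq E X (Suc n) powr p)) d" for n
  have trm_sum: "suminf trm < \<infinity>" using fin_sum unfolding trm_def .
  have powr0: "0 \<le> ereal_powr x d" if "0 \<le> x" for x unfolding ereal_powr_def by simp
  have div0: "0 \<le> x / ereal r" if "0 \<le> x" "0 \<le> r" for x r
    using that by (cases "r = 0") (auto simp: divide_ereal_def ereal_zero_le_0_iff)
  have term0: "0 \<le> trm n" for n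
    unfolding trm_def G Lm by (intro ereal_0_le_mult powr0 div0 sum_nonneg E0) auto
  have term_fin: "trm n < \<infinity>" for n
  proof (rule ccontr)
    assume "\<not> trm n < \<infinity>"
    then have "trm n = \<infinity>" by simp
    moreover have "trm n \<le> (\<Sum>i<Suc n. trm i)" unfolding sum.lessThan_Suc by (rule add_increasing[OF sum_nonneg order_refl]) (rule term0)
    moreover have "(\<Sum>i<Suc n. trm i) \<le> suminf trm" by (rule suminf_upper[OF term0])
    ultimately have "suminf trm = \<infinity>" by (metis ereal_infty_less_eq(1))
    then show False using trm_sum by simp
  qed
  have Gfin: "E (T (Suc n) n) < \<infinity>" for n
  proof (rule ccontr)
    assume "\<not> E (T (Suc n) n) < \<infinity>"
    then have inf: "E (T (Suc n) n) = \<infinity>" by simp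
    have "(\<Sum>j<Suc n. E (T (Suc n) j)) = \<infinity>" using inf E0 sum_nonneg[of "{..<n}" "\<lambda>j. E (T (Suc n) j)"] by auto
    then have Linf: "Lambda_trunc E X (Suc n) p \<alpha> = \<infinity>" unfolding Lm .
    \<comment> \<open>Covers \<open>a = 0\<close> as well. For \<open>d = 0\<close> the second
      factor of the term is 1, so the product is infinite in every case.\<close>
    have dinf: "\<infinity> / ereal r = \<infinity>" if "0 \<le> r" for r
      using that by (cases "r = 0") (auto simp: divide_ereal_def)
    have "trm n = \<infinity>" unfolding trm_def Linf G inf by (simp add: dinf ereal_powr_def)
    then show False using term_fin[of n] by simp
  qed
  have Tfin: "T n j \<in> fin" for n j
  proof (rule finI[OF TH])
    let ?C = "\<alpha> * s (Suc j) / t (Suc j)"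
    have f: "T (Suc j) j \<in> fin" using TH Gfin[of j] unfolding fin_def T_def by simp
    show "(\<lambda>\<omega>. 2 powr p * (T (Suc j) j \<omega> + ?C powr p)) \<in> H"
      by (rule fin_H[OF fin_scale[OF fin_add[OF f fin_const]]])
    show "E (\<lambda>\<omega>. 2 powr p * (T (Suc j) j \<omega> + ?C powr p)) < \<infinity>"
      using E_fin[OF fin_scale[OF fin_add[OF f fin_const]]] by simp
    show "\<bar>T n j \<omega>\<bar> \<le> 2 powr p * (T (Suc j) j \<omega> + ?C powr p)" for \<omega>
      using max_tail_powr_le[OF c0 c0, of p "X (Suc j) \<omega>" n "Suc j"] p by (simp add: T_def)
  qed
  interpret R: lil_truncation M H E X \<alpha> p d
    by unfold_locales (fact \<alpha>, fact p, fact d, rule Tfin[unfolded Teq])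
  have ET: "E (T n j) = ereal (R.raw n j)" for n j
    unfolding E_fin[OF Tfin] unfolding R.raw_def R.c_def Teq ..
  define f where "f n = R.raw (Suc n) n / a (Suc n) powr p * R.b (Suc n) powr d" for n
  \<comment> \<open>Spares a comparison of real with extended division by zero while
    \<open>u\<close> is 0.\<close>
  define f' where "f' n = (if 0 < u (Suc n) then f n else 0)" for n
  have f0: "0 \<le> f' n" for n
    unfolding f'_def f_def using R.raw_nonneg[of n "Suc n"] by simp
  have le: "ereal (f' n) \<le> trm n" for n
  proof (cases "0 < u (Suc n)")
    case True
    have ap: "0 < a (Suc n) powr p" using a_pos[OF True] by simp
    have 1: "Gamma_trunc E X (Suc n) p \<alpha> / ereal (a_seq E X (Suc n) powr p) = ereal (R.raw (Suc n) n / a (Suc n) powr p)"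
      unfolding G ET a_seq_eq using ap by simp
    have "(\<Sum>j<Suc n. E (T (Suc n) j)) = ereal (R.Lam (Suc n))" unfolding ET R.Lam_def by (simp only: sum_ereal)
    then have 2: "Lambda_trunc E X (Suc n) p \<alpha> / ereal (a_seq E X (Suc n) powr p) = ereal (R.b (Suc n))"
      unfolding Lm a_seq_eq R.b_def using ap by simp
    \<comment> \<open>Only an inequality: at base 0 and exponent 0 the left side is 0 and the right
      side 1.\<close>
    have 3: "ereal (R.b (Suc n) powr d) \<le> ereal_powr (ereal (R.b (Suc n))) d"
      unfolding ereal_powr_def by (auto simp: one_ereal_def)
    have "ereal (f' n) = ereal (R.raw (Suc n) n / a (Suc n) powr p) * ereal (R.b (Suc n) powr d)"
      using True by (simp add: f'_def f_def)
    also have "\<dots> \<le> ereal (R.raw (Suc n) n / a (Suc n) powr p) * ereal_powr (ereal (R.b (Suc n))) d"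
      using R.raw_nonneg[of n "Suc n"] by (intro ereal_mult_left_mono 3) simp
    finally show ?thesis unfolding trm_def 1 2 .
  next
    case False
    then have "ereal (f' n) = 0" by (simp add: f'_def zero_ereal_def)
    then show ?thesis using term0[of n] by (simp only:)
  qed
  have "(\<Sum>n. ereal (f' n)) \<le> suminf trm" by (intro suminf_le_pos le) (use f0 in simp)
  then have "summable f'" using trm_sum by (intro summable_of_ereal_suminf f0) (rule le_less_trans)
  moreover have "\<forall>\<^sub>F n in sequentially. f n = f' n"
  proof -
    obtain m where "\<And>n. m \<le> n \<Longrightarrow> 0 < u n" using L.eventually_u_pos unfolding eventually_sequentially by blast
    then show ?thesis unfolding eventually_sequentially f'_def by (intro exI[of _ m]) simp
  qed
  ultimately have "summable f" using summable_cong[of f f'] by blast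
  then have "summable (\<lambda>n. R.raw (Suc n) n / a (Suc n) powr p * R.b (Suc n) powr d)"
    unfolding f_def[abs_def] .
  then have "lil_full M H E X \<alpha> p d" by unfold_locales (assumption, rule exceed_hat)
  then show ?thesis by blast
qed

end

section \<open>Conclusion\<close>

context lil_hypotheses
begin

lemma upper_bound:
  assumes "0 < \<epsilon>" "\<epsilon> \<le> 1" "0 < \<eta>"
  shows "\<exists>n1. small_cover \<eta> (\<lambda>m. if n1 \<le> m then {\<omega> \<in> space M. (1 + \<epsilon>) * a m < S m \<omega>} else {})"
proof -
  \<comment> \<open>Gives \<open>exp (2 * \<alpha>) \<le> 1 + \<epsilon> / 8\<close>, inside the
    margin \<open>\<epsilon> / 4\<close>.\<close>
  define \<alpha> where "\<alpha> = \<epsilon> / 32"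
  have \<alpha>: "0 < \<alpha>" using assms by (simp add: \<alpha>_def)
  obtain p d where "lil_full M H E X \<alpha> p d" using lil_full_exists[OF \<alpha>] by blast
  then interpret L: lil_full M H E X \<alpha> p d .
  have "exp (2 * \<alpha>) \<le> 1 + 2 * (2 * \<alpha>)" 
    using exp_bound_lemma[of "2 * \<alpha>"] assms by (simp add: \<alpha>_def)
  then have "exp (2 * \<alpha>) \<le> 1 + \<epsilon> / 4" using assms by (simp add: \<alpha>_def)
  then show ?thesis using L.upper_small_cover assms by blast
qed

lemma lower_bound:
  assumes neg: "\<And>\<eta>. 0 < \<eta> \<Longrightarrow> \<exists>n1. small_cover \<eta> (\<lambda>m. if n1 \<le> m then {\<omega> \<in> space M. 2 * a m < - S m \<omega>} else {})"
    and \<epsilon>: "0 < \<epsilon>" "\<epsilon> \<le> 7 / 10" and \<eta>: "0 < \<eta>"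
  shows "\<exists>N\<ge>n0. 1 - \<eta> \<le> V {\<omega> \<in> space M. \<exists>m\<in>{n0..N}. (1 - \<epsilon>) * a m \<le> S m \<omega>}"
proof -
  \<comment> \<open>The total loss in \<open>lower_main\<close> is
    \<open>7 * \<delta>\<close>.\<close>
  define \<delta> where "\<delta> = \<epsilon> / 7"
  have \<delta>: "0 < \<delta>" "\<delta> \<le> 1 / 10" using \<epsilon> by (auto simp: \<delta>_def)
  have \<delta>2: "0 < \<delta>\<^sup>2" "\<delta>\<^sup>2 \<le> 1 / 100" using \<delta> power_mono[of \<delta> "1 / 10" 2] by (auto simp: power2_eq_square)
  define \<alpha> where "\<alpha> = \<delta>\<^sup>2 / 1024"
  define \<Theta> where "\<Theta> = 128 / \<delta>\<^sup>2"
  have \<alpha>: "0 < \<alpha>" "\<alpha> \<le> 1 / 32" using \<delta>2 by (auto simp: \<alpha>_def)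
  have \<Theta>: "1 < \<Theta>" using \<delta>2 by (simp add: \<Theta>_def)
  have \<Theta>i: "1 / \<Theta> = \<delta>\<^sup>2 / 128" by (simp add: \<Theta>_def)
  have sq: "2 * sqrt (1 / \<Theta>) \<le> \<delta>"
  proof -
    have "sqrt (1 / \<Theta>) \<le> sqrt ((\<delta> / 2)\<^sup>2)" unfolding \<Theta>i using \<delta>2 by (intro real_sqrt_le_mono) (simp add: power_divide)
    then show ?thesis using \<delta> by simp
  qed
  have e1: "exp (4 * \<alpha>) \<le> 1 + \<delta>\<^sup>2 / 32"
  proof -
    have "exp (4 * \<alpha>) \<le> 1 + 2 * (4 * \<alpha>)" using exp_bound_lemma[of "4 * \<alpha>"] \<alpha> by simp
    moreover have "2 * (4 * \<alpha>) \<le> \<delta>\<^sup>2 / 32" using \<delta>2 by (simp add: \<alpha>_def)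
    ultimately show ?thesis by linarith
  qed
  have e2: "1 - 20 * \<alpha> \<le> exp (- 4 * \<alpha>) - 16 * \<alpha>" using exp_ge_add_one_self[of "- 4 * \<alpha>"] by simp
  have e3: "0 \<le> exp (- 4 * \<alpha>) - 16 * \<alpha>" using e2 \<alpha> by linarith
  have e4: "1 - \<delta>\<^sup>2 / 32 \<le> (exp (- 4 * \<alpha>) - 16 * \<alpha>) * (1 - 1 / \<Theta>)"
  proof -
    have "1 - \<delta>\<^sup>2 / 32 \<le> 1 - 20 * \<alpha> - \<delta>\<^sup>2 / 128" using \<delta>2 by (simp add: \<alpha>_def)
    also have "\<dots> \<le> (1 - 20 * \<alpha>) * (1 - \<delta>\<^sup>2 / 128)"
    proof -
      have "0 \<le> 20 * \<alpha> * (\<delta>\<^sup>2 / 128)" using \<alpha> by simp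
      then show ?thesis by (simp add: algebra_simps)
    qed
    also have "\<dots> \<le> (exp (- 4 * \<alpha>) - 16 * \<alpha>) * (1 - \<delta>\<^sup>2 / 128)"
      using e2 \<delta>2 by (intro mult_right_mono) auto
    finally show ?thesis unfolding \<Theta>i .
  qed
  obtain p d where "lil_full M H E X \<alpha> p d" using lil_full_exists[OF \<alpha>(1)] by blast
  then interpret L: lil_full M H E X \<alpha> p d .
  have "\<exists>N\<ge>n0. 1 - \<eta> \<le> V {\<omega> \<in> space M. \<exists>m\<in>{n0..N}. (1 - 7 * \<delta>) * a m \<le> S m \<omega>}"
    using \<delta> by (intro L.lower_main[OF cap propC \<delta> \<Theta> sq e1 e4 \<alpha>(2) e3 neg diverge \<eta>]) auto
  then show ?thesis by (simp add: \<delta>_def)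
qed

end

text \<open>Test functions are closed under reflecting the argument, so independence is applied to
  the reflected function \<psi>; conditions over all vectors are insensitive to reflection.\<close>

lemma independent_to_uminus:
  assumes "independent_to H E n Y m X" and sc: "\<And>Z c. Z \<in> H \<Longrightarrow> (\<lambda>\<omega>. c * Z \<omega>) \<in> H"
  shows "independent_to H E n (\<lambda>i \<omega>. - Y i \<omega>) m (\<lambda>i \<omega>. - X i \<omega>)"
  unfolding independent_to_def
proof (intro conjI ballI)
  have mem: "\<forall>i<n. Y i \<in> H" "\<forall>i<m. X i \<in> H" using assms(1) unfolding independent_to_def by blast+
  show "\<forall>i<n. (\<lambda>\<omega>. - Y i \<omega>) \<in> H" "\<forall>i<m. (\<lambda>\<omega>. - X i \<omega>) \<in> H"
    using mem sc[of _ "-1"] by simp_all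
  fix \<phi> assume \<phi>: "\<phi> \<in> C_lLip (m + n)"
  define \<psi> where "\<psi> x = \<phi> (\<lambda>i. - x i)" for x :: "nat \<Rightarrow> real"
  have "\<psi> \<in> C_lLip (m + n)"
  proof -
    obtain C k where C: "C > 0" "\<And>x y. \<bar>\<phi> x - \<phi> y\<bar> \<le> C * (1 + L2_set x {..<m + n} ^ k + L2_set y {..<m + n} ^ k)
                       * L2_set (\<lambda>i. x i - y i) {..<m + n}"
      using \<phi> unfolding C_lLip_def by blast
    have neg: "L2_set (\<lambda>i. - x i) A = L2_set x A" for x :: "nat \<Rightarrow> real" and A by (simp add: L2_set_def)
    have neg2: "L2_set (\<lambda>i. - x i - - y i) A = L2_set (\<lambda>i. x i - y i) A" for x y :: "nat \<Rightarrow> real" and A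
      using neg[of "\<lambda>i. x i - y i" A] by simp
    show ?thesis unfolding C_lLip_def \<psi>_def
      using C(1) C(2)[of "\<lambda>i. - _ i" "\<lambda>i. - _ i", unfolded neg neg2] by blast
  qed
  moreover have app: "vec_append m (\<lambda>i. - x i) (\<lambda>i. - y i) = (\<lambda>i. - vec_append m x y i)" for x y
    by (auto simp: vec_append_def fun_eq_iff)
  have app1: "\<phi> (vec_append m x (\<lambda>i. - y i)) = \<psi> (vec_append m (\<lambda>i. - x i) y)" for x y
    unfolding \<psi>_def app[symmetric] by simp
  have app2: "\<phi> (vec_append m (\<lambda>i. - x i) (\<lambda>i. - y i)) = \<psi> (vec_append m x y)" for x y
    unfolding \<psi>_def app by simp
  have all: "(\<forall>x. P (\<lambda>i. - x i)) \<Longrightarrow> (\<forall>x. P x)" for P :: "(nat \<Rightarrow> real) \<Rightarrow> bool"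
  proof
    fix x assume "\<forall>x. P (\<lambda>i. - x i)"
    then have "P (\<lambda>i. - (\<lambda>i. - x i) i)" by (rule spec)
    then show "P x" by simp
  qed
  ultimately have ind: "(\<forall>x. E (\<lambda>\<omega>. \<bar>\<psi> (vec_append m x (\<lambda>i. Y i \<omega>))\<bar>) < \<infinity>) \<longrightarrow>
      (\<lambda>\<omega>. real_of_ereal (E (\<lambda>\<omega>'. \<bar>\<psi> (vec_append m (\<lambda>i. X i \<omega>) (\<lambda>i. Y i \<omega>'))\<bar>))) \<in> H \<longrightarrow>
      E (\<lambda>\<omega>. \<bar>real_of_ereal (E (\<lambda>\<omega>'. \<bar>\<psi> (vec_append m (\<lambda>i. X i \<omega>) (\<lambda>i. Y i \<omega>'))\<bar>))\<bar>) < \<infinity> \<longrightarrow>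
      (\<lambda>\<omega>. real_of_ereal (E (\<lambda>\<omega>'. \<psi> (vec_append m (\<lambda>i. X i \<omega>) (\<lambda>i. Y i \<omega>'))))) \<in> H \<longrightarrow>
      E (\<lambda>\<omega>. \<psi> (vec_append m (\<lambda>i. X i \<omega>) (\<lambda>i. Y i \<omega>))) =
      E (\<lambda>\<omega>. real_of_ereal (E (\<lambda>\<omega>'. \<psi> (vec_append m (\<lambda>i. X i \<omega>) (\<lambda>i. Y i \<omega>')))))"
    using assms(1) unfolding independent_to_def Let_def by blast
  have fin: "(\<forall>x. E (\<lambda>\<omega>. \<bar>\<psi> (vec_append m x (\<lambda>i. Y i \<omega>))\<bar>) < \<infinity>)"
    if "\<forall>x. E (\<lambda>\<omega>. \<bar>\<psi> (vec_append m (\<lambda>i. - x i) (\<lambda>i. Y i \<omega>))\<bar>) < \<infinity>"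
    using all[of "\<lambda>x. E (\<lambda>\<omega>. \<bar>\<psi> (vec_append m x (\<lambda>i. Y i \<omega>))\<bar>) < \<infinity>"] that by blast
  show "let abs_inner = (\<lambda>x. E (\<lambda>\<omega>. \<bar>\<phi> (vec_append m x (\<lambda>i. - Y i \<omega>))\<bar>));
            inner = (\<lambda>x. E (\<lambda>\<omega>. \<phi> (vec_append m x (\<lambda>i. - Y i \<omega>))));
            abs_inner_X = (\<lambda>\<omega>. real_of_ereal (abs_inner (\<lambda>i. - X i \<omega>)));
            inner_X = (\<lambda>\<omega>. real_of_ereal (inner (\<lambda>i. - X i \<omega>)))
        in (\<forall>x. abs_inner x < \<infinity>) \<longrightarrow> abs_inner_X \<in> H \<longrightarrow> E (\<lambda>\<omega>. \<bar>abs_inner_X \<omega>\<bar>) < \<infinity> \<longrightarrow>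
           inner_X \<in> H \<longrightarrow>
           E (\<lambda>\<omega>. \<phi> (vec_append m (\<lambda>i. - X i \<omega>) (\<lambda>i. - Y i \<omega>))) = E inner_X"
    unfolding Let_def app2 unfolding app1 using ind fin by blast
qed

section \<open>Null sets of the countably sub-additive extension\<close>

context sublinear_expectation_space
begin

lemma V_hat_star_nonneg: "0 \<le> V_hat_star M H E A"
  unfolding V_hat_star_def by (rule Inf_greatest) (auto intro!: suminf_0_le V_hat_nonneg)

lemma V_hat_star_mono:
  assumes "A \<subseteq> B" shows "V_hat_star M H E A \<le> V_hat_star M H E B"
  unfolding V_hat_star_def
proof (rule Inf_superset_mono, rule subsetI)
  fix x assume "x \<in> {(\<Sum>n. V_hat M H E (C n)) |C. range C \<subseteq> sets M \<and> B \<subseteq> (\<Union>n. C n)}"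
  then obtain C where C: "x = (\<Sum>n. V_hat M H E (C n))" "range C \<subseteq> sets M" "B \<subseteq> (\<Union>n. C n)"
    by (elim CollectE exE conjE)
  from assms C(3) have "A \<subseteq> (\<Union>n. C n)" by (rule order_trans)
  with C(1,2) show "x \<in> {(\<Sum>n. V_hat M H E (C n)) |C. range C \<subseteq> sets M \<and> A \<subseteq> (\<Union>n. C n)}"
    by (intro CollectI exI conjI)
qed

text \<open>The k-th set receives a cover of size \<open>\<eta> / 2 ^ Suc k\<close>, and the members
  of all covers are enumerated by pairing.\<close>

lemma V_hat_star_countable_null:
  fixes F :: "nat \<Rightarrow> 'a set"
  assumes "\<And>k \<eta>. 0 < \<eta> \<Longrightarrow> \<exists>A. small_cover \<eta> A \<and> F k \<subseteq> (\<Union>n. A n)"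
  shows "V_hat_star M H E (\<Union>k. F k) = 0"
proof (rule antisym[OF _ V_hat_star_nonneg], rule ereal_le_epsilon2)
  fix \<eta> :: real assume \<eta>: "0 < \<eta>"
  define h where "h k = \<eta> * (1 / 2) ^ Suc k" for k
  have h: "0 < h k" for k using \<eta> by (simp add: h_def)
  have hs: "h sums \<eta>"
    unfolding h_def using sums_mult[OF power_half_series, of \<eta>] by simp
  have "\<exists>B. (\<forall>i. B i \<in> sets M) \<and> F k \<subseteq> (\<Union>i. B i) \<and> (\<Sum>i. V_hat M H E (B i)) \<le> ereal (h k)" for k
  proof -
    obtain A where A: "small_cover (h k) A" "F k \<subseteq> (\<Union>n. A n)" using assms[OF h] by blast
    obtain B r where B: "\<And>i. B i \<in> sets M" "\<And>i. hat_le (B i) (r i)" "\<And>I. (\<Sum>i<(I::nat). r i) \<le> h k"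
      "\<And>n. \<exists>I. A n \<subseteq> (\<Union>i<I. B i)" using A(1) by (rule small_cover_E) blast
    have "A n \<subseteq> (\<Union>i. B i)" for n using B(4)[of n] by (elim exE) (erule order_trans, auto)
    then have "F k \<subseteq> (\<Union>i. B i)" by (intro order_trans[OF A(2)] UN_least)
    moreover have "(\<Sum>i. V_hat M H E (B i)) \<le> ereal (h k)"
    proof (rule suminf_bound, rule allI)
      fix N
      have "(\<Sum>i<N. V_hat M H E (B i)) \<le> (\<Sum>i<N. ereal (r i))" by (intro sum_mono V_hat_le B)
      also have "\<dots> = ereal (\<Sum>i<N. r i)" by simp
      also have "\<dots> \<le> ereal (h k)" using B(3) by simp
      finally show "(\<Sum>i<N. V_hat M H E (B i)) \<le> ereal (h k)" .
    qed (rule V_hat_nonneg)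
    ultimately show ?thesis using B(1) by (intro exI[of _ B]) simp
  qed
  then have "\<forall>k. \<exists>B. (\<forall>i. B i \<in> sets M) \<and> F k \<subseteq> (\<Union>i. B i) \<and> (\<Sum>i. V_hat M H E (B i)) \<le> ereal (h k)" ..
  from choice[OF this] obtain B where B: "\<And>k i. B k i \<in> sets M" "\<And>k. F k \<subseteq> (\<Union>i. B k i)"
    "\<And>k. (\<Sum>i. V_hat M H E (B k i)) \<le> ereal (h k)" by auto
  define C where "C n = (case prod_decode n of (k, i) \<Rightarrow> B k i)" for n
  have "V_hat_star M H E (\<Union>k. F k) \<le> (\<Sum>n. V_hat M H E (C n))"
    unfolding V_hat_star_def
  proof (rule Inf_lower, intro CollectI exI[of _ C] conjI refl)
    show "range C \<subseteq> sets M" unfolding C_def using B(1) by (auto split: prod.split)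
    show "(\<Union>k. F k) \<subseteq> (\<Union>n. C n)"
    proof
      fix \<omega> assume "\<omega> \<in> (\<Union>k. F k)"
      then obtain k i where "\<omega> \<in> B k i" using B(2) by blast
      then have "\<omega> \<in> C (prod_encode (k, i))" by (simp add: C_def)
      then show "\<omega> \<in> (\<Union>n. C n)" by blast
    qed
  qed
  also have "\<dots> \<le> ereal \<eta>"
  proof (rule suminf_bound, rule allI)
    fix N
    let ?f = "\<lambda>q. V_hat M H E (B (fst q) (snd q))"
    \<comment> \<open>A square of pairs containing the first \<open>N\<close> enumerated ones; by
      nonnegativity the sum may be extended to all of it.\<close>
    define L where "L = Suc (\<Sum>n<N. fst (prod_decode n) + snd (prod_decode n))"
    have sub: "prod_decode ` {..<N} \<subseteq> {..<L} \<times> {..<L}"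
    proof (rule image_subsetI)
      fix n assume "n \<in> {..<N}"
      then have "fst (prod_decode n) + snd (prod_decode n) \<le> (\<Sum>n<N. fst (prod_decode n) + snd (prod_decode n))"
        by (intro member_le_sum) auto
      then show "prod_decode n \<in> {..<L} \<times> {..<L}" by (simp add: L_def mem_Times_iff)
    qed
    have "(\<Sum>n<N. V_hat M H E (C n)) = (\<Sum>n<N. ?f (prod_decode n))" unfolding C_def by (simp add: case_prod_beta)
    also have "\<dots> = (\<Sum>q\<in>prod_decode ` {..<N}. ?f q)"
      by (simp only: sum.reindex[OF inj_prod_decode] comp_def)
    also have "\<dots> \<le> (\<Sum>q\<in>{..<L} \<times> {..<L}. ?f q)" by (intro sum_mono2 sub V_hat_nonneg) simp
    also have "\<dots> = (\<Sum>k<L. \<Sum>i<L. V_hat M H E (B k i))" by (simp add: sum.cartesian_product case_prod_beta)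
    also have "\<dots> \<le> (\<Sum>k<L. ereal (h k))"
      by (intro sum_mono order_trans[OF suminf_upper B(3)] V_hat_nonneg)
    also have "\<dots> = ereal (\<Sum>k<L. h k)" by simp
    also have "(\<Sum>k<L. h k) \<le> \<eta>"
      using hs h sum_le_suminf[of h "{..<L}"] by (simp add: sums_iff less_imp_le)
    finally show "(\<Sum>n<N. V_hat M H E (C n)) \<le> ereal \<eta>" by simp
  qed (rule V_hat_nonneg)
  finally show "V_hat_star M H E (\<Union>k. F k) \<le> 0 + ereal \<eta>" by simp
qed

end

context lil_hypotheses
begin

lemma uminus_square_integrable: "independent_square_integrable M H E (\<lambda>n \<omega>. - X n \<omega>)"
proof unfold_locales
  have mem: "X i \<in> H" if "1 \<le> i" for i using X_H that by blast
  show "independent_seq H E (\<lambda>n \<omega>. - X n \<omega>)"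
    unfolding independent_seq_def
  proof (intro conjI allI impI)
    fix i :: nat assume i: "1 \<le> i"
    show "(\<lambda>\<omega>. - X i \<omega>) \<in> H" using scale_H[OF mem[OF i], of "-1"] by simp
    have "independent_to H E 1 (\<lambda>_. X (i + 1)) i (\<lambda>j. X (j + 1))"
      using indep i unfolding independent_seq_def by blast
    from independent_to_uminus[OF this scale_H]
    show "independent_to H E 1 (\<lambda>_ \<omega>. - X (i + 1) \<omega>) i (\<lambda>j \<omega>. - X (j + 1) \<omega>)" by simp
  qed
  show "E (\<lambda>\<omega>. (- X n \<omega>)\<^sup>2) < \<infinity>" if "1 \<le> n" for n using square_fin[OF that] by simp
qed

lemma s_seq_uminus: "s_seq E (\<lambda>n \<omega>. - X n \<omega>) = s_seq E X"
  by (rule ext) (simp add: s_seq_def)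

lemma t_seq_uminus: "t_seq E (\<lambda>n \<omega>. - X n \<omega>) = t_seq E X"
  by (rule ext) (simp add: t_seq_def s_seq_uminus)

lemma a_seq_uminus: "a_seq E (\<lambda>n \<omega>. - X n \<omega>) = a_seq E X"
  by (rule ext) (simp add: a_seq_def s_seq_uminus t_seq_uminus)

text \<open>Truncated moments, variances and exceedances depend on absolute values only; in the mean
  condition reflection exchanges \<open>E\<close> and its conjugate up to sign.\<close>

lemma uminus: "lil_hypotheses M H E (\<lambda>n \<omega>. - X n \<omega>) V"
proof (rule lil_hypotheses.intro[OF uminus_square_integrable], unfold_locales)
  show "subadditive_capacity M V" "property_C M H E V" by (fact cap, fact propC)
  show "(\<Sum>n. ereal (V {\<omega> \<in> space M. \<bar>- X (Suc n) \<omega>\<bar> \<ge> \<epsilon> * a_seq E (\<lambda>n \<omega>. - X n \<omega>) (Suc n)})) < \<infinity>"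
    if "\<epsilon> > 0" for \<epsilon> using exceedances[OF that] unfolding a_seq_uminus by simp
  show "\<exists>p\<ge>2. \<exists>d\<ge>0.
     (\<Sum>n. Gamma_trunc E (\<lambda>n \<omega>. - X n \<omega>) (Suc n) p \<alpha> / ereal (a_seq E (\<lambda>n \<omega>. - X n \<omega>) (Suc n) powr p) *
       ereal_powr (Lambda_trunc E (\<lambda>n \<omega>. - X n \<omega>) (Suc n) p \<alpha> / ereal (a_seq E (\<lambda>n \<omega>. - X n \<omega>) (Suc n) powr p)) d) < \<infinity>"
    if "\<alpha> > 0" for \<alpha>
    using truncated[OF that] unfolding a_seq_uminus Gamma_trunc_def Lambda_trunc_def s_seq_uminus t_seq_uminus by simp
  show "(\<Sum>n. ereal (1 / (s_seq E (\<lambda>n \<omega>. - X n \<omega>) (Suc n))\<^sup>2 * Log ((s_seq E (\<lambda>n \<omega>. - X n \<omega>) (Suc n))\<^sup>2) powr (\<delta> - 1))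
     * E (\<lambda>\<omega>. (- X (Suc n) \<omega>)\<^sup>2)) = \<infinity>" if "\<delta> > 0" for \<delta>
    using variance[OF that] unfolding s_seq_uminus by simp
  have "\<bar>E (\<lambda>\<omega>. - X j \<omega>)\<bar> = \<bar>conjugate_expectation E (X j)\<bar>"
    "\<bar>conjugate_expectation E (\<lambda>\<omega>. - X j \<omega>)\<bar> = \<bar>E (X j)\<bar>" for j
    by (simp_all add: conjugate_expectation_def)
  then show "(\<lambda>n. ((\<Sum>j=1..n. \<bar>E (\<lambda>\<omega>. - X j \<omega>)\<bar>) + (\<Sum>j=1..n. \<bar>conjugate_expectation E (\<lambda>\<omega>. - X j \<omega>)\<bar>))
     / ereal (a_seq E (\<lambda>n \<omega>. - X n \<omega>) n)) \<longlonglongrightarrow> 0"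
    using means unfolding a_seq_uminus by (simp add: add.commute)
qed

lemma capacity_bounds:
  assumes "A \<in> sets M" shows "0 \<le> V A" "V A \<le> 1"
  using cap assms unfolding subadditive_capacity_def capacity_def by blast+

lemma eventually_a_pos: "\<forall>\<^sub>F n in sequentially. 0 < a n"
proof -
  interpret lil_setting M H E X by (rule lil_setting)
  show ?thesis using eventually_u_pos by eventually_elim (rule a_pos)
qed

end

text \<open>Both signs side by side: the lower half for \<open>X\<close> needs the upper half for
  \<open>- X\<close>, which bounds the preceding partial sum from below.\<close>

locale lil_two_sided = P: lil_hypotheses M H E X V + Q: lil_hypotheses M H E "\<lambda>n \<omega>. - X n \<omega>" V
  for M :: "'a measure" and H E and X :: "nat \<Rightarrow> 'a \<Rightarrow> real" and V
begin

lemma Q_a: "Q.a n = P.a n"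
  using Q.a_seq_eq[of n] P.a_seq_eq[of n] by (simp add: P.a_seq_uminus)

lemma Q_S: "Q.S n \<omega> = - P.S n \<omega>"
  by (simp add: P.S_def Q.S_def sum_negf)

lemma two_sided_small_cover:
  assumes "0 < \<epsilon>" "\<epsilon> \<le> 1" "0 < \<eta>"
  shows "\<exists>n1. P.small_cover \<eta> (\<lambda>m. if n1 \<le> m then {\<omega> \<in> space M. (1 + \<epsilon>) * P.a m < \<bar>P.S m \<omega>\<bar>} else {})"
proof -
  have h: "0 < \<eta> / 2" using assms by simp
  obtain n1 where n1: "P.small_cover (\<eta> / 2) (\<lambda>m. if n1 \<le> m then {\<omega> \<in> space M. (1 + \<epsilon>) * P.a m < P.S m \<omega>} else {})"
    using P.upper_bound[OF assms(1,2) h] by blast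
  obtain n2 where n2: "P.small_cover (\<eta> / 2) (\<lambda>m. if n2 \<le> m then {\<omega> \<in> space M. (1 + \<epsilon>) * P.a m < - P.S m \<omega>} else {})"
    using Q.upper_bound[OF assms(1,2) h] unfolding Q_a Q_S by blast
  from P.small_cover_Un[OF n1 n2]
  have "P.small_cover \<eta> (\<lambda>m. (if n1 \<le> m then {\<omega> \<in> space M. (1 + \<epsilon>) * P.a m < P.S m \<omega>} else {}) \<union>
      (if n2 \<le> m then {\<omega> \<in> space M. (1 + \<epsilon>) * P.a m < - P.S m \<omega>} else {}))" by simp
  then have "P.small_cover \<eta> (\<lambda>m. if max n1 n2 \<le> m then {\<omega> \<in> space M. (1 + \<epsilon>) * P.a m < \<bar>P.S m \<omega>\<bar>} else {})"
    by (rule P.small_cover_cover) (rule exI[of _ "Suc _"], rule order_trans[OF _ UN_upper[of _ "{..<Suc _}"]], auto)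
  then show ?thesis by blast
qed

text \<open>One small cover bounds \<open>V\<close> for all horizons \<open>N\<close> and all late
  \<open>n\<close> at once, hence also the supremum over \<open>N\<close>.\<close>

lemma upper_limit:
  assumes "0 < \<epsilon>"
  shows "(\<lambda>n. SUP N\<in>{n..}. V {\<omega> \<in> space M. (MAX m\<in>{n..N}. \<bar>P.S m \<omega>\<bar> / P.a m) > 1 + \<epsilon>}) \<longlonglongrightarrow> 0"
proof (rule LIMSEQ_I)
  fix r :: real assume r: "0 < r"
  define \<epsilon>' where "\<epsilon>' = min \<epsilon> 1"
  have \<epsilon>': "0 < \<epsilon>'" "\<epsilon>' \<le> 1" "\<epsilon>' \<le> \<epsilon>" using assms by (auto simp: \<epsilon>'_def)
  have r2: "0 < r / 2" using r by simp
  obtain n1 where n1: "P.small_cover (r / 2) (\<lambda>m. if n1 \<le> m then {\<omega> \<in> space M. (1 + \<epsilon>') * P.a m < \<bar>P.S m \<omega>\<bar>} else {})"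
    using two_sided_small_cover[OF \<epsilon>'(1,2) r2] by blast
  obtain n2 where n2: "\<And>n. n2 \<le> n \<Longrightarrow> 0 < P.a n"
    using P.eventually_a_pos unfolding eventually_sequentially by blast
  have bound: "0 \<le> V {\<omega> \<in> space M. (MAX m\<in>{n..N}. \<bar>P.S m \<omega>\<bar> / P.a m) > 1 + \<epsilon>} \<and>
      V {\<omega> \<in> space M. (MAX m\<in>{n..N}. \<bar>P.S m \<omega>\<bar> / P.a m) > 1 + \<epsilon>} \<le> r / 2"
    if n: "max n1 n2 \<le> n" and N: "n \<le> N" for n N
  proof -
    let ?F = "{\<omega> \<in> space M. \<exists>m\<in>{n..N}. 1 + \<epsilon> < \<bar>P.S m \<omega>\<bar> / P.a m}"
    have eq: "{\<omega> \<in> space M. (MAX m\<in>{n..N}. \<bar>P.S m \<omega>\<bar> / P.a m) > 1 + \<epsilon>} = ?F"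
      using N by (auto simp: Max_gr_iff)
    have F: "?F \<in> sets M" by measurable
    have "V ?F \<le> r / 2"
    proof (rule P.small_cover_V_le[OF n1 P.propC F, of "Suc N"])
      show "?F \<inter> space M \<subseteq> (\<Union>i<Suc N. if n1 \<le> i then {\<omega> \<in> space M. (1 + \<epsilon>') * P.a i < \<bar>P.S i \<omega>\<bar>} else {})"
      proof
        fix \<omega> assume "\<omega> \<in> ?F \<inter> space M"
        then obtain m where m: "\<omega> \<in> space M" "m \<in> {n..N}" "1 + \<epsilon> < \<bar>P.S m \<omega>\<bar> / P.a m" by blast
        have am: "0 < P.a m" using n2 m n by simp
        have "(1 + \<epsilon>') * P.a m \<le> (1 + \<epsilon>) * P.a m" using \<epsilon>' am by (intro mult_right_mono) auto
        also have "\<dots> < \<bar>P.S m \<omega>\<bar>" using m(3) am by (simp only: pos_less_divide_eq)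
        finally show "\<omega> \<in> (\<Union>i<Suc N. if n1 \<le> i then {\<omega> \<in> space M. (1 + \<epsilon>') * P.a i < \<bar>P.S i \<omega>\<bar>} else {})"
          using m n by (intro UN_I[of m]) auto
      qed
    qed
    then show ?thesis unfolding eq using P.capacity_bounds[OF F] by blast
  qed
  show "\<exists>no. \<forall>n\<ge>no. norm ((SUP N\<in>{n..}. V {\<omega> \<in> space M. (MAX m\<in>{n..N}. \<bar>P.S m \<omega>\<bar> / P.a m) > 1 + \<epsilon>}) - 0) < r"
  proof (intro exI[of _ "max n1 n2"] allI impI)
    fix n assume n: "max n1 n2 \<le> n"
    let ?f = "\<lambda>N. V {\<omega> \<in> space M. (MAX m\<in>{n..N}. \<bar>P.S m \<omega>\<bar> / P.a m) > 1 + \<epsilon>}"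
    have le: "(SUP N\<in>{n..}. ?f N) \<le> r / 2" using bound[OF n] by (intro cSUP_least) auto
    have "0 \<le> ?f n" using bound[OF n] by blast
    also have "\<dots> \<le> (SUP N\<in>{n..}. ?f N)"
      using bound[OF n] by (intro cSUP_upper bdd_aboveI2[where M = "r / 2"]) auto
    finally show "norm ((SUP N\<in>{n..}. ?f N) - 0) < r" using le r by simp
  qed
qed

lemma lower_limit:
  assumes \<epsilon>: "0 < \<epsilon>"
  shows "(\<lambda>n. SUP N\<in>{n..}. V {\<omega> \<in> space M. (MAX m\<in>{n..N}. P.S m \<omega> / P.a m) \<ge> 1 - \<epsilon>}) \<longlonglongrightarrow> 1"
proof (rule LIMSEQ_I)
  fix r :: real assume r: "0 < r"
  define \<epsilon>' where "\<epsilon>' = min \<epsilon> (7 / 10)"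
  have \<epsilon>': "0 < \<epsilon>'" "\<epsilon>' \<le> 7 / 10" "\<epsilon>' \<le> \<epsilon>" using assms by (auto simp: \<epsilon>'_def)
  have r2: "0 < r / 2" using r by simp
  \<comment> \<open>The upper half for \<open>- X\<close> with \<epsilon> = 1.\<close>
  have neg: "\<exists>n1. P.small_cover \<eta> (\<lambda>m. if n1 \<le> m then {\<omega> \<in> space M. 2 * P.a m < - P.S m \<omega>} else {})" if "0 < \<eta>" for \<eta>
    using Q.upper_bound[OF zero_less_one order_refl that] unfolding Q_a Q_S one_add_one .
  obtain n2 where n2: "\<And>n. n2 \<le> n \<Longrightarrow> 0 < P.a n"
    using P.eventually_a_pos unfolding eventually_sequentially by blast
  show "\<exists>no. \<forall>n\<ge>no. norm ((SUP N\<in>{n..}. V {\<omega> \<in> space M. (MAX m\<in>{n..N}. P.S m \<omega> / P.a m) \<ge> 1 - \<epsilon>}) - 1) < r"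
  proof (intro exI[of _ n2] allI impI)
    fix n assume n: "n2 \<le> n"
    let ?f = "\<lambda>N. V {\<omega> \<in> space M. (MAX m\<in>{n..N}. P.S m \<omega> / P.a m) \<ge> 1 - \<epsilon>}"
    let ?F = "\<lambda>N. {\<omega> \<in> space M. \<exists>m\<in>{n..N}. 1 - \<epsilon> \<le> P.S m \<omega> / P.a m}"
    have eq: "{\<omega> \<in> space M. (MAX m\<in>{n..N}. P.S m \<omega> / P.a m) \<ge> 1 - \<epsilon>} = ?F N" if "n \<le> N" for N
      using that by (auto simp: Max_ge_iff)
    have F: "?F N \<in> sets M" for N by measurable
    have f1: "?f N \<le> 1" if "N \<in> {n..}" for N
      using eq[of N] P.capacity_bounds[OF F, of N] that by simp
    \<comment> \<open>A single horizon suffices, since the supremum lies between its value and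
      1.\<close>
    obtain N where N: "n \<le> N" "1 - r / 2 \<le> V {\<omega> \<in> space M. \<exists>m\<in>{n..N}. (1 - \<epsilon>') * P.a m \<le> P.S m \<omega>}"
      using P.lower_bound[OF neg \<epsilon>'(1,2) r2] by blast
    have sub: "{\<omega> \<in> space M. \<exists>m\<in>{n..N}. (1 - \<epsilon>') * P.a m \<le> P.S m \<omega>} \<subseteq> ?F N"
    proof
      fix \<omega> assume "\<omega> \<in> {\<omega> \<in> space M. \<exists>m\<in>{n..N}. (1 - \<epsilon>') * P.a m \<le> P.S m \<omega>}"
      then obtain m where m: "\<omega> \<in> space M" "m \<in> {n..N}" "(1 - \<epsilon>') * P.a m \<le> P.S m \<omega>" by blast
      have am: "0 < P.a m" using n2 m n by simp
      have "(1 - \<epsilon>) * P.a m \<le> (1 - \<epsilon>') * P.a m" using \<epsilon>' am by (intro mult_right_mono) auto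
      then have "(1 - \<epsilon>) * P.a m \<le> P.S m \<omega>" using m(3) by linarith
      then have "1 - \<epsilon> \<le> P.S m \<omega> / P.a m" using am by (simp only: pos_le_divide_eq)
      then show "\<omega> \<in> ?F N" using m by blast
    qed
    have "{\<omega> \<in> space M. \<exists>m\<in>{n..N}. (1 - \<epsilon>') * P.a m \<le> P.S m \<omega>} \<in> sets M" by measurable
    then have "V {\<omega> \<in> space M. \<exists>m\<in>{n..N}. (1 - \<epsilon>') * P.a m \<le> P.S m \<omega>} \<le> V (?F N)"
      using P.cap F sub unfolding subadditive_capacity_def capacity_def by blast
    then have "1 - r / 2 \<le> ?f N" using N eq[OF N(1)] by simp
    also have "\<dots> \<le> (SUP N\<in>{n..}. ?f N)"
      using N(1) f1 by (intro cSUP_upper bdd_aboveI2[where M = 1]) auto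
    finally have "1 - r / 2 \<le> (SUP N\<in>{n..}. ?f N)" .
    moreover have "(SUP N\<in>{n..}. ?f N) \<le> 1" by (intro cSUP_least f1) auto
    ultimately show "norm ((SUP N\<in>{n..}. ?f N) - 1) < r" using r by (simp add: abs_less_iff)
  qed
qed

text \<open>A limsup beyond 1 means exceeding some \<open>1 + 1 / Suc k\<close> infinitely often,
  and for each \<open>k\<close> that event lies in the union of arbitrarily small covers.\<close>

lemma limsup_null: "V_hat_star M H E {\<omega> \<in> space M. limsup (\<lambda>n. ereal (\<bar>P.S n \<omega>\<bar> / P.a n)) > 1} = 0"
proof -
  define F where "F k = {\<omega> \<in> space M. \<forall>n. \<exists>m\<ge>n. 1 + 1 / real (Suc k) < \<bar>P.S m \<omega>\<bar> / P.a m}" for k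
  obtain n2 where n2: "\<And>n. n2 \<le> n \<Longrightarrow> 0 < P.a n"
    using P.eventually_a_pos unfolding eventually_sequentially by blast
  have "V_hat_star M H E (\<Union>k. F k) = 0"
  proof (rule P.V_hat_star_countable_null)
    fix k and \<eta> :: real assume \<eta>: "0 < \<eta>"
    let ?e = "1 / real (Suc k)"
    obtain n1 where n1: "P.small_cover \<eta> (\<lambda>m. if n1 \<le> m then {\<omega> \<in> space M. (1 + ?e) * P.a m < \<bar>P.S m \<omega>\<bar>} else {})"
      using two_sided_small_cover[of ?e, OF _ _ \<eta>] by auto
    have "F k \<subseteq> (\<Union>m. if n1 \<le> m then {\<omega> \<in> space M. (1 + ?e) * P.a m < \<bar>P.S m \<omega>\<bar>} else {})"
    proof
      fix \<omega> assume w: "\<omega> \<in> F k"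
      then obtain m where m: "max n1 n2 \<le> m" "1 + ?e < \<bar>P.S m \<omega>\<bar> / P.a m" unfolding F_def by blast
      have "(1 + ?e) * P.a m < \<bar>P.S m \<omega>\<bar>"
        using m n2[of m] by (simp add: pos_less_divide_eq del: of_nat_Suc)
      then show "\<omega> \<in> (\<Union>m. if n1 \<le> m then {\<omega> \<in> space M. (1 + ?e) * P.a m < \<bar>P.S m \<omega>\<bar>} else {})"
        using w m by (intro UN_I[of m]) (auto simp: F_def)
    qed
    then show "\<exists>A. P.small_cover \<eta> A \<and> F k \<subseteq> (\<Union>n. A n)" using n1 by blast
  qed
  moreover have "{\<omega> \<in> space M. limsup (\<lambda>n. ereal (\<bar>P.S n \<omega>\<bar> / P.a n)) > 1} \<subseteq> (\<Union>k. F k)"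
  proof
    fix \<omega> assume w: "\<omega> \<in> {\<omega> \<in> space M. limsup (\<lambda>n. ereal (\<bar>P.S n \<omega>\<bar> / P.a n)) > 1}"
    then obtain y where y: "1 < ereal y" "ereal y < limsup (\<lambda>n. ereal (\<bar>P.S n \<omega>\<bar> / P.a n))"
      using ereal_dense2[of 1] by blast
    then have "0 < y - 1" by (simp add: one_ereal_def)
    then obtain k where k: "inverse (real (Suc k)) < y - 1" using reals_Archimedean by blast
    have "\<exists>m\<ge>n. 1 + 1 / real (Suc k) < \<bar>P.S m \<omega>\<bar> / P.a m" for n
    proof (rule ccontr)
      assume "\<not> ?thesis"
      then have "\<forall>\<^sub>F m in sequentially. ereal (\<bar>P.S m \<omega>\<bar> / P.a m) \<le> ereal y"
        unfolding eventually_sequentially using k by (intro exI[of _ n]) (force simp: not_less inverse_eq_divide)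
      then have "limsup (\<lambda>n. ereal (\<bar>P.S n \<omega>\<bar> / P.a n)) \<le> ereal y" by (rule Limsup_bounded)
      then show False using y by simp
    qed
    then show "\<omega> \<in> (\<Union>k. F k)" using w by (auto simp: F_def)
  qed
  ultimately have "V_hat_star M H E {\<omega> \<in> space M. limsup (\<lambda>n. ereal (\<bar>P.S n \<omega>\<bar> / P.a n)) > 1} \<le> 0"
    using P.V_hat_star_mono[of _ "\<Union>k. F k"] by simp
  then show ?thesis by (rule antisym[OF _ P.V_hat_star_nonneg])
qed

end

theorem theorem5p2:
  fixes M :: "'a measure" and H :: "('a \<Rightarrow> real) set" and E :: "('a \<Rightarrow> real) \<Rightarrow> ereal"
    and V :: "'a set \<Rightarrow> real" and X :: "nat \<Rightarrow> 'a \<Rightarrow> real"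
  defines "S \<equiv> partial_sum X" and "s \<equiv> s_seq E X" and "a \<equiv> a_seq E X"
  assumes "sublinear_expectation_space M H E"
    and "independent_seq H E X"
    and "\<And>n. n \<ge> 1 \<Longrightarrow> E (\<lambda>\<omega>. (X n \<omega>)\<^sup>2) < \<infinity>"
    and "subadditive_capacity M V"
    and "property_C M H E V"
    and "\<And>\<epsilon>::real. \<epsilon> > 0 \<Longrightarrow>
           (\<Sum>n. ereal (V {\<omega> \<in> space M. \<bar>X (Suc n) \<omega>\<bar> \<ge> \<epsilon> * a (Suc n)})) < \<infinity>"
    and "\<And>\<alpha>::real. \<alpha> > 0 \<Longrightarrow> \<exists>p\<ge>2. \<exists>d\<ge>0.
           (\<Sum>n. Gamma_trunc E X (Suc n) p \<alpha> / ereal (a (Suc n) powr p) *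
                 ereal_powr (Lambda_trunc E X (Suc n) p \<alpha> / ereal (a (Suc n) powr p)) d) < \<infinity>"
    and "\<And>\<delta>::real. \<delta> > 0 \<Longrightarrow>
           (\<Sum>n. ereal (1 / (s (Suc n))\<^sup>2 * Log ((s (Suc n))\<^sup>2) powr (\<delta> - 1))
                 * E (\<lambda>\<omega>. (X (Suc n) \<omega>)\<^sup>2)) = \<infinity>"
    and "(\<lambda>n. ((\<Sum>j=1..n. \<bar>E (X j)\<bar>) + (\<Sum>j=1..n. \<bar>conjugate_expectation E (X j)\<bar>)) / ereal (a n))
           \<longlonglongrightarrow> 0"
  shows "(\<forall>\<epsilon>>0.
            (\<lambda>n. SUP N\<in>{n..}. V {\<omega> \<in> space M. (MAX m\<in>{n..N}. \<bar>S m \<omega>\<bar> / a m) > 1 + \<epsilon>}) \<longlonglongrightarrow> 0 \<and>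
            (\<lambda>n. SUP N\<in>{n..}. V {\<omega> \<in> space M. (MAX m\<in>{n..N}. - S m \<omega> / a m) \<ge> 1 - \<epsilon>}) \<longlonglongrightarrow> 1 \<and>
            (\<lambda>n. SUP N\<in>{n..}. V {\<omega> \<in> space M. (MAX m\<in>{n..N}. S m \<omega> / a m) \<ge> 1 - \<epsilon>}) \<longlonglongrightarrow> 1) \<and>
         V_hat_star M H E {\<omega> \<in> space M. limsup (\<lambda>n. ereal (\<bar>S n \<omega>\<bar> / a n)) > 1} = 0"
proof -
  note facts = assms[unfolded S_def s_def a_def]
  have "independent_square_integrable M H E X"
    by (rule independent_square_integrable.intro[OF facts(4)], unfold_locales) (rule facts | assumption)+
  then have hyp: "lil_hypotheses M H E X V"
    by (rule lil_hypotheses.intro, unfold_locales) (rule facts | assumption)+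
  interpret L: lil_two_sided M H E X V
    by (rule lil_two_sided.intro[OF hyp lil_hypotheses.uminus[OF hyp]])
  \<comment> \<open>Its lower half is the claim about \<open>- S\<close>; reflecting twice returns
    \<open>X\<close>.\<close>
  interpret N: lil_two_sided M H E "\<lambda>n \<omega>. - X n \<omega>" V
    by (rule lil_two_sided.intro[OF lil_hypotheses.uminus[OF hyp]]) (use hyp in simp)
  show ?thesis
    unfolding S_def a_def L.P.partial_sum_eq L.P.a_seq_eq
    using L.upper_limit L.lower_limit N.lower_limit[unfolded L.Q_a L.Q_S] L.limsup_null by blast
qed

end
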